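(* A double category $\mathbb{D}$ is isomorphic to the classifying double category of its horizontal category, i.e. to $\mathcal{H}(\mathbb{D})\rtimes_I\mathrm{iso}\,\mathcal{H}(\mathbb{D})$, if and only if it is $\{\mathsf{simp},\mathsf{trunc}_h,\mathbb{V}(\mathsf{inv}),\mathsf{rotfold},\mathsf{hiso}\}$-local and either strictly $\mathsf{rot}_{\lrcorner}$-local or strictly $\mathsf{rot}_{\ulcorner}$-local.
   Context: A double category $\mathbb{D}$ has objects, horizontal morphisms (forming a category $\mathcal{H}(\mathbb{D})$), vertical morphisms (forming a category $\mathcal{V}(\mathbb{D})$ with the same objects), and squares; a square written (top $f$; left $h$; right $k$; bottom $g$) has boundary $f\colon A\to B$, $g\colon C\to D$ horizontal and $h\colon A\to C$, $k\colon B\to D$ vertical. Squares compose horizontally and vertically, with identities, subject to unit, associativity and interchange laws. For a set $S$ of morphisms in a category, an object $X$ is $S$-local if for each $i\colon A\to B$ in $S$ every morphism $A\to X$ extends along $i$ to a morphism $B\to X$; it is strictly $S$-local if the extension is always unique. Here this is applied in the category of double categories and double functors. For an identity-on-objects functor $F\colon\mathcal{C}'\to\mathcal{C}$, the double category $\mathcal{C}\rtimes_F\mathcal{C}'$ has the objects of $\mathcal{C}$, horizontal morphisms those of $\mathcal{C}$, vertical morphisms those of $\mathcal{C}'$, and exactly one square (top $f$; left $g$; right $h$; bottom $j$) whenever $F(h)f=jF(g)$. The classifying double category of $\mathcal{C}$ is $\mathcal{C}\rtimes_I\mathrm{iso}\,\mathcal{C}$, where $I\colon\mathrm{iso}\,\mathcal{C}\to\mathcal{C}$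 is the inclusion of the maximal subgroupoid. For a category $\mathcal{C}$, $\mathbb{H}(\mathcal{C})$ (resp. $\mathbb{V}(\mathcal{C})$) is the double category with the morphisms of $\mathcal{C}$ as horizontal (resp. vertical) morphisms, and only identity vertical (resp. horizontal) morphisms and identity squares. $[1]=\{0\to 1\}$; $[1]\boxtimes[1]$ is the free double category on a single square; $\mathcal{E}$ is the category with two objects $0,1$, one morphism $0\to1$ and one morphism $1\to0$ besides identities (the walking isomorphism). The double functors are (all identity on objects, except where evident): - $\mathsf{simp}\colon\mathbb{D}'\to[1]\boxtimes[1]$, where $\mathbb{D}'$ has the same objects and morphisms as $[1]\boxtimes[1]$ but two nontrivial squares with the same boundary, both sent to the square. - $\mathsf{trunc}_h$: from the double category freely generated by objects $0,1$, horizontal $\alpha,\beta\colon0\to1$ and a square (top $\alpha$; left $\mathrm{id}_0$; right $\mathrm{id}_1$; bottom $\beta$), to $\mathbb{H}([1])$, sending the square to the identity square. - $\mathsf{rot}_{\lrcorner}$: from $\mathbb{V}([1])$ to the double category freely generated by a horizontal $a\colon0\to1$, a vertical $u\colon0\to1$ and a square (top $a$; left $u$; right $\mathrm{id}_1$; bottom $\mathrm{id}_1$), sending the vertical morphism to $u$. - $\mathsf{rot}_{\ulcorner}$: from $\mathbb{V}([1])$ to the double category freely generated by a horizontal $a\colon0\to1$, a vertical $u\colon0\to1$ and a square (top $\mathrm{id}_0$; left $\mathrm{id}_0$; right $u$; bottom $a$), sending the vertical morphism to $u$. - $\mathbb{V}(\mathsf{inv})\colon\mathbb{V}([1])\to\mathbb{V}(\mathcal{E})$,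 induced by the identity-on-objects functor $\mathsf{inv}\colon[1]\to\mathcal{E}$. - $\mathsf{rotfold}$: from the double category freely generated by a horizontal $h\colon0\to1$, vertical $f,g\colon0\to1$ and squares (top $h$; left $f$; right $\mathrm{id}_1$; bottom $\mathrm{id}_1$), (top $h$; left $g$; right $\mathrm{id}_1$; bottom $\mathrm{id}_1$), to the codomain of $\mathsf{rot}_{\lrcorner}$, sending $h\mapsto a$ and $f,g\mapsto u$. - $\mathsf{hiso}\colon\mathbb{H}(\mathcal{E})\to\mathcal{E}\rtimes_{\mathrm{id}}\mathcal{E}$, the inclusion of the horizontal morphisms. *)

theory Defs
  imports Main
begin

section \<open>Categories and functors\<close>

text \<open>Composition is written in functional order: \<open>cmp C g f\<close> is ``\<open>g\<close> after \<open>f\<close>'' and is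
  meaningful when \<open>src C g = tgt C f\<close>. All operations are relevant on the carriers only.\<close>

record ('o, 'm) cat =
  Obj :: "'o set"
  Arr :: "'m set"
  src :: "'m \<Rightarrow> 'o"
  tgt :: "'m \<Rightarrow> 'o"
  idn :: "'o \<Rightarrow> 'm"
  cmp :: "'m \<Rightarrow> 'm \<Rightarrow> 'm"

locale category =
  fixes C :: "('o, 'm) cat"
  assumes src_Obj: "f \<in> Arr C \<Longrightarrow> src C f \<in> Obj C"
    and tgt_Obj: "f \<in> Arr C \<Longrightarrow> tgt C f \<in> Obj C"
    and idn_Arr: "x \<in> Obj C \<Longrightarrow> idn C x \<in> Arr C"
    and src_idn: "x \<in> Obj C \<Longrightarrow> src C (idn C x) = x"
    and tgt_idn: "x \<in> Obj C \<Longrightarrow> tgt C (idn C x) = x"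
    and cmp_Arr: "\<lbrakk>f \<in> Arr C; g \<in> Arr C; src C g = tgt C f\<rbrakk> \<Longrightarrow> cmp C g f \<in> Arr C"
    and src_cmp: "\<lbrakk>f \<in> Arr C; g \<in> Arr C; src C g = tgt C f\<rbrakk> \<Longrightarrow> src C (cmp C g f) = src C f"
    and tgt_cmp: "\<lbrakk>f \<in> Arr C; g \<in> Arr C; src C g = tgt C f\<rbrakk> \<Longrightarrow> tgt C (cmp C g f) = tgt C g"
    and cmp_idn_left: "f \<in> Arr C \<Longrightarrow> cmp C (idn C (tgt C f)) f = f"
    and cmp_idn_right: "f \<in> Arr C \<Longrightarrow> cmp C f (idn C (src C f)) = f"
    and cmp_assoc: "\<lbrakk>f \<in> Arr C; g \<in> Arr C; h \<in> Arr C; src C g = tgt C f; src C h = tgt C g\<rbrakk>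
      \<Longrightarrow> cmp C h (cmp C g f) = cmp C (cmp C h g) f"

locale cat_functor =
  fixes C :: "('o, 'm) cat" and C' :: "('p, 'n) cat" and Fo :: "'o \<Rightarrow> 'p" and Fm :: "'m \<Rightarrow> 'n"
  assumes map_Obj: "x \<in> Obj C \<Longrightarrow> Fo x \<in> Obj C'"
    and map_Arr: "f \<in> Arr C \<Longrightarrow> Fm f \<in> Arr C'"
    and map_src: "f \<in> Arr C \<Longrightarrow> src C' (Fm f) = Fo (src C f)"
    and map_tgt: "f \<in> Arr C \<Longrightarrow> tgt C' (Fm f) = Fo (tgt C f)"
    and map_idn: "x \<in> Obj C \<Longrightarrow> Fm (idn C x) = idn C' (Fo x)"
    and map_cmp: "\<lbrakk>f \<in> Arr C; g \<in> Arr C; src C g = tgt C f\<rbrakk>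
      \<Longrightarrow> Fm (cmp C g f) = cmp C' (Fm g) (Fm f)"

definition iso_arr :: "('o, 'm) cat \<Rightarrow> 'm \<Rightarrow> bool" where
  "iso_arr C f \<longleftrightarrow> f \<in> Arr C \<and>
    (\<exists>g \<in> Arr C. src C g = tgt C f \<and> tgt C g = src C f \<and>
       cmp C g f = idn C (src C f) \<and> cmp C f g = idn C (tgt C f))"

definition iso_cat :: "('o, 'm) cat \<Rightarrow> ('o, 'm) cat" where
  "iso_cat C = C\<lparr>Arr := {f. iso_arr C f}\<rparr>"

text \<open>The category on \<open>A\<close> with one arrow \<open>(x, y) : x \<rightarrow> y\<close> for each related pair.\<close>

definition thin_cat :: "'a set \<Rightarrow> ('a \<Rightarrow> 'a \<Rightarrow> bool) \<Rightarrow> ('a, 'a \<times> 'a) cat" where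
  "thin_cat A r = \<lparr>Obj = A, Arr = {(x, y). x \<in> A \<and> y \<in> A \<and> r x y}, src = fst, tgt = snd,
     idn = (\<lambda>x. (x, x)), cmp = (\<lambda>g f. (fst f, snd g))\<rparr>"

definition interval_cat :: "(nat, nat \<times> nat) cat" where
  "interval_cat = thin_cat {0, 1} (\<le>)"

definition walking_iso :: "(nat, nat \<times> nat) cat" where
  "walking_iso = thin_cat {0, 1} (\<lambda>_ _. True)"


section \<open>Double categories and double functors\<close>

text \<open>\<open>hid\<close> sends a vertical morphism to its identity square for horizontal composition, and
  \<open>vid\<close> sends a horizontal morphism to its identity square for vertical composition. Squares
  compose in functional order as well: in \<open>hcomp D b a\<close> the square \<open>a\<close> is to the left of \<open>b\<close>, and
  in \<open>vcomp D b a\<close> the square \<open>a\<close> is above \<open>b\<close>.\<close>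

record ('o, 'h, 'v, 's) dblcat =
  hcat :: "('o, 'h) cat"
  vcat :: "('o, 'v) cat"
  Sq :: "'s set"
  sqtop :: "'s \<Rightarrow> 'h"
  sqbot :: "'s \<Rightarrow> 'h"
  sqleft :: "'s \<Rightarrow> 'v"
  sqright :: "'s \<Rightarrow> 'v"
  hid :: "'v \<Rightarrow> 's"
  vid :: "'h \<Rightarrow> 's"
  hcomp :: "'s \<Rightarrow> 's \<Rightarrow> 's"
  vcomp :: "'s \<Rightarrow> 's \<Rightarrow> 's"

definition hsq_cat :: "('o, 'h, 'v, 's) dblcat \<Rightarrow> ('v, 's) cat" where
  "hsq_cat D = \<lparr>Obj = Arr (vcat D), Arr = Sq D, src = sqleft D, tgt = sqright D,
     idn = hid D, cmp = hcomp D\<rparr>"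

definition vsq_cat :: "('o, 'h, 'v, 's) dblcat \<Rightarrow> ('h, 's) cat" where
  "vsq_cat D = \<lparr>Obj = Arr (hcat D), Arr = Sq D, src = sqtop D, tgt = sqbot D,
     idn = vid D, cmp = vcomp D\<rparr>"

text \<open>The unit and associativity laws for squares are those of \<open>hsq_cat\<close> and \<open>vsq_cat\<close>. The
  functors express the shape of the boundary of a square, the boundaries of composites and of
  identity squares, and the compatibility of identity squares with composition; in particular
  \<open>hid\<close> preserving identities says that the two identity squares on an object agree.\<close>

locale double_category =
  fixes D :: "('o, 'h, 'v, 's) dblcat"
  assumes hcat: "category (hcat D)"
    and vcat: "category (vcat D)"
    and same_Obj: "Obj (vcat D) = Obj (hcat D)"
    and hsq_cat: "category (hsq_cat D)"
    and vsq_cat: "category (vsq_cat D)"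
    and top_functor: "cat_functor (hsq_cat D) (hcat D) (src (vcat D)) (sqtop D)"
    and bot_functor: "cat_functor (hsq_cat D) (hcat D) (tgt (vcat D)) (sqbot D)"
    and left_functor: "cat_functor (vsq_cat D) (vcat D) (src (hcat D)) (sqleft D)"
    and right_functor: "cat_functor (vsq_cat D) (vcat D) (tgt (hcat D)) (sqright D)"
    and hid_functor: "cat_functor (vcat D) (vsq_cat D) (idn (hcat D)) (hid D)"
    and vid_functor: "cat_functor (hcat D) (hsq_cat D) (idn (vcat D)) (vid D)"
    and interchange: "\<lbrakk>a \<in> Sq D; b \<in> Sq D; c \<in> Sq D; d \<in> Sq D;
        sqleft D c = sqright D a; sqleft D d = sqright D b; sqtop D b = sqbot D a; sqtop D d = sqbot D c\<rbrakk>
      \<Longrightarrow> hcomp D (vcomp D d c) (vcomp D b a) = vcomp D (hcomp D d b) (hcomp D c a)"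

record ('o, 'h, 'v, 's, 'o1, 'h1, 'v1, 's1) dfun =
  ob :: "'o \<Rightarrow> 'o1"
  hor :: "'h \<Rightarrow> 'h1"
  ver :: "'v \<Rightarrow> 'v1"
  sqr :: "'s \<Rightarrow> 's1"

locale double_functor =
  fixes D :: "('o, 'h, 'v, 's) dblcat" and E :: "('o1, 'h1, 'v1, 's1) dblcat"
    and F :: "('o, 'h, 'v, 's, 'o1, 'h1, 'v1, 's1) dfun"
  assumes hor_functor: "cat_functor (hcat D) (hcat E) (ob F) (hor F)"
    and ver_functor: "cat_functor (vcat D) (vcat E) (ob F) (ver F)"
    and hsq_functor: "cat_functor (hsq_cat D) (hsq_cat E) (ver F) (sqr F)"
    and vsq_functor: "cat_functor (vsq_cat D) (vsq_cat E) (hor F) (sqr F)"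

definition dfun_id :: "('o, 'h, 'v, 's, 'o, 'h, 'v, 's) dfun" where
  "dfun_id = \<lparr>ob = id, hor = id, ver = id, sqr = id\<rparr>"

definition dfun_comp :: "('o1, 'h1, 'v1, 's1, 'o2, 'h2, 'v2, 's2) dfun \<Rightarrow>
    ('o, 'h, 'v, 's, 'o1, 'h1, 'v1, 's1) dfun \<Rightarrow> ('o, 'h, 'v, 's, 'o2, 'h2, 'v2, 's2) dfun" where
  "dfun_comp G F = \<lparr>ob = ob G \<circ> ob F, hor = hor G \<circ> hor F, ver = ver G \<circ> ver F, sqr = sqr G \<circ> sqr F\<rparr>"

text \<open>Double functors out of \<open>D\<close> are equal when they agree on the carriers of \<open>D\<close>.\<close>

definition dfun_eq :: "('o, 'h, 'v, 's) dblcat \<Rightarrow> ('o, 'h, 'v, 's, 'o1, 'h1, 'v1, 's1) dfun \<Rightarrow>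
    ('o, 'h, 'v, 's, 'o1, 'h1, 'v1, 's1) dfun \<Rightarrow> bool" where
  "dfun_eq D F G \<longleftrightarrow>
    (\<forall>x \<in> Obj (hcat D). ob F x = ob G x) \<and>
    (\<forall>f \<in> Arr (hcat D). hor F f = hor G f) \<and>
    (\<forall>u \<in> Arr (vcat D). ver F u = ver G u) \<and>
    (\<forall>a \<in> Sq D. sqr F a = sqr G a)"

definition dbl_isomorphic :: "('o, 'h, 'v, 's) dblcat \<Rightarrow> ('o1, 'h1, 'v1, 's1) dblcat \<Rightarrow> bool" where
  "dbl_isomorphic D E \<longleftrightarrow> (\<exists>F G. double_functor D E F \<and> double_functor E D G \<and>
     dfun_eq D (dfun_comp G F) dfun_id \<and> dfun_eq E (dfun_comp F G) dfun_id)"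

text \<open>Locality of \<open>X\<close> with respect to a single double functor \<open>i : A \<rightarrow> B\<close>. Locality with respect to
  a set is locality with respect to each member; the members of the sets needed here have
  different types, so this is written as a conjunction.\<close>

definition is_local :: "('o, 'h, 'v, 's) dblcat \<Rightarrow> ('o1, 'h1, 'v1, 's1) dblcat \<Rightarrow>
    ('o, 'h, 'v, 's, 'o1, 'h1, 'v1, 's1) dfun \<Rightarrow> ('o2, 'h2, 'v2, 's2) dblcat \<Rightarrow> bool" where
  "is_local A B i X \<longleftrightarrow> (\<forall>F. double_functor A X F \<longrightarrow>
     (\<exists>G. double_functor B X G \<and> dfun_eq A (dfun_comp G i) F))"

definition is_strictly_local :: "('o, 'h, 'v, 's) dblcat \<Rightarrow> ('o1, 'h1, 'v1, 's1) dblcat \<Rightarrow>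
    ('o, 'h, 'v, 's, 'o1, 'h1, 'v1, 's1) dfun \<Rightarrow> ('o2, 'h2, 'v2, 's2) dblcat \<Rightarrow> bool" where
  "is_strictly_local A B i X \<longleftrightarrow> (\<forall>F. double_functor A X F \<longrightarrow>
     (\<exists>G. double_functor B X G \<and> dfun_eq A (dfun_comp G i) F \<and>
        (\<forall>G'. double_functor B X G' \<and> dfun_eq A (dfun_comp G' i) F \<longrightarrow> dfun_eq B G G')))"


section \<open>Double categories built from categories\<close>

text \<open>\<open>semidirect C F C'\<close> is $C \rtimes_F C'$ for a functor that is the identity on objects and \<open>F\<close> on
  arrows. Squares are tuples (top, left, right, bottom).\<close>

definition semidirect :: "('o, 'm) cat \<Rightarrow> ('n \<Rightarrow> 'm) \<Rightarrow> ('o, 'n) cat \<Rightarrow>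
    ('o, 'm, 'n, 'm \<times> 'n \<times> 'n \<times> 'm) dblcat" where
  "semidirect C F C' = \<lparr>hcat = C, vcat = C',
     Sq = {(f, g, h, j). f \<in> Arr C \<and> j \<in> Arr C \<and> g \<in> Arr C' \<and> h \<in> Arr C' \<and>
             src C' g = src C f \<and> src C' h = tgt C f \<and> tgt C' g = src C j \<and> tgt C' h = tgt C j \<and>
             cmp C (F h) f = cmp C j (F g)},
     sqtop = (\<lambda>(f, g, h, j). f), sqbot = (\<lambda>(f, g, h, j). j),
     sqleft = (\<lambda>(f, g, h, j). g), sqright = (\<lambda>(f, g, h, j). h),
     hid = (\<lambda>u. (idn C (src C' u), u, u, idn C (tgt C' u))),
     vid = (\<lambda>f. (f, idn C' (src C f), idn C' (tgt C f), f)),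
     hcomp = (\<lambda>(f', g', h', j') (f, g, h, j). (cmp C f' f, g, h', cmp C j' j)),
     vcomp = (\<lambda>(f', g', h', j') (f, g, h, j). (f, cmp C' g' g, cmp C' h' h, j'))\<rparr>"

definition classifying :: "('o, 'm) cat \<Rightarrow> ('o, 'm, 'm, 'm \<times> 'm \<times> 'm \<times> 'm) dblcat" where
  "classifying C = semidirect C (\<lambda>f. f) (iso_cat C)"

definition discrete_cat :: "'o set \<Rightarrow> ('o, 'o) cat" where
  "discrete_cat A = \<lparr>Obj = A, Arr = A, src = (\<lambda>x. x), tgt = (\<lambda>x. x), idn = (\<lambda>x. x), cmp = (\<lambda>y x. x)\<rparr>"

text \<open>In \<open>HH C\<close> the vertical (identity) morphism on \<open>x\<close> is encoded by \<open>x\<close>, and the square encoded by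
  an arrow of \<open>C\<close> is its vertical identity square; \<open>VV C\<close> is the transpose.\<close>

definition HH :: "('o, 'm) cat \<Rightarrow> ('o, 'm, 'o, 'm) dblcat" where
  "HH C = \<lparr>hcat = C, vcat = discrete_cat (Obj C), Sq = Arr C,
     sqtop = (\<lambda>f. f), sqbot = (\<lambda>f. f), sqleft = src C, sqright = tgt C,
     hid = idn C, vid = (\<lambda>f. f), hcomp = cmp C, vcomp = (\<lambda>g f. f)\<rparr>"

definition VV :: "('o, 'm) cat \<Rightarrow> ('o, 'o, 'm, 'm) dblcat" where
  "VV C = \<lparr>hcat = discrete_cat (Obj C), vcat = C, Sq = Arr C,
     sqtop = src C, sqbot = tgt C, sqleft = (\<lambda>f. f), sqright = (\<lambda>f. f),
     hid = (\<lambda>f. f), vid = idn C, hcomp = (\<lambda>g f. f), vcomp = cmp C\<rparr>"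

text \<open>The action of \<open>VV\<close> on functors.\<close>

definition VV_map :: "('o \<Rightarrow> 'p) \<Rightarrow> ('m \<Rightarrow> 'n) \<Rightarrow> ('o, 'o, 'm, 'm, 'p, 'p, 'n, 'n) dfun" where
  "VV_map Fo Fm = \<lparr>ob = Fo, hor = Fo, ver = Fm, sqr = Fm\<rparr>"


section \<open>Freely generated double categories\<close>

record ('o, 'e) graph =
  Verts :: "'o set"
  Edges :: "'e set"
  esrc :: "'e \<Rightarrow> 'o"
  etgt :: "'e \<Rightarrow> 'o"

text \<open>A path is its start vertex with its edges listed in the order in which they are traversed;
  \<open>(x, [])\<close> is the identity on \<open>x\<close>.\<close>

type_synonym ('o, 'e) path = "'o \<times> 'e list"

fun walk :: "('o, 'e) graph \<Rightarrow> 'o \<Rightarrow> 'e list \<Rightarrow> bool" where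
  "walk G x [] \<longleftrightarrow> x \<in> Verts G"
| "walk G x (e # es) \<longleftrightarrow> x \<in> Verts G \<and> e \<in> Edges G \<and> esrc G e = x \<and> walk G (etgt G e) es"

fun walk_end :: "('o, 'e) graph \<Rightarrow> 'o \<Rightarrow> 'e list \<Rightarrow> 'o" where
  "walk_end G x [] = x"
| "walk_end G x (e # es) = walk_end G (etgt G e) es"

definition free_cat :: "('o, 'e) graph \<Rightarrow> ('o, ('o, 'e) path) cat" where
  "free_cat G = \<lparr>Obj = Verts G, Arr = {(x, p). walk G x p}, src = fst,
     tgt = (\<lambda>(x, p). walk_end G x p), idn = (\<lambda>x. (x, [])),
     cmp = (\<lambda>(y, q) (x, p). (x, p @ q))\<rparr>"

text \<open>Generators of a double category: objects, horizontal and vertical edges, and squares whose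
  boundaries are paths of edges, possibly identities. Both graphs are meant to have the same vertices,
  and the boundary paths of a square to fit together at its corners.\<close>

record ('o, 'x, 'y, 'z) computad =
  hgraph :: "('o, 'x) graph"
  vgraph :: "('o, 'y) graph"
  Gsq :: "'z set"
  gtop :: "'z \<Rightarrow> ('o, 'x) path"
  gbot :: "'z \<Rightarrow> ('o, 'x) path"
  gleft :: "'z \<Rightarrow> ('o, 'y) path"
  gright :: "'z \<Rightarrow> ('o, 'y) path"

text \<open>Formal composites of generating squares and identity squares.\<close>

datatype ('o, 'x, 'y, 'z) sqterm =
    Gen 'z
  | HId "('o, 'y) path"
  | VId "('o, 'x) path"
  | HComp "('o, 'x, 'y, 'z) sqterm" "('o, 'x, 'y, 'z) sqterm"
  | VComp "('o, 'x, 'y, 'z) sqterm" "('o, 'x, 'y, 'z) sqterm"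

context
  fixes P :: "('o, 'x, 'y, 'z) computad"
begin

primrec ttop :: "('o, 'x, 'y, 'z) sqterm \<Rightarrow> ('o, 'x) path" where
  "ttop (Gen z) = gtop P z"
| "ttop (HId v) = idn (free_cat (hgraph P)) (src (free_cat (vgraph P)) v)"
| "ttop (VId f) = f"
| "ttop (HComp b a) = cmp (free_cat (hgraph P)) (ttop b) (ttop a)"
| "ttop (VComp b a) = ttop a"

primrec tbot :: "('o, 'x, 'y, 'z) sqterm \<Rightarrow> ('o, 'x) path" where
  "tbot (Gen z) = gbot P z"
| "tbot (HId v) = idn (free_cat (hgraph P)) (tgt (free_cat (vgraph P)) v)"
| "tbot (VId f) = f"
| "tbot (HComp b a) = cmp (free_cat (hgraph P)) (tbot b) (tbot a)"
| "tbot (VComp b a) = tbot b"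

primrec tleft :: "('o, 'x, 'y, 'z) sqterm \<Rightarrow> ('o, 'y) path" where
  "tleft (Gen z) = gleft P z"
| "tleft (HId v) = v"
| "tleft (VId f) = idn (free_cat (vgraph P)) (src (free_cat (hgraph P)) f)"
| "tleft (HComp b a) = tleft a"
| "tleft (VComp b a) = cmp (free_cat (vgraph P)) (tleft b) (tleft a)"

primrec tright :: "('o, 'x, 'y, 'z) sqterm \<Rightarrow> ('o, 'y) path" where
  "tright (Gen z) = gright P z"
| "tright (HId v) = v"
| "tright (VId f) = idn (free_cat (vgraph P)) (tgt (free_cat (hgraph P)) f)"
| "tright (HComp b a) = tright b"
| "tright (VComp b a) = cmp (free_cat (vgraph P)) (tright b) (tright a)"

primrec wf_term :: "('o, 'x, 'y, 'z) sqterm \<Rightarrow> bool" where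
  "wf_term (Gen z) \<longleftrightarrow> z \<in> Gsq P"
| "wf_term (HId v) \<longleftrightarrow> v \<in> Arr (free_cat (vgraph P))"
| "wf_term (VId f) \<longleftrightarrow> f \<in> Arr (free_cat (hgraph P))"
| "wf_term (HComp b a) \<longleftrightarrow> wf_term b \<and> wf_term a \<and> tleft b = tright a"
| "wf_term (VComp b a) \<longleftrightarrow> wf_term b \<and> wf_term a \<and> ttop b = tbot a"

text \<open>The congruence generated by the axioms of a double category.\<close>

inductive sq_eq :: "('o, 'x, 'y, 'z) sqterm \<Rightarrow> ('o, 'x, 'y, 'z) sqterm \<Rightarrow> bool" where
  sq_refl: "wf_term a \<Longrightarrow> sq_eq a a"
| sq_sym: "sq_eq a b \<Longrightarrow> sq_eq b a"
| sq_trans: "\<lbrakk>sq_eq a b; sq_eq b c\<rbrakk> \<Longrightarrow> sq_eq a c"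
| sq_HComp: "\<lbrakk>sq_eq a a'; sq_eq b b'; tleft b = tright a\<rbrakk> \<Longrightarrow> sq_eq (HComp b a) (HComp b' a')"
| sq_VComp: "\<lbrakk>sq_eq a a'; sq_eq b b'; ttop b = tbot a\<rbrakk> \<Longrightarrow> sq_eq (VComp b a) (VComp b' a')"
| sq_HComp_id_left: "wf_term a \<Longrightarrow> sq_eq (HComp (HId (tright a)) a) a"
| sq_HComp_id_right: "wf_term a \<Longrightarrow> sq_eq (HComp a (HId (tleft a))) a"
| sq_VComp_id_left: "wf_term a \<Longrightarrow> sq_eq (VComp (VId (tbot a)) a) a"
| sq_VComp_id_right: "wf_term a \<Longrightarrow> sq_eq (VComp a (VId (ttop a))) a"
| sq_HComp_assoc: "\<lbrakk>wf_term a; wf_term b; wf_term c; tleft b = tright a; tleft c = tright b\<rbrakk>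
    \<Longrightarrow> sq_eq (HComp c (HComp b a)) (HComp (HComp c b) a)"
| sq_VComp_assoc: "\<lbrakk>wf_term a; wf_term b; wf_term c; ttop b = tbot a; ttop c = tbot b\<rbrakk>
    \<Longrightarrow> sq_eq (VComp c (VComp b a)) (VComp (VComp c b) a)"
| sq_HId_cmp: "\<lbrakk>u \<in> Arr (free_cat (vgraph P)); v \<in> Arr (free_cat (vgraph P));
      src (free_cat (vgraph P)) v = tgt (free_cat (vgraph P)) u\<rbrakk>
    \<Longrightarrow> sq_eq (HId (cmp (free_cat (vgraph P)) v u)) (VComp (HId v) (HId u))"
| sq_VId_cmp: "\<lbrakk>f \<in> Arr (free_cat (hgraph P)); g \<in> Arr (free_cat (hgraph P));
      src (free_cat (hgraph P)) g = tgt (free_cat (hgraph P)) f\<rbrakk>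
    \<Longrightarrow> sq_eq (VId (cmp (free_cat (hgraph P)) g f)) (HComp (VId g) (VId f))"
| sq_HId_idn: "x \<in> Verts (hgraph P) \<Longrightarrow>
    sq_eq (HId (idn (free_cat (vgraph P)) x)) (VId (idn (free_cat (hgraph P)) x))"
| sq_interchange: "\<lbrakk>wf_term a; wf_term b; wf_term c; wf_term d;
      tleft c = tright a; tleft d = tright b; ttop b = tbot a; ttop d = tbot c\<rbrakk>
    \<Longrightarrow> sq_eq (HComp (VComp d c) (VComp b a)) (VComp (HComp d b) (HComp c a))"

definition sq_class :: "('o, 'x, 'y, 'z) sqterm \<Rightarrow> ('o, 'x, 'y, 'z) sqterm set" where
  "sq_class a = {b. sq_eq a b}"

end

definition sq_rep :: "('o, 'x, 'y, 'z) sqterm set \<Rightarrow> ('o, 'x, 'y, 'z) sqterm" where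
  "sq_rep A = (SOME a. a \<in> A)"

definition free_dbl :: "('o, 'x, 'y, 'z) computad \<Rightarrow>
    ('o, ('o, 'x) path, ('o, 'y) path, ('o, 'x, 'y, 'z) sqterm set) dblcat" where
  "free_dbl P = \<lparr>hcat = free_cat (hgraph P), vcat = free_cat (vgraph P),
     Sq = {sq_class P a |a. wf_term P a},
     sqtop = (\<lambda>A. ttop P (sq_rep A)), sqbot = (\<lambda>A. tbot P (sq_rep A)),
     sqleft = (\<lambda>A. tleft P (sq_rep A)), sqright = (\<lambda>A. tright P (sq_rep A)),
     hid = (\<lambda>v. sq_class P (HId v)), vid = (\<lambda>f. sq_class P (VId f)),
     hcomp = (\<lambda>B A. sq_class P (HComp (sq_rep B) (sq_rep A))),
     vcomp = (\<lambda>B A. sq_class P (VComp (sq_rep B) (sq_rep A)))\<rparr>"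

text \<open>The double functor out of a free double category determined by the images of the generators.\<close>

fun path_ext :: "('o1, 'm) cat \<Rightarrow> ('o \<Rightarrow> 'o1) \<Rightarrow> ('e \<Rightarrow> 'm) \<Rightarrow> ('o, 'e) path \<Rightarrow> 'm" where
  "path_ext C Fo Fe (x, p) = foldl (\<lambda>f e. cmp C (Fe e) f) (idn C (Fo x)) p"

primrec sq_ext :: "('o1, 'h1, 'v1, 's1) dblcat \<Rightarrow> ('o \<Rightarrow> 'o1) \<Rightarrow> ('x \<Rightarrow> 'h1) \<Rightarrow> ('y \<Rightarrow> 'v1) \<Rightarrow>
    ('z \<Rightarrow> 's1) \<Rightarrow> ('o, 'x, 'y, 'z) sqterm \<Rightarrow> 's1" where
  "sq_ext E Fo Fx Fy Fz (Gen z) = Fz z"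
| "sq_ext E Fo Fx Fy Fz (HId v) = hid E (path_ext (vcat E) Fo Fy v)"
| "sq_ext E Fo Fx Fy Fz (VId f) = vid E (path_ext (hcat E) Fo Fx f)"
| "sq_ext E Fo Fx Fy Fz (HComp b a) = hcomp E (sq_ext E Fo Fx Fy Fz b) (sq_ext E Fo Fx Fy Fz a)"
| "sq_ext E Fo Fx Fy Fz (VComp b a) = vcomp E (sq_ext E Fo Fx Fy Fz b) (sq_ext E Fo Fx Fy Fz a)"

definition free_ext :: "('o1, 'h1, 'v1, 's1) dblcat \<Rightarrow> ('o \<Rightarrow> 'o1) \<Rightarrow> ('x \<Rightarrow> 'h1) \<Rightarrow> ('y \<Rightarrow> 'v1) \<Rightarrow>
    ('z \<Rightarrow> 's1) \<Rightarrow>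
    ('o, ('o, 'x) path, ('o, 'y) path, ('o, 'x, 'y, 'z) sqterm set, 'o1, 'h1, 'v1, 's1) dfun" where
  "free_ext E Fo Fx Fy Fz = \<lparr>ob = Fo, hor = path_ext (hcat E) Fo Fx, ver = path_ext (vcat E) Fo Fy,
     sqr = (\<lambda>A. sq_ext E Fo Fx Fy Fz (sq_rep A))\<rparr>"


section \<open>The double functors defining the locality conditions\<close>

subsection \<open>simp\<close>

text \<open>The corner in row \<open>i\<close> and column \<open>j\<close> is \<open>(i, j)\<close>. The horizontal edge in row \<open>i\<close> and the
  vertical edge in column \<open>j\<close> are encoded by \<open>i\<close> and \<open>j\<close>. The generating squares are indexed by \<open>S\<close>
  and all have the same boundary: one square gives $[1] \boxtimes [1]$, two give the domain of \<open>simp\<close>.\<close>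

definition parallel_squares :: "nat set \<Rightarrow> (nat \<times> nat, nat, nat, nat) computad" where
  "parallel_squares S = \<lparr>
     hgraph = \<lparr>Verts = {0, 1} \<times> {0, 1}, Edges = {0, 1}, esrc = (\<lambda>i. (i, 0)), etgt = (\<lambda>i. (i, 1))\<rparr>,
     vgraph = \<lparr>Verts = {0, 1} \<times> {0, 1}, Edges = {0, 1}, esrc = (\<lambda>j. (0, j)), etgt = (\<lambda>j. (1, j))\<rparr>,
     Gsq = S,
     gtop = (\<lambda>_. ((0, 0), [0])), gbot = (\<lambda>_. ((1, 0), [1])),
     gleft = (\<lambda>_. ((0, 0), [0])), gright = (\<lambda>_. ((0, 1), [1]))\<rparr>"

abbreviation walking_square where
  "walking_square \<equiv> free_dbl (parallel_squares {0})"

abbreviation simp_dom where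
  "simp_dom \<equiv> free_dbl (parallel_squares {0, 1})"

definition simp_fun where
  "simp_fun = (free_ext walking_square (\<lambda>x. x) (\<lambda>i. ((i, 0), [i])) (\<lambda>j. ((0, j), [j]))
     (\<lambda>_. sq_class (parallel_squares {0}) (Gen 0))
     :: (nat \<times> nat, (nat \<times> nat, nat) path, (nat \<times> nat, nat) path, (nat \<times> nat, nat, nat, nat) sqterm set,
         nat \<times> nat, (nat \<times> nat, nat) path, (nat \<times> nat, nat) path, (nat \<times> nat, nat, nat, nat) sqterm set) dfun)"

subsection \<open>trunc\<close>

datatype trunc_edge = Alpha | Beta

definition trunc_h_gen :: "(nat, trunc_edge, unit, unit) computad" where
  "trunc_h_gen = \<lparr>
     hgraph = \<lparr>Verts = {0, 1}, Edges = UNIV, esrc = (\<lambda>_. 0), etgt = (\<lambda>_. 1)\<rparr>,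
     vgraph = \<lparr>Verts = {0, 1}, Edges = {}, esrc = (\<lambda>_. 0), etgt = (\<lambda>_. 0)\<rparr>,
     Gsq = UNIV,
     gtop = (\<lambda>_. (0, [Alpha])), gbot = (\<lambda>_. (0, [Beta])),
     gleft = (\<lambda>_. (0, [])), gright = (\<lambda>_. (1, []))\<rparr>"

abbreviation trunc_h_dom where
  "trunc_h_dom \<equiv> free_dbl trunc_h_gen"

abbreviation trunc_h_cod where
  "trunc_h_cod \<equiv> HH interval_cat"

text \<open>There are no vertical generators, so their images are irrelevant.\<close>

definition trunc_h_fun where
  "trunc_h_fun = (free_ext trunc_h_cod (\<lambda>x. x) (\<lambda>_. (0, 1)) (\<lambda>_. 0) (\<lambda>_. vid trunc_h_cod (0, 1))
     :: (nat, (nat, trunc_edge) path, (nat, unit) path, (nat, trunc_edge, unit, unit) sqterm set,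
         nat, nat \<times> nat, nat, nat \<times> nat) dfun)"

subsection \<open>rot and rotfold\<close>

text \<open>The functor from \<open>VV interval_cat\<close> to a free double category with objects \<open>0\<close>, \<open>1\<close> that sends the
  vertical morphism to the edge \<open>u : 0 \<rightarrow> 1\<close>.\<close>

definition vertical_pick :: "(nat, 'x, 'y, 'z) computad \<Rightarrow> 'y \<Rightarrow>
    (nat, nat, nat \<times> nat, nat \<times> nat,
     nat, (nat, 'x) path, (nat, 'y) path, (nat, 'x, 'y, 'z) sqterm set) dfun" where
  "vertical_pick P u = (let V = (\<lambda>(x, y). if x = y then (x, []) else (0, [u])) in
     \<lparr>ob = (\<lambda>x. x), hor = idn (hcat (free_dbl P)), ver = V, sqr = (\<lambda>m. hid (free_dbl P) (V m))\<rparr>)"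

abbreviation rot_dom where
  "rot_dom \<equiv> VV interval_cat"

definition rot_lr_gen :: "(nat, unit, unit, unit) computad" where
  "rot_lr_gen = \<lparr>
     hgraph = \<lparr>Verts = {0, 1}, Edges = UNIV, esrc = (\<lambda>_. 0), etgt = (\<lambda>_. 1)\<rparr>,
     vgraph = \<lparr>Verts = {0, 1}, Edges = UNIV, esrc = (\<lambda>_. 0), etgt = (\<lambda>_. 1)\<rparr>,
     Gsq = UNIV,
     gtop = (\<lambda>_. (0, [()])), gbot = (\<lambda>_. (1, [])),
     gleft = (\<lambda>_. (0, [()])), gright = (\<lambda>_. (1, []))\<rparr>"

abbreviation rot_lr_cod where
  "rot_lr_cod \<equiv> free_dbl rot_lr_gen"

definition rot_lr_fun where
  "rot_lr_fun = vertical_pick rot_lr_gen ()"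

definition rot_ul_gen :: "(nat, unit, unit, unit) computad" where
  "rot_ul_gen = \<lparr>
     hgraph = \<lparr>Verts = {0, 1}, Edges = UNIV, esrc = (\<lambda>_. 0), etgt = (\<lambda>_. 1)\<rparr>,
     vgraph = \<lparr>Verts = {0, 1}, Edges = UNIV, esrc = (\<lambda>_. 0), etgt = (\<lambda>_. 1)\<rparr>,
     Gsq = UNIV,
     gtop = (\<lambda>_. (0, [])), gbot = (\<lambda>_. (0, [()])),
     gleft = (\<lambda>_. (0, [])), gright = (\<lambda>_. (0, [()]))\<rparr>"

abbreviation rot_ul_cod where
  "rot_ul_cod \<equiv> free_dbl rot_ul_gen"

definition rot_ul_fun where
  "rot_ul_fun = vertical_pick rot_ul_gen ()"

datatype rotfold_edge = EdgeF | EdgeG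

text \<open>Each of the two generating squares is encoded by its left edge.\<close>

definition rotfold_gen :: "(nat, unit, rotfold_edge, rotfold_edge) computad" where
  "rotfold_gen = \<lparr>
     hgraph = \<lparr>Verts = {0, 1}, Edges = UNIV, esrc = (\<lambda>_. 0), etgt = (\<lambda>_. 1)\<rparr>,
     vgraph = \<lparr>Verts = {0, 1}, Edges = UNIV, esrc = (\<lambda>_. 0), etgt = (\<lambda>_. 1)\<rparr>,
     Gsq = UNIV,
     gtop = (\<lambda>_. (0, [()])), gbot = (\<lambda>_. (1, [])),
     gleft = (\<lambda>e. (0, [e])), gright = (\<lambda>_. (1, []))\<rparr>"

abbreviation rotfold_dom where
  "rotfold_dom \<equiv> free_dbl rotfold_gen"

definition rotfold_fun where
  "rotfold_fun = (free_ext rot_lr_cod (\<lambda>x. x) (\<lambda>_. (0, [()])) (\<lambda>_. (0, [()]))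
     (\<lambda>_. sq_class rot_lr_gen (Gen ()))
     :: (nat, (nat, unit) path, (nat, rotfold_edge) path, (nat, unit, rotfold_edge, rotfold_edge) sqterm set,
         nat, (nat, unit) path, (nat, unit) path, (nat, unit, unit, unit) sqterm set) dfun)"

subsection \<open>inv and hiso\<close>

text \<open>Both categories have arrows encoded by pairs of objects, so \<open>inv\<close> is an inclusion.\<close>

definition inv_fun where
  "inv_fun = (VV_map (\<lambda>x. x) (\<lambda>f. f)
     :: (nat, nat, nat \<times> nat, nat \<times> nat, nat, nat, nat \<times> nat, nat \<times> nat) dfun)"

abbreviation hiso_dom where
  "hiso_dom \<equiv> HH walking_iso"

abbreviation hiso_cod where
  "hiso_cod \<equiv> semidirect walking_iso (\<lambda>f. f) walking_iso"

definition hiso_fun where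
  "hiso_fun = \<lparr>ob = (\<lambda>x. x), hor = (\<lambda>f. f), ver = idn walking_iso, sqr = vid hiso_cod\<rparr>"

end

theory Submission
  imports Defs
begin

text \<open>By the universal property of free double categories, each locality condition is a condition on
  the squares of \<open>D\<close>; for instance \<open>simp\<close> says that a square is determined by its boundary, and
  \<open>trunc_h\<close> that a square with identity vertical sides is a vertical identity. A square with top \<open>a\<close>,
  left side \<open>u\<close> and identities on the right and at the bottom rotates the vertical \<open>u\<close> to the
  horizontal \<open>a\<close>. Pasting makes this rotation functorial, \<open>rotfold\<close> makes it faithful and \<open>hiso\<close>
  makes it full onto the horizontal isomorphisms. Rotating the right side of a square of \<open>D\<close> and
  pasting an inverse onto its left side leaves only identities as vertical sides, so the rotated
  boundary commutes by \<open>trunc_h\<close>; conversely a commuting boundary is filled by pasting rotation squares.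
  In the upper-left case the squares of the lower-right case are obtained by pasting with inverses.\<close>

section \<open>Functors and double functors\<close>

text \<open>Locality is invariant under isomorphism, so the forward implication is a computation in
  \<open>classifying C\<close>, where a square is its boundary. In the converse there are two
  obstacles: a vertical \<open>u\<close> might rotate to several horizontal morphisms, and its
  lower-right square need not come with an upper-left one. A single lemma,
  \<open>cmp_lr_square_left\<close>, removes the first: applied to another rotation square of
  \<open>u\<close> it makes the rotated morphism unique, and applied to a square whose right side
  has been rotated away it yields commutativity. The second is removed through isomorphisms: rotated
  verticals are invertible because verticals are, \<open>hiso\<close> then supplies both squares for
  some vertical, and \<open>rotfold\<close> identifies that vertical with \<open>u\<close>. Both
  kinds of square occur because the filler of a commuting boundary rotates its left side by a
  lower-right square and its right side by an upper-left one.\<close>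

lemma cat_functor_comp:
  assumes "cat_functor C C' Fo Fm" "cat_functor C' C'' Go Gm"
  shows "cat_functor C C'' (Go \<circ> Fo) (Gm \<circ> Fm)"
proof -
  interpret F: cat_functor C C' Fo Fm by fact
  interpret G: cat_functor C' C'' Go Gm by fact
  show ?thesis
    by unfold_locales
      (simp_all add: F.map_Obj G.map_Obj F.map_Arr G.map_Arr F.map_src G.map_src F.map_tgt G.map_tgt
        F.map_idn G.map_idn F.map_cmp G.map_cmp)
qed

text \<open>The inverse respects composition because composability is reflected, not only preserved:
  \<open>Fo\<close> is injective on objects, so preimages of composable arrows are
  composable.\<close>

lemma cat_functor_inv_into:
  assumes "category C" "cat_functor C C' Fo Fm"
    and Fo: "bij_betw Fo (Obj C) (Obj C')" and Fm: "bij_betw Fm (Arr C) (Arr C')"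
  shows "cat_functor C' C (inv_into (Obj C) Fo) (inv_into (Arr C) Fm)"
proof -
  interpret C: category C by fact
  interpret F: cat_functor C C' Fo Fm by fact
  let ?Go = "inv_into (Obj C) Fo" and ?Gm = "inv_into (Arr C) Fm"
  have Go: "?Go (Fo x) = x" if "x \<in> Obj C" for x
    using that Fo by (simp add: bij_betw_def)
  have Gm: "?Gm (Fm f) = f" if "f \<in> Arr C" for f
    using that Fm by (simp add: bij_betw_def)
  have exO: "\<exists>x \<in> Obj C. y = Fo x" if "y \<in> Obj C'" for y
    using that Fo by (auto simp: bij_betw_def)
  have exA: "\<exists>f \<in> Arr C. g = Fm f" if "g \<in> Arr C'" for g
    using that Fm by (auto simp: bij_betw_def)
  show ?thesis
  proof
    show "?Go y \<in> Obj C" if "y \<in> Obj C'" for y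
      using exO[OF that] Go by auto
    show "?Gm g \<in> Arr C" if "g \<in> Arr C'" for g
      using exA[OF that] Gm by auto
    show "src C (?Gm g) = ?Go (src C' g)" if "g \<in> Arr C'" for g
      using exA[OF that] Gm Go C.src_Obj F.map_src by auto
    show "tgt C (?Gm g) = ?Go (tgt C' g)" if "g \<in> Arr C'" for g
      using exA[OF that] Gm Go C.tgt_Obj F.map_tgt by auto
    show "?Gm (idn C' y) = idn C (?Go y)" if "y \<in> Obj C'" for y
      using exO[OF that] Gm Go C.idn_Arr F.map_idn by (metis (full_types))
    show "?Gm (cmp C' g f) = cmp C (?Gm g) (?Gm f)"
      if fg: "f \<in> Arr C'" "g \<in> Arr C'" "src C' g = tgt C' f" for f g
    proof -
      obtain f0 g0 where 0: "f0 \<in> Arr C" "g0 \<in> Arr C" "f = Fm f0" "g = Fm g0"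
        using exA[OF fg(1)] exA[OF fg(2)] by auto
      have "Fo (src C g0) = Fo (tgt C f0)"
        using fg 0 by (simp add: F.map_src F.map_tgt)
      then have "src C g0 = tgt C f0"
        using Go 0 C.src_Obj C.tgt_Obj by metis
      then show ?thesis
        using 0 Gm by (simp add: C.cmp_Arr F.map_cmp[symmetric])
    qed
  qed
qed

section \<open>Composition and equality of double functors, and transport of locality\<close>

lemma double_functor_comp:
  assumes "double_functor D E F" "double_functor E K G"
  shows "double_functor D K (dfun_comp G F)"
  using assms unfolding double_functor_def dfun_comp_def by (auto intro: cat_functor_comp)

lemma dfun_eq_sym: "dfun_eq D F G \<Longrightarrow> dfun_eq D G F"
  by (simp add: dfun_eq_def)

lemma dfun_eq_trans: "dfun_eq D F G \<Longrightarrow> dfun_eq D G H \<Longrightarrow> dfun_eq D F H"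
  by (simp add: dfun_eq_def)

lemma dfun_eq_ver: "dfun_eq D F G \<Longrightarrow> u \<in> Arr (vcat D) \<Longrightarrow> ver F u = ver G u"
  by (simp add: dfun_eq_def)

lemma dfun_eq_sqr: "dfun_eq D F G \<Longrightarrow> s \<in> Sq D \<Longrightarrow> sqr F s = sqr G s"
  by (simp add: dfun_eq_def)

lemma dfun_eq_comp_left: "dfun_eq D F F' \<Longrightarrow> dfun_eq D (dfun_comp G F) (dfun_comp G F')"
  by (simp add: dfun_eq_def dfun_comp_def)

lemma dfun_eq_comp_right:
  assumes "double_functor D E F" "dfun_eq E G G'"
  shows "dfun_eq D (dfun_comp G F) (dfun_comp G' F)"
proof -
  interpret double_functor D E F by fact
  show ?thesis
    using assms(2) cat_functor.map_Obj[OF hor_functor] cat_functor.map_Arr[OF hor_functor]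
      cat_functor.map_Arr[OF ver_functor] cat_functor.map_Arr[OF hsq_functor]
    by (auto simp: dfun_eq_def dfun_comp_def hsq_cat_def)
qed

lemma dfun_comp_assoc: "dfun_comp (dfun_comp H G) F = dfun_comp H (dfun_comp G F)"
  by (simp add: dfun_comp_def comp_assoc)

lemma dfun_comp_id_left: "dfun_comp dfun_id F = F"
  by (simp add: dfun_comp_def dfun_id_def)

text \<open>Push the extension problem to \<open>Y\<close> along \<open>\<Phi>\<close>, solve it
  there and bring the solution back along \<open>\<Psi>\<close>.\<close>

lemma is_local_iso:
  assumes iso: "dbl_isomorphic X Y" and loc: "is_local A B i Y"
  shows "is_local A B i X"
  unfolding is_local_def
proof (intro allI impI)
  fix F assume F: "double_functor A X F"
  obtain \<Phi> \<Psi> where \<Phi>: "double_functor X Y \<Phi>" and \<Psi>: "double_functor Y X \<Psi>"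
    and \<Psi>\<Phi>: "dfun_eq X (dfun_comp \<Psi> \<Phi>) dfun_id"
    using iso unfolding dbl_isomorphic_def by blast
  obtain G where G: "double_functor B Y G" "dfun_eq A (dfun_comp G i) (dfun_comp \<Phi> F)"
    using loc double_functor_comp[OF F \<Phi>] unfolding is_local_def by blast
  have "dfun_eq A (dfun_comp (dfun_comp \<Psi> G) i) F"
    using dfun_eq_trans[OF dfun_eq_comp_left[OF G(2), of \<Psi>]] dfun_eq_comp_right[OF F \<Psi>\<Phi>]
    by (simp add: dfun_comp_assoc dfun_comp_id_left)
  then show "\<exists>G. double_functor B X G \<and> dfun_eq A (dfun_comp G i) F"
    using double_functor_comp[OF G(1) \<Psi>] by blast
qed

text \<open>For uniqueness, two extensions into \<open>X\<close> become extensions of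
  \<open>\<Phi> F\<close> into \<open>Y\<close>, where both equal the unique one; postcomposing with
  \<open>\<Psi>\<close> cancels \<open>\<Phi>\<close>.\<close>

lemma is_strictly_local_iso:
  assumes iso: "dbl_isomorphic X Y" and loc: "is_strictly_local A B i Y"
  shows "is_strictly_local A B i X"
proof -
  obtain \<Phi> \<Psi> where \<Phi>: "double_functor X Y \<Phi>" and \<Psi>\<Phi>: "dfun_eq X (dfun_comp \<Psi> \<Phi>) dfun_id"
    using iso unfolding dbl_isomorphic_def by blast
  have uniq: "dfun_eq B G G'"
    if F: "double_functor A X F" and G: "double_functor B X G" "dfun_eq A (dfun_comp G i) F"
      and G': "double_functor B X G'" "dfun_eq A (dfun_comp G' i) F" for F G G'
  proof -
    have "\<exists>H. \<forall>G. double_functor B Y G \<and> dfun_eq A (dfun_comp G i) (dfun_comp \<Phi> F) \<longrightarrow> dfun_eq B H G"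
      using loc double_functor_comp[OF F \<Phi>] unfolding is_strictly_local_def by blast
    moreover have "double_functor B Y (dfun_comp \<Phi> K) \<and>
        dfun_eq A (dfun_comp (dfun_comp \<Phi> K) i) (dfun_comp \<Phi> F)"
      if "double_functor B X K" "dfun_eq A (dfun_comp K i) F" for K
      using double_functor_comp[OF that(1) \<Phi>] dfun_eq_comp_left[OF that(2)] by (simp add: dfun_comp_assoc)
    ultimately have "dfun_eq B (dfun_comp \<Phi> G) (dfun_comp \<Phi> G')"
      using G G' by (meson dfun_eq_sym dfun_eq_trans)
    then have "dfun_eq B (dfun_comp (dfun_comp \<Psi> \<Phi>) G) (dfun_comp (dfun_comp \<Psi> \<Phi>) G')"
      by (simp add: dfun_comp_assoc dfun_eq_comp_left)
    then show ?thesis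
      using dfun_eq_comp_right[OF G(1) \<Psi>\<Phi>] dfun_eq_comp_right[OF G'(1) \<Psi>\<Phi>]
      by (metis dfun_comp_id_left dfun_eq_sym dfun_eq_trans)
  qed
  have "is_local A B i Y"
    using loc unfolding is_local_def is_strictly_local_def by blast
  then have "is_local A B i X"
    by (rule is_local_iso[OF iso])
  then show ?thesis
    using uniq unfolding is_local_def is_strictly_local_def by meson
qed

section \<open>Laws of squares and of double functors in terms of the operations\<close>

context double_category
begin

sublocale H: category "hcat D" by (rule hcat)
sublocale V: category "vcat D" by (rule vcat)

lemma sq_sides:
  assumes "s \<in> Sq D"
  shows "sqtop D s \<in> Arr (hcat D)" "sqbot D s \<in> Arr (hcat D)"
    "sqleft D s \<in> Arr (vcat D)" "sqright D s \<in> Arr (vcat D)"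
  using assms category.src_Obj[OF hsq_cat] category.tgt_Obj[OF hsq_cat]
    category.src_Obj[OF vsq_cat] category.tgt_Obj[OF vsq_cat]
  by (simp_all add: hsq_cat_def vsq_cat_def)

lemma sq_corners:
  assumes "s \<in> Sq D"
  shows "src (hcat D) (sqtop D s) = src (vcat D) (sqleft D s)"
    "tgt (hcat D) (sqtop D s) = src (vcat D) (sqright D s)"
    "src (hcat D) (sqbot D s) = tgt (vcat D) (sqleft D s)"
    "tgt (hcat D) (sqbot D s) = tgt (vcat D) (sqright D s)"
  using assms cat_functor.map_src[OF top_functor] cat_functor.map_tgt[OF top_functor]
    cat_functor.map_src[OF bot_functor] cat_functor.map_tgt[OF bot_functor]
  by (simp_all add: hsq_cat_def)

lemma hcomp_sq:
  assumes "a \<in> Sq D" "b \<in> Sq D" "sqleft D b = sqright D a"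
  shows "hcomp D b a \<in> Sq D" "sqleft D (hcomp D b a) = sqleft D a"
    "sqright D (hcomp D b a) = sqright D b"
    "sqtop D (hcomp D b a) = cmp (hcat D) (sqtop D b) (sqtop D a)"
    "sqbot D (hcomp D b a) = cmp (hcat D) (sqbot D b) (sqbot D a)"
  using assms category.cmp_Arr[OF hsq_cat, of a b] category.src_cmp[OF hsq_cat, of a b]
    category.tgt_cmp[OF hsq_cat, of a b] cat_functor.map_cmp[OF top_functor, of a b]
    cat_functor.map_cmp[OF bot_functor, of a b]
  by (simp_all add: hsq_cat_def)

lemma vcomp_sq:
  assumes "a \<in> Sq D" "b \<in> Sq D" "sqtop D b = sqbot D a"
  shows "vcomp D b a \<in> Sq D" "sqtop D (vcomp D b a) = sqtop D a"
    "sqbot D (vcomp D b a) = sqbot D b"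
    "sqleft D (vcomp D b a) = cmp (vcat D) (sqleft D b) (sqleft D a)"
    "sqright D (vcomp D b a) = cmp (vcat D) (sqright D b) (sqright D a)"
  using assms category.cmp_Arr[OF vsq_cat, of a b] category.src_cmp[OF vsq_cat, of a b]
    category.tgt_cmp[OF vsq_cat, of a b] cat_functor.map_cmp[OF left_functor, of a b]
    cat_functor.map_cmp[OF right_functor, of a b]
  by (simp_all add: vsq_cat_def)

lemma hid_sq:
  assumes "u \<in> Arr (vcat D)"
  shows "hid D u \<in> Sq D" "sqleft D (hid D u) = u" "sqright D (hid D u) = u"
    "sqtop D (hid D u) = idn (hcat D) (src (vcat D) u)"
    "sqbot D (hid D u) = idn (hcat D) (tgt (vcat D) u)"
  using assms category.idn_Arr[OF hsq_cat, of u] category.src_idn[OF hsq_cat, of u]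
    category.tgt_idn[OF hsq_cat, of u] cat_functor.map_src[OF hid_functor, of u]
    cat_functor.map_tgt[OF hid_functor, of u]
  by (simp_all add: hsq_cat_def vsq_cat_def)

lemma vid_sq:
  assumes "f \<in> Arr (hcat D)"
  shows "vid D f \<in> Sq D" "sqtop D (vid D f) = f" "sqbot D (vid D f) = f"
    "sqleft D (vid D f) = idn (vcat D) (src (hcat D) f)"
    "sqright D (vid D f) = idn (vcat D) (tgt (hcat D) f)"
  using assms category.idn_Arr[OF vsq_cat, of f] category.src_idn[OF vsq_cat, of f]
    category.tgt_idn[OF vsq_cat, of f] cat_functor.map_src[OF vid_functor, of f]
    cat_functor.map_tgt[OF vid_functor, of f]
  by (simp_all add: hsq_cat_def vsq_cat_def)

lemma hcomp_hid:
  assumes "s \<in> Sq D"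
  shows "hcomp D (hid D (sqright D s)) s = s" "hcomp D s (hid D (sqleft D s)) = s"
  using assms category.cmp_idn_left[OF hsq_cat] category.cmp_idn_right[OF hsq_cat]
  by (simp_all add: hsq_cat_def)

lemma vcomp_vid:
  assumes "s \<in> Sq D"
  shows "vcomp D (vid D (sqbot D s)) s = s" "vcomp D s (vid D (sqtop D s)) = s"
  using assms category.cmp_idn_left[OF vsq_cat] category.cmp_idn_right[OF vsq_cat]
  by (simp_all add: vsq_cat_def)

lemma hcomp_assoc:
  assumes "a \<in> Sq D" "b \<in> Sq D" "c \<in> Sq D" "sqleft D b = sqright D a" "sqleft D c = sqright D b"
  shows "hcomp D c (hcomp D b a) = hcomp D (hcomp D c b) a"
  using assms category.cmp_assoc[OF hsq_cat, of a b c] by (simp add: hsq_cat_def)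

lemma vcomp_assoc:
  assumes "a \<in> Sq D" "b \<in> Sq D" "c \<in> Sq D" "sqtop D b = sqbot D a" "sqtop D c = sqbot D b"
  shows "vcomp D c (vcomp D b a) = vcomp D (vcomp D c b) a"
  using assms category.cmp_assoc[OF vsq_cat, of a b c] by (simp add: vsq_cat_def)

lemma hid_idn: "x \<in> Obj (hcat D) \<Longrightarrow> hid D (idn (vcat D) x) = vid D (idn (hcat D) x)"
  using cat_functor.map_idn[OF hid_functor, of x] by (simp add: same_Obj vsq_cat_def)

lemma hid_cmp:
  assumes "u \<in> Arr (vcat D)" "v \<in> Arr (vcat D)" "src (vcat D) v = tgt (vcat D) u"
  shows "hid D (cmp (vcat D) v u) = vcomp D (hid D v) (hid D u)"
  using cat_functor.map_cmp[OF hid_functor, of u v] assms by (simp add: vsq_cat_def)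

lemma vid_cmp:
  assumes "f \<in> Arr (hcat D)" "g \<in> Arr (hcat D)" "src (hcat D) g = tgt (hcat D) f"
  shows "vid D (cmp (hcat D) g f) = hcomp D (vid D g) (vid D f)"
  using cat_functor.map_cmp[OF vid_functor, of f g] assms by (simp add: hsq_cat_def)

end

context double_functor
begin

sublocale H: cat_functor "hcat D" "hcat E" "ob F" "hor F" by (rule hor_functor)
sublocale V: cat_functor "vcat D" "vcat E" "ob F" "ver F" by (rule ver_functor)

lemma sqr_sq:
  assumes "s \<in> Sq D"
  shows "sqr F s \<in> Sq E" "sqtop E (sqr F s) = hor F (sqtop D s)"
    "sqbot E (sqr F s) = hor F (sqbot D s)" "sqleft E (sqr F s) = ver F (sqleft D s)"
    "sqright E (sqr F s) = ver F (sqright D s)"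
  using assms cat_functor.map_Arr[OF hsq_functor, of s] cat_functor.map_src[OF hsq_functor, of s]
    cat_functor.map_tgt[OF hsq_functor, of s] cat_functor.map_src[OF vsq_functor, of s]
    cat_functor.map_tgt[OF vsq_functor, of s]
  by (simp_all add: hsq_cat_def vsq_cat_def)

lemma sqr_hid: "u \<in> Arr (vcat D) \<Longrightarrow> sqr F (hid D u) = hid E (ver F u)"
  using cat_functor.map_idn[OF hsq_functor, of u] by (simp add: hsq_cat_def)

lemma sqr_vid: "f \<in> Arr (hcat D) \<Longrightarrow> sqr F (vid D f) = vid E (hor F f)"
  using cat_functor.map_idn[OF vsq_functor, of f] by (simp add: vsq_cat_def)

lemma sqr_hcomp:
  assumes "a \<in> Sq D" "b \<in> Sq D" "sqleft D b = sqright D a"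
  shows "sqr F (hcomp D b a) = hcomp E (sqr F b) (sqr F a)"
  using assms cat_functor.map_cmp[OF hsq_functor, of a b] by (simp add: hsq_cat_def)

lemma sqr_vcomp:
  assumes "a \<in> Sq D" "b \<in> Sq D" "sqtop D b = sqbot D a"
  shows "sqr F (vcomp D b a) = vcomp E (sqr F b) (sqr F a)"
  using assms cat_functor.map_cmp[OF vsq_functor, of a b] by (simp add: vsq_cat_def)

end

text \<open>The inverse is taken separately on each carrier and is functorial by
  \<open>cat_functor_inv_into\<close>, applied to all four categories of arrows and squares. The
  second half of \<open>ob\<close> lets the one bijection on objects serve the vertical category as
  well.\<close>

lemma dbl_isomorphicI:
  assumes "double_category D" "double_functor D E F"
    and ob: "bij_betw (ob F) (Obj (hcat D)) (Obj (hcat E))" "Obj (vcat E) = Obj (hcat E)"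
    and hor: "bij_betw (hor F) (Arr (hcat D)) (Arr (hcat E))"
    and ver: "bij_betw (ver F) (Arr (vcat D)) (Arr (vcat E))"
    and sqr: "bij_betw (sqr F) (Sq D) (Sq E)"
  shows "dbl_isomorphic D E"
proof -
  interpret D: double_category D by fact
  interpret F: double_functor D E F by fact
  let ?G = "\<lparr>ob = inv_into (Obj (hcat D)) (ob F), hor = inv_into (Arr (hcat D)) (hor F),
    ver = inv_into (Arr (vcat D)) (ver F), sqr = inv_into (Sq D) (sqr F)\<rparr>"
  have "double_functor E D ?G"
    using cat_functor_inv_into[OF D.hcat F.hor_functor] cat_functor_inv_into[OF D.vcat F.ver_functor]
      cat_functor_inv_into[OF D.hsq_cat F.hsq_functor] cat_functor_inv_into[OF D.vsq_cat F.vsq_functor]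
      assms D.same_Obj
    by (simp add: double_functor_def) (simp add: hsq_cat_def vsq_cat_def)
  moreover have "dfun_eq D (dfun_comp ?G F) dfun_id" "dfun_eq E (dfun_comp F ?G) dfun_id"
    using assms by (auto simp: dfun_eq_def dfun_comp_def dfun_id_def bij_betw_def f_inv_into_f)
  ultimately show ?thesis
    using assms unfolding dbl_isomorphic_def by blast
qed

section \<open>Free double categories\<close>

locale wf_graph =
  fixes G :: "('o, 'e) graph"
  assumes esrc_Verts: "e \<in> Edges G \<Longrightarrow> esrc G e \<in> Verts G"
    and etgt_Verts: "e \<in> Edges G \<Longrightarrow> etgt G e \<in> Verts G"
begin

lemma walk_start: "walk G x p \<Longrightarrow> x \<in> Verts G"
  by (cases p) auto

lemma walk_end_Verts: "walk G x p \<Longrightarrow> walk_end G x p \<in> Verts G"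
  by (induction p arbitrary: x) (auto simp: walk_start)

lemma walk_append: "walk G x (p @ q) \<longleftrightarrow> walk G x p \<and> walk G (walk_end G x p) q"
  by (induction p arbitrary: x) (auto simp: walk_start)

lemma walk_end_append: "walk_end G x (p @ q) = walk_end G (walk_end G x p) q"
  by (induction p arbitrary: x) auto

lemma free_cat_simps:
  "Obj (free_cat G) = Verts G" "(x, p) \<in> Arr (free_cat G) \<longleftrightarrow> walk G x p"
  "src (free_cat G) = fst" "tgt (free_cat G) (x, p) = walk_end G x p" "idn (free_cat G) x = (x, [])"
  "cmp (free_cat G) (y, q) (x, p) = (x, p @ q)"
  by (simp_all add: free_cat_def)

lemma category_free_cat: "category (free_cat G)"
  by unfold_locales
    (auto simp: free_cat_simps walk_start walk_end_Verts walk_append walk_end_append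
      split: prod.splits)

text \<open>Existence half of the universal property of the free category;
  \<open>cat_functor_free_cat_eqI\<close> is the uniqueness half.\<close>

lemma cat_functor_path_ext:
  assumes "category C" and Fo: "\<And>x. x \<in> Verts G \<Longrightarrow> Fo x \<in> Obj C"
    and Fe: "\<And>e. e \<in> Edges G \<Longrightarrow> Fe e \<in> Arr C \<and> src C (Fe e) = Fo (esrc G e) \<and> tgt C (Fe e) = Fo (etgt G e)"
  shows "cat_functor (free_cat G) C Fo (path_ext C Fo Fe)"
proof -
  interpret C: category C by fact
  let ?F = "path_ext C Fo Fe"
  \<comment> \<open>The fold composes edges in order of traversal, so appending a last edge is one
    composition. Hence the inductions split paths at their end.\<close>
  have ext_snoc: "?F (x, p @ [e]) = cmp C (Fe e) (?F (x, p))" for x p e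
    by simp
  have bd: "?F (x, p) \<in> Arr C \<and> src C (?F (x, p)) = Fo x \<and> tgt C (?F (x, p)) = Fo (walk_end G x p)"
    if "walk G x p" for x p
    using that
  proof (induction p rule: rev_induct)
    case Nil
    then show ?case
      by (simp add: Fo C.idn_Arr C.src_idn C.tgt_idn)
  next
    case (snoc e p)
    then show ?case
      unfolding ext_snoc using Fe[of e]
      by (simp add: walk_append walk_end_append C.cmp_Arr C.src_cmp C.tgt_cmp del: path_ext.simps)
  qed
  have cmp: "?F (x, p @ q) = cmp C (?F (walk_end G x p, q)) (?F (x, p))" if "walk G x (p @ q)" for x p q
    using that
  proof (induction q rule: rev_induct)
    case Nil
    then show ?case
      using bd[of x p] C.cmp_idn_left[of "?F (x, p)"] by simp
  next
    case (snoc e q)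
    have w: "walk G x p" "walk G (walk_end G x p) q" "e \<in> Edges G"
      "esrc G e = walk_end G (walk_end G x p) q" "walk G x (p @ q)"
      using snoc.prems by (simp_all add: walk_append walk_end_append)
    have "?F (x, p @ q @ [e]) = cmp C (Fe e) (?F (x, p @ q))"
      by simp
    also have "\<dots> = cmp C (cmp C (Fe e) (?F (walk_end G x p, q))) (?F (x, p))"
      unfolding snoc.IH[OF w(5)]
      using C.cmp_assoc bd[OF w(1)] bd[OF w(2)] Fe[OF w(3)] w(4) by metis
    finally show ?case
      by simp
  qed
  show ?thesis
    by unfold_locales
      (auto simp: free_cat_simps Fo bd cmp walk_append simp del: path_ext.simps simp: path_ext.simps[of _ _ _ _ "[]"])
qed

lemma cat_functor_free_cat_eqI:
  assumes "cat_functor (free_cat G) C Fo Fm" "cat_functor (free_cat G) C Go Gm"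
    and ob: "\<And>x. x \<in> Verts G \<Longrightarrow> Fo x = Go x"
    and edge: "\<And>e. e \<in> Edges G \<Longrightarrow> Fm (esrc G e, [e]) = Gm (esrc G e, [e])"
    and "f \<in> Arr (free_cat G)"
  shows "Fm f = Gm f"
proof -
  interpret F: cat_functor "free_cat G" C Fo Fm by fact
  interpret G: cat_functor "free_cat G" C Go Gm by fact
  have "Fm (x, p) = Gm (x, p)" if "walk G x p" for x p
    using that
  proof (induction p rule: rev_induct)
    case Nil
    then show ?case
      using F.map_idn[of x] G.map_idn[of x] ob by (simp add: free_cat_simps)
  next
    case (snoc e p)
    then show ?case
      using F.map_cmp[of "(x, p)" "(esrc G e, [e])"] G.map_cmp[of "(x, p)" "(esrc G e, [e])"] edge[of e]
      by (simp add: free_cat_simps walk_append)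
  qed
  then show ?thesis
    using \<open>f \<in> Arr (free_cat G)\<close> by (cases f) (simp add: free_cat_simps)
qed

end

section \<open>The free double category on a computad\<close>

locale wf_computad =
  fixes P :: "('o, 'x, 'y, 'z) computad"
  assumes hgraph: "wf_graph (hgraph P)" and vgraph: "wf_graph (vgraph P)"
    and same_Verts: "Verts (vgraph P) = Verts (hgraph P)"
    and gen_sides: "z \<in> Gsq P \<Longrightarrow> gtop P z \<in> Arr (free_cat (hgraph P))"
      "z \<in> Gsq P \<Longrightarrow> gbot P z \<in> Arr (free_cat (hgraph P))"
      "z \<in> Gsq P \<Longrightarrow> gleft P z \<in> Arr (free_cat (vgraph P))"
      "z \<in> Gsq P \<Longrightarrow> gright P z \<in> Arr (free_cat (vgraph P))"
    and gen_corners: "z \<in> Gsq P \<Longrightarrow> src (free_cat (hgraph P)) (gtop P z) = src (free_cat (vgraph P)) (gleft P z)"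
      "z \<in> Gsq P \<Longrightarrow> tgt (free_cat (hgraph P)) (gtop P z) = src (free_cat (vgraph P)) (gright P z)"
      "z \<in> Gsq P \<Longrightarrow> src (free_cat (hgraph P)) (gbot P z) = tgt (free_cat (vgraph P)) (gleft P z)"
      "z \<in> Gsq P \<Longrightarrow> tgt (free_cat (hgraph P)) (gbot P z) = tgt (free_cat (vgraph P)) (gright P z)"
begin

abbreviation "HC \<equiv> free_cat (hgraph P)"
abbreviation "VC \<equiv> free_cat (vgraph P)"

sublocale HG: wf_graph "hgraph P" by (rule hgraph)
sublocale VG: wf_graph "vgraph P" by (rule vgraph)
sublocale HC: category HC by (rule HG.category_free_cat)
sublocale VC: category VC by (rule VG.category_free_cat)

lemma Obj_HC: "Obj HC = Verts (hgraph P)" and Obj_VC: "Obj VC = Verts (hgraph P)"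
  by (simp_all add: HG.free_cat_simps VG.free_cat_simps same_Verts)

lemmas HC_simps = HC.src_Obj HC.tgt_Obj HC.idn_Arr HC.src_idn HC.tgt_idn HC.cmp_Arr HC.src_cmp HC.tgt_cmp
  HC.cmp_idn_left HC.cmp_idn_right HC.cmp_assoc
lemmas VC_simps = VC.src_Obj VC.tgt_Obj VC.idn_Arr VC.src_idn VC.tgt_idn VC.cmp_Arr VC.src_cmp VC.tgt_cmp
  VC.cmp_idn_left VC.cmp_idn_right VC.cmp_assoc

text \<open>Sides and corners need a simultaneous induction: a side of a composite term is a
  composite of paths, and it is the corners that make these paths composable.\<close>

lemma wf_term_boundary:
  assumes "wf_term P t"
  shows "ttop P t \<in> Arr HC \<and> tbot P t \<in> Arr HC \<and> tleft P t \<in> Arr VC \<and> tright P t \<in> Arr VC \<and>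
    src HC (ttop P t) = src VC (tleft P t) \<and> tgt HC (ttop P t) = src VC (tright P t) \<and>
    src HC (tbot P t) = tgt VC (tleft P t) \<and> tgt HC (tbot P t) = tgt VC (tright P t)"
  using assms
proof (induction t)
  case (HId v)
  then show ?case
    using VC.src_Obj[of v] VC.tgt_Obj[of v] by (simp add: Obj_HC Obj_VC HC_simps)
next
  case (VId f)
  then show ?case
    using HC.src_Obj[of f] HC.tgt_Obj[of f] by (simp add: Obj_HC Obj_VC VC_simps)
qed (auto simp: gen_sides gen_corners HC_simps VC_simps)

lemma wf_term_sides:
  assumes "wf_term P t"
  shows "ttop P t \<in> Arr HC" "tbot P t \<in> Arr HC" "tleft P t \<in> Arr VC" "tright P t \<in> Arr VC"
    "src HC (ttop P t) = src VC (tleft P t)" "tgt HC (ttop P t) = src VC (tright P t)"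
    "src HC (tbot P t) = tgt VC (tleft P t)" "tgt HC (tbot P t) = tgt VC (tright P t)"
  using wf_term_boundary[OF assms] by simp_all

lemma wf_term_composable:
  assumes "wf_term P a" "wf_term P b"
  shows "tleft P b = tright P a \<Longrightarrow> src HC (ttop P b) = tgt HC (ttop P a)"
    "tleft P b = tright P a \<Longrightarrow> src HC (tbot P b) = tgt HC (tbot P a)"
    "ttop P b = tbot P a \<Longrightarrow> src VC (tleft P b) = tgt VC (tleft P a)"
    "ttop P b = tbot P a \<Longrightarrow> src VC (tright P b) = tgt VC (tright P a)"
  using wf_term_sides(5-8)[OF assms(1)] wf_term_sides(5-8)[OF assms(2)] by simp_all

lemma wf_term_units:
  assumes "wf_term P t"
  shows "cmp HC (idn HC (src VC (tright P t))) (ttop P t) = ttop P t"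
    "cmp HC (idn HC (tgt VC (tright P t))) (tbot P t) = tbot P t"
    "cmp HC (ttop P t) (idn HC (src VC (tleft P t))) = ttop P t"
    "cmp HC (tbot P t) (idn HC (tgt VC (tleft P t))) = tbot P t"
  using wf_term_sides[OF assms] HC.cmp_idn_left HC.cmp_idn_right by metis+

text \<open>This makes the sides of a class independent of the representative that
  \<open>sq_rep\<close> chooses.\<close>

lemma sq_eq_boundary:
  assumes "sq_eq P s t"
  shows "wf_term P s \<and> wf_term P t \<and> ttop P s = ttop P t \<and> tbot P s = tbot P t \<and>
    tleft P s = tleft P t \<and> tright P s = tright P t"
  using assms
proof induction
  case (sq_HId_cmp u v)
  then show ?case
    using VC.tgt_Obj[of u] by (simp add: VC_simps Obj_VC)
next
  case (sq_VId_cmp f g)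
  then show ?case
    using HC.tgt_Obj[of f] by (simp add: HC_simps Obj_HC)
next
  case (sq_HId_idn x)
  then show ?case
    by (simp add: HC_simps VC_simps Obj_HC Obj_VC)
qed (auto simp: wf_term_sides wf_term_units wf_term_composable HC_simps VC_simps)

lemma sq_class_eqI: "sq_eq P s t \<Longrightarrow> sq_class P s = sq_class P t"
  unfolding sq_class_def by (auto intro: sq_sym sq_trans)

lemmas sq_class_laws =
  sq_HComp_id_left[THEN sq_class_eqI] sq_HComp_id_right[THEN sq_class_eqI]
  sq_VComp_id_left[THEN sq_class_eqI] sq_VComp_id_right[THEN sq_class_eqI]
  sq_HComp_assoc[THEN sq_class_eqI] sq_VComp_assoc[THEN sq_class_eqI]
  sq_HId_cmp[THEN sq_class_eqI] sq_VId_cmp[THEN sq_class_eqI] sq_HId_idn[THEN sq_class_eqI]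
  sq_interchange[THEN sq_class_eqI]

lemma sq_rep_class:
  assumes "wf_term P t"
  shows "sq_eq P t (sq_rep (sq_class P t))"
  using someI[of "sq_eq P t" t] sq_refl[OF assms] by (simp add: sq_rep_def sq_class_def)

lemma free_dbl_cats: "hcat (free_dbl P) = HC" "vcat (free_dbl P) = VC"
  by (simp_all add: free_dbl_def)

lemma Sq_free_dblE:
  assumes "A \<in> Sq (free_dbl P)"
  obtains t where "wf_term P t" "A = sq_class P t"
  using assms by (auto simp: free_dbl_def)

lemma free_dbl_simps:
  "hid (free_dbl P) v = sq_class P (HId v)" "vid (free_dbl P) f = sq_class P (VId f)"
  by (simp_all add: free_dbl_def)

lemma sq_class_Sq: "wf_term P t \<Longrightarrow> sq_class P t \<in> Sq (free_dbl P)"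
  by (auto simp: free_dbl_def)

lemma sq_class_sides:
  assumes "wf_term P t"
  shows "sqtop (free_dbl P) (sq_class P t) = ttop P t" "sqbot (free_dbl P) (sq_class P t) = tbot P t"
    "sqleft (free_dbl P) (sq_class P t) = tleft P t" "sqright (free_dbl P) (sq_class P t) = tright P t"
  using sq_eq_boundary[OF sq_rep_class[OF assms]] by (simp_all add: free_dbl_def)

text \<open>Composition of classes goes through chosen representatives; the congruence rule
  \<open>sq_HComp\<close> allows replacing them by the given ones.\<close>

lemma hcomp_sq_class:
  assumes "wf_term P a" "wf_term P b" "tleft P b = tright P a"
  shows "hcomp (free_dbl P) (sq_class P b) (sq_class P a) = sq_class P (HComp b a)"
  using assms sq_HComp[OF sq_rep_class sq_rep_class, of a b]
    sq_class_eqI[of "HComp b a"]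
  by (simp add: free_dbl_def)

lemma vcomp_sq_class:
  assumes "wf_term P a" "wf_term P b" "ttop P b = tbot P a"
  shows "vcomp (free_dbl P) (sq_class P b) (sq_class P a) = sq_class P (VComp b a)"
  using assms sq_VComp[OF sq_rep_class sq_rep_class, of a b]
    sq_class_eqI[of "VComp b a"]
  by (simp add: free_dbl_def)

text \<open>Every law for squares is a generating rule of \<open>sq_eq\<close>, so once squares are
  written as classes of terms it is an instance of \<open>sq_class_laws\<close>. What remains
  concerns boundaries, which are computed in the two path categories.\<close>

lemma double_category_free_dbl: "double_category (free_dbl P)"
proof -
  let ?D = "free_dbl P"
  note [simp] = free_dbl_cats free_dbl_simps sq_class_Sq sq_class_sides hcomp_sq_class vcomp_sq_class
    wf_term_sides wf_term_composable sq_class_laws Obj_HC Obj_VC HC_simps VC_simps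
  note [elim!] = Sq_free_dblE
  have tgt_HC: "tgt HC f \<in> Verts (hgraph P)" and src_HC: "src HC f \<in> Verts (hgraph P)" if "f \<in> Arr HC" for f
    using that HC.tgt_Obj HC.src_Obj by simp_all
  have tgt_VC: "tgt VC f \<in> Verts (hgraph P)" and src_VC: "src VC f \<in> Verts (hgraph P)" if "f \<in> Arr VC" for f
    using that VC.tgt_Obj VC.src_Obj by simp_all
  note [simp] = tgt_HC src_HC tgt_VC src_VC
  show ?thesis
  proof (rule double_category.intro)
    show "category (hcat ?D)" "category (vcat ?D)" "Obj (vcat ?D) = Obj (hcat ?D)"
      using HC.category_axioms VC.category_axioms by simp_all
    show "category (hsq_cat ?D)"
      unfolding hsq_cat_def
      by unfold_locales auto
    show "category (vsq_cat ?D)"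
      unfolding vsq_cat_def
      by unfold_locales auto
    show "cat_functor (hsq_cat ?D) (hcat ?D) (src (vcat ?D)) (sqtop ?D)"
      "cat_functor (hsq_cat ?D) (hcat ?D) (tgt (vcat ?D)) (sqbot ?D)"
      unfolding hsq_cat_def by (unfold_locales; auto)+
    show "cat_functor (vsq_cat ?D) (vcat ?D) (src (hcat ?D)) (sqleft ?D)"
      "cat_functor (vsq_cat ?D) (vcat ?D) (tgt (hcat ?D)) (sqright ?D)"
      unfolding vsq_cat_def by (unfold_locales; auto)+
    show "cat_functor (vcat ?D) (vsq_cat ?D) (idn (hcat ?D)) (hid ?D)"
      unfolding vsq_cat_def by unfold_locales auto
    show "cat_functor (hcat ?D) (hsq_cat ?D) (idn (vcat ?D)) (vid ?D)"
      unfolding hsq_cat_def by unfold_locales auto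
    show "hcomp ?D (vcomp ?D d c) (vcomp ?D b a) = vcomp ?D (hcomp ?D d b) (hcomp ?D c a)"
      if "a \<in> Sq ?D" "b \<in> Sq ?D" "c \<in> Sq ?D" "d \<in> Sq ?D" "sqleft ?D c = sqright ?D a"
        "sqleft ?D d = sqright ?D b" "sqtop ?D b = sqbot ?D a" "sqtop ?D d = sqbot ?D c" for a b c d
      using that by auto
  qed
qed

end

section \<open>The universal property of free double categories\<close>

locale computad_map = wf_computad P + E: double_category E
  for P :: "('o, 'x, 'y, 'z) computad" and E :: "('o1, 'h1, 'v1, 's1) dblcat" +
  fixes Fo :: "'o \<Rightarrow> 'o1" and Fx :: "'x \<Rightarrow> 'h1" and Fy :: "'y \<Rightarrow> 'v1" and Fz :: "'z \<Rightarrow> 's1"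
  assumes Fo: "x \<in> Verts (hgraph P) \<Longrightarrow> Fo x \<in> Obj (hcat E)"
    and Fx: "e \<in> Edges (hgraph P) \<Longrightarrow> Fx e \<in> Arr (hcat E) \<and>
      src (hcat E) (Fx e) = Fo (esrc (hgraph P) e) \<and> tgt (hcat E) (Fx e) = Fo (etgt (hgraph P) e)"
    and Fy: "d \<in> Edges (vgraph P) \<Longrightarrow> Fy d \<in> Arr (vcat E) \<and>
      src (vcat E) (Fy d) = Fo (esrc (vgraph P) d) \<and> tgt (vcat E) (Fy d) = Fo (etgt (vgraph P) d)"
    and Fz: "z \<in> Gsq P \<Longrightarrow> Fz z \<in> Sq E \<and> sqtop E (Fz z) = path_ext (hcat E) Fo Fx (gtop P z) \<and>
      sqbot E (Fz z) = path_ext (hcat E) Fo Fx (gbot P z) \<and>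
      sqleft E (Fz z) = path_ext (vcat E) Fo Fy (gleft P z) \<and>
      sqright E (Fz z) = path_ext (vcat E) Fo Fy (gright P z)"
begin

abbreviation "Ph \<equiv> path_ext (hcat E) Fo Fx"
abbreviation "Pv \<equiv> path_ext (vcat E) Fo Fy"
abbreviation "Ps \<equiv> sq_ext E Fo Fx Fy Fz"

sublocale Ph: cat_functor HC "hcat E" Fo Ph
  by (intro HG.cat_functor_path_ext E.hcat Fo Fx)

sublocale Pv: cat_functor VC "vcat E" Fo Pv
  by (intro VG.cat_functor_path_ext E.vcat) (simp_all add: same_Verts E.same_Obj Fo Fy)

lemma sq_ext_boundary:
  assumes "wf_term P t"
  shows "Ps t \<in> Sq E \<and> sqtop E (Ps t) = Ph (ttop P t) \<and> sqbot E (Ps t) = Ph (tbot P t) \<and>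
    sqleft E (Ps t) = Pv (tleft P t) \<and> sqright E (Ps t) = Pv (tright P t)"
  using assms
proof (induction t)
  case (HId v)
  then show ?case
    using VC.src_Obj[of v] VC.tgt_Obj[of v]
    by (simp add: E.hid_sq Pv.map_Arr Pv.map_src Pv.map_tgt Ph.map_idn Obj_HC Obj_VC)
next
  case (VId f)
  then show ?case
    using HC.src_Obj[of f] HC.tgt_Obj[of f]
    by (simp add: E.vid_sq Ph.map_Arr Ph.map_src Ph.map_tgt Pv.map_idn Obj_HC Obj_VC)
next
  case (HComp b a)
  then show ?case
    using wf_term_sides[of a] wf_term_sides[of b] wf_term_composable[of a b] by (simp add: E.hcomp_sq Ph.map_cmp)
next
  case (VComp b a)
  then show ?case
    using wf_term_sides[of a] wf_term_sides[of b] wf_term_composable[of a b] by (simp add: E.vcomp_sq Pv.map_cmp)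
qed (simp add: Fz)

lemma sq_ext_sides:
  assumes "wf_term P t"
  shows "Ps t \<in> Sq E" "sqtop E (Ps t) = Ph (ttop P t)" "sqbot E (Ps t) = Ph (tbot P t)"
    "sqleft E (Ps t) = Pv (tleft P t)" "sqright E (Ps t) = Pv (tright P t)"
  using sq_ext_boundary[OF assms] by simp_all

text \<open>Well-definedness of the extension on classes: each generating rule of
  \<open>sq_eq\<close> is a law that holds in \<open>E\<close>, and \<open>sq_ext_sides\<close>
  provides its boundary conditions.\<close>

lemma sq_ext_cong: "sq_eq P s t \<Longrightarrow> Ps s = Ps t"
proof (induction rule: sq_eq.induct)
  case (sq_HComp_id_left a)
  then show ?case
    using E.hcomp_hid(1)[of "Ps a"] by (simp add: sq_ext_sides)
next
  case (sq_HComp_id_right a)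
  then show ?case
    using E.hcomp_hid(2)[of "Ps a"] by (simp add: sq_ext_sides)
next
  case (sq_VComp_id_left a)
  then show ?case
    using E.vcomp_vid(1)[of "Ps a"] by (simp add: sq_ext_sides)
next
  case (sq_VComp_id_right a)
  then show ?case
    using E.vcomp_vid(2)[of "Ps a"] by (simp add: sq_ext_sides)
next
  case (sq_HId_cmp u v)
  then show ?case
    by (simp add: Pv.map_cmp E.hid_cmp Pv.map_Arr Pv.map_src Pv.map_tgt)
next
  case (sq_VId_cmp f g)
  then show ?case
    by (simp add: Ph.map_cmp E.vid_cmp Ph.map_Arr Ph.map_src Ph.map_tgt)
next
  case (sq_HId_idn x)
  then show ?case
    using Ph.map_idn[of x] Pv.map_idn[of x] by (simp add: Obj_HC Obj_VC E.hid_idn Fo)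
qed (simp_all add: E.hcomp_assoc E.vcomp_assoc E.interchange sq_ext_sides)

lemma sqr_free_ext:
  assumes "wf_term P t"
  shows "sqr (free_ext E Fo Fx Fy Fz) (sq_class P t) = Ps t"
  using sq_ext_cong[OF sq_rep_class[OF assms]] by (simp add: free_ext_def)

lemma double_functor_free_ext: "double_functor (free_dbl P) E (free_ext E Fo Fx Fy Fz)" (is "double_functor ?D E ?F")
proof (rule double_functor.intro)
  have F: "ob ?F = Fo" "hor ?F = Ph" "ver ?F = Pv"
    by (simp_all add: free_ext_def)
  show "cat_functor (hcat ?D) (hcat E) (ob ?F) (hor ?F)" "cat_functor (vcat ?D) (vcat E) (ob ?F) (ver ?F)"
    using Ph.cat_functor_axioms Pv.cat_functor_axioms by (simp_all add: F free_dbl_cats)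
  note simps = F free_dbl_cats free_dbl_simps sq_class_Sq sq_class_sides hcomp_sq_class vcomp_sq_class
    sqr_free_ext sq_ext_sides Ph.map_Arr Pv.map_Arr
  show "cat_functor (hsq_cat ?D) (hsq_cat E) (ver ?F) (sqr ?F)"
    unfolding hsq_cat_def by unfold_locales (auto simp: simps elim!: Sq_free_dblE)
  show "cat_functor (vsq_cat ?D) (vsq_cat E) (hor ?F) (sqr ?F)"
    unfolding vsq_cat_def by unfold_locales (auto simp: simps elim!: Sq_free_dblE)
qed

lemma hor_free_ext_edge:
  assumes "e \<in> Edges (hgraph P)"
  shows "hor (free_ext E Fo Fx Fy Fz) (esrc (hgraph P) e, [e]) = Fx e"
  using Fx[OF assms] E.H.cmp_idn_right[of "Fx e"] by (simp add: free_ext_def)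

lemma ver_free_ext_edge:
  assumes "e \<in> Edges (vgraph P)"
  shows "ver (free_ext E Fo Fx Fy Fz) (esrc (vgraph P) e, [e]) = Fy e"
  using Fy[OF assms] E.V.cmp_idn_right[of "Fy e"] by (simp add: free_ext_def)

lemma sqr_free_ext_gen: "z \<in> Gsq P \<Longrightarrow> sqr (free_ext E Fo Fx Fy Fz) (sq_class P (Gen z)) = Fz z"
  by (simp add: sqr_free_ext)

end

text \<open>Uniqueness half of the universal property. Agreement on edges extends to paths, which
  settles the identity squares; the other squares follow by induction on a representing
  term.\<close>

lemma (in wf_computad) free_dbl_dfun_eqI:
  assumes "double_functor (free_dbl P) E F" "double_functor (free_dbl P) E G"
    and ob: "\<And>x. x \<in> Verts (hgraph P) \<Longrightarrow> ob F x = ob G x"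
    and hor: "\<And>e. e \<in> Edges (hgraph P) \<Longrightarrow> hor F (esrc (hgraph P) e, [e]) = hor G (esrc (hgraph P) e, [e])"
    and ver: "\<And>e. e \<in> Edges (vgraph P) \<Longrightarrow> ver F (esrc (vgraph P) e, [e]) = ver G (esrc (vgraph P) e, [e])"
    and sqr: "\<And>z. z \<in> Gsq P \<Longrightarrow> sqr F (sq_class P (Gen z)) = sqr G (sq_class P (Gen z))"
  shows "dfun_eq (free_dbl P) F G"
proof -
  interpret F: double_functor "free_dbl P" E F by fact
  interpret G: double_functor "free_dbl P" E G by fact
  have h: "hor F f = hor G f" if "f \<in> Arr HC" for f
    using HG.cat_functor_free_cat_eqI F.hor_functor G.hor_functor ob hor that
    by (simp add: free_dbl_cats) blast
  have v: "ver F f = ver G f" if "f \<in> Arr VC" for f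
    using VG.cat_functor_free_cat_eqI F.ver_functor G.ver_functor ob ver that same_Verts
    by (simp add: free_dbl_cats) blast
  have s: "sqr F (sq_class P t) = sqr G (sq_class P t)" if "wf_term P t" for t
    using that
  proof (induction t)
    case (HId w)
    then show ?case
      using F.sqr_hid[of w] G.sqr_hid[of w] v by (simp add: free_dbl_cats free_dbl_simps)
  next
    case (VId f)
    then show ?case
      using F.sqr_vid[of f] G.sqr_vid[of f] h by (simp add: free_dbl_cats free_dbl_simps)
  next
    case (HComp b a)
    then show ?case
      using F.sqr_hcomp[of "sq_class P a" "sq_class P b"] G.sqr_hcomp[of "sq_class P a" "sq_class P b"]
      by (simp add: sq_class_Sq sq_class_sides hcomp_sq_class)
  next
    case (VComp b a)
    then show ?case
      using F.sqr_vcomp[of "sq_class P a" "sq_class P b"] G.sqr_vcomp[of "sq_class P a" "sq_class P b"]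
      by (simp add: sq_class_Sq sq_class_sides vcomp_sq_class)
  qed (simp add: sqr)
  show ?thesis
    unfolding dfun_eq_def using h v s ob by (auto simp: free_dbl_cats Obj_HC elim!: Sq_free_dblE)
qed

section \<open>Semidirect products and double categories of arrows\<close>

text \<open>Squares are determined by their boundaries, so the laws hold componentwise by those of
  \<open>C\<close> and \<open>C'\<close>. The content is that identities and pastings of commuting
  squares commute.\<close>

lemma double_category_semidirect:
  assumes "category C" "category C'" and Obj: "Obj C' = Obj C"
    and F: "cat_functor C' C (\<lambda>x. x) F"
  shows "double_category (semidirect C F C')"
proof -
  interpret C: category C by fact
  interpret C': category C' by fact
  interpret F: cat_functor C' C "\<lambda>x. x" F by fact
  let ?S = "semidirect C F C'"
  have Cobj: "src C' u \<in> Obj C" "tgt C' u \<in> Obj C" if "u \<in> Arr C'" for u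
    using that C'.src_Obj C'.tgt_Obj Obj by simp_all
  have units: "cmp C f (idn C x) = f" "cmp C (idn C y) f = f"
    if "f \<in> Arr C" "src C f = x" "tgt C f = y" for f x y
    using that C.cmp_idn_left C.cmp_idn_right by auto
  have units': "cmp C' f (idn C' x) = f" "cmp C' (idn C' y) f = f"
    if "f \<in> Arr C'" "src C' f = x" "tgt C' f = y" for f x y
    using that C'.cmp_idn_left C'.cmp_idn_right by auto
  note [simp] = Cobj units units' F.map_Arr F.map_src F.map_tgt F.map_idn F.map_cmp Obj
    C.src_Obj C.tgt_Obj C.idn_Arr C.src_idn C.tgt_idn C.cmp_Arr C.src_cmp C.tgt_cmp C.cmp_assoc
    C'.src_Obj C'.tgt_Obj C'.idn_Arr C'.src_idn C'.tgt_idn C'.cmp_Arr C'.src_cmp C'.tgt_cmp C'.cmp_assoc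
  \<comment> \<open>Closure of commuting squares under horizontal pasting: the middle vertical
    \<open>h\<close> is moved across by associativity. Vertical pasting works alike in
    \<open>paste_v\<close>.\<close>
  have paste_h: "cmp C (F k) (cmp C f' f) = cmp C (cmp C j' j) (F g)"
    if "cmp C (F h) f = cmp C j (F g)" "cmp C (F k) f' = cmp C j' (F h)"
      "f \<in> Arr C" "f' \<in> Arr C" "j \<in> Arr C" "j' \<in> Arr C" "g \<in> Arr C'" "h \<in> Arr C'" "k \<in> Arr C'"
      "src C f' = tgt C f" "src C j' = tgt C j" "src C' g = src C f" "src C' h = tgt C f" "src C' k = tgt C f'"
      "tgt C' g = src C j" "tgt C' h = tgt C j" "tgt C' k = tgt C j'" for f f' j j' g h k
  proof -
    have "cmp C (F k) (cmp C f' f) = cmp C (cmp C j' (F h)) f"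
      using that by simp
    also have "\<dots> = cmp C j' (cmp C (F h) f)"
      using that by (intro C.cmp_assoc[symmetric]) simp_all
    also have "\<dots> = cmp C (cmp C j' j) (F g)"
      using that by (simp only: that(1)) simp
    finally show ?thesis .
  qed
  have paste_v: "cmp C (cmp C (F h') (F h)) f = cmp C (cmp C k (F g')) (F g)"
    if "cmp C (F h) f = cmp C j (F g)" "cmp C (F h') j = cmp C k (F g')"
      "f \<in> Arr C" "j \<in> Arr C" "k \<in> Arr C" "g \<in> Arr C'" "h \<in> Arr C'" "g' \<in> Arr C'" "h' \<in> Arr C'"
      "src C' g = src C f" "src C' h = tgt C f" "tgt C' g = src C j" "tgt C' h = tgt C j"
      "src C' g' = src C j" "src C' h' = tgt C j" "tgt C' g' = src C k" "tgt C' h' = tgt C k"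
    for f j k g h g' h'
  proof -
    have "cmp C (cmp C (F h') (F h)) f = cmp C (F h') (cmp C (F h) f)"
      using that by (intro C.cmp_assoc[symmetric]) simp_all
    also have "\<dots> = cmp C (cmp C (F h') j) (F g)"
      using that by (simp only: that(1)) simp
    also have "\<dots> = cmp C (cmp C k (F g')) (F g)"
      by (simp only: that(2))
    finally show ?thesis .
  qed
  note defs = semidirect_def hsq_cat_def vsq_cat_def
  show ?thesis
  proof (rule double_category.intro)
    show "category (hcat ?S)" "category (vcat ?S)" "Obj (vcat ?S) = Obj (hcat ?S)"
      using assms by (simp_all add: defs)
    show "category (hsq_cat ?S)"
      unfolding defs by unfold_locales (auto intro: paste_h)
    show "category (vsq_cat ?S)"
      unfolding defs by unfold_locales (auto intro: paste_v)
    show "cat_functor (hsq_cat ?S) (hcat ?S) (src (vcat ?S)) (sqtop ?S)"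
      "cat_functor (hsq_cat ?S) (hcat ?S) (tgt (vcat ?S)) (sqbot ?S)"
      "cat_functor (vsq_cat ?S) (vcat ?S) (src (hcat ?S)) (sqleft ?S)"
      "cat_functor (vsq_cat ?S) (vcat ?S) (tgt (hcat ?S)) (sqright ?S)"
      "cat_functor (vcat ?S) (vsq_cat ?S) (idn (hcat ?S)) (hid ?S)"
      "cat_functor (hcat ?S) (hsq_cat ?S) (idn (vcat ?S)) (vid ?S)"
      unfolding defs by (unfold_locales; auto)+
    show "hcomp ?S (vcomp ?S d c) (vcomp ?S b a) = vcomp ?S (hcomp ?S d b) (hcomp ?S c a)"
      if "a \<in> Sq ?S" "b \<in> Sq ?S" "c \<in> Sq ?S" "d \<in> Sq ?S" "sqleft ?S c = sqright ?S a"
        "sqleft ?S d = sqright ?S b" "sqtop ?S b = sqbot ?S a" "sqtop ?S d = sqbot ?S c" for a b c d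
      using that by (auto simp: defs)
  qed
qed

text \<open>This supplies the extensions along \<open>hiso_fun\<close>. A functor preserves
  commuting squares, and \<open>FF\<close> rewrites the images of their vertical sides into the form
  required over \<open>F'\<close>.\<close>

lemma double_functor_semidirect:
  assumes "cat_functor C E Fo Fm" "cat_functor C' E' Fo Fv"
    and "category C" "category C'" "Obj C' = Obj C" "cat_functor C' C (\<lambda>x. x) F"
    and FF: "\<And>u. u \<in> Arr C' \<Longrightarrow> Fm (F u) = F' (Fv u)"
  shows "double_functor (semidirect C F C') (semidirect E F' E')
    \<lparr>ob = Fo, hor = Fm, ver = Fv, sqr = (\<lambda>(f, g, h, j). (Fm f, Fv g, Fv h, Fm j))\<rparr>"
proof -
  interpret C: category C by fact
  interpret C': category C' by fact
  interpret F: cat_functor C' C "\<lambda>x. x" F by fact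
  interpret M: cat_functor C E Fo Fm by fact
  interpret V: cat_functor C' E' Fo Fv by fact
  have sq: "cmp E (F' (Fv h)) (Fm f) = cmp E (Fm j) (F' (Fv g))"
    if "cmp C (F h) f = cmp C j (F g)"
      "f \<in> Arr C" "j \<in> Arr C" "g \<in> Arr C'" "h \<in> Arr C'"
      "src C' h = tgt C f" "tgt C' g = src C j" for f g h j
    using that M.map_cmp[of f "F h"] M.map_cmp[of "F g" j]
    by (simp add: FF F.map_Arr F.map_src F.map_tgt)
  have Cobj: "src C' u \<in> Obj C" "tgt C' u \<in> Obj C" if "u \<in> Arr C'" for u
    using that C'.src_Obj C'.tgt_Obj assms by simp_all
  note [simp] = sq M.map_Obj M.map_Arr M.map_src M.map_tgt M.map_idn M.map_cmp
     V.map_Obj V.map_Arr V.map_src V.map_tgt V.map_idn V.map_cmp C.src_Obj C.tgt_Obj Cobj assms(5)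
  show ?thesis
    unfolding double_functor_def using assms(1,2)
    by (auto simp: semidirect_def hsq_cat_def vsq_cat_def cat_functor_def)
qed

section \<open>Isomorphisms and the classifying double category\<close>

lemma (in category) category_iso_cat: "category (iso_cat C)"
proof -
  have "iso_arr C (idn C x)" if "x \<in> Obj C" for x
    using that cmp_idn_left[of "idn C x"] by (auto simp: iso_arr_def idn_Arr src_idn tgt_idn intro!: bexI[of _ "idn C x"])
  moreover have "iso_arr C (cmp C g f)" if fg: "iso_arr C f" "iso_arr C g" "src C g = tgt C f" for f g
  proof -
    obtain f' where f': "f' \<in> Arr C" "src C f' = tgt C f" "tgt C f' = src C f"
      "cmp C f' f = idn C (src C f)" "cmp C f f' = idn C (tgt C f)"
      using fg(1) by (auto simp: iso_arr_def)
    obtain g' where g': "g' \<in> Arr C" "src C g' = tgt C g" "tgt C g' = src C g"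
      "cmp C g' g = idn C (src C g)" "cmp C g g' = idn C (tgt C g)"
      using fg(2) by (auto simp: iso_arr_def)
    have A: "f \<in> Arr C" "g \<in> Arr C"
      using fg by (auto simp: iso_arr_def)
    have "cmp C (cmp C f' g') (cmp C g f) = cmp C f' (cmp C (cmp C g' g) f)"
      using A f' g' fg(3) cmp_assoc[of "cmp C g f" g' f'] cmp_assoc[of f g g']
      by (simp add: cmp_Arr src_cmp tgt_cmp)
    also have "\<dots> = idn C (src C f)"
      using A f' g' fg(3) cmp_idn_left[of f] by simp
    finally have 1: "cmp C (cmp C f' g') (cmp C g f) = idn C (src C f)" .
    have "cmp C (cmp C g f) (cmp C f' g') = cmp C g (cmp C (cmp C f f') g')"
      using A f' g' fg(3) cmp_assoc[of "cmp C f' g'" f g] cmp_assoc[of g' f' f]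
      by (simp add: cmp_Arr src_cmp tgt_cmp)
    also have "\<dots> = idn C (tgt C g)"
      using A f' g' fg(3) cmp_idn_left[of g'] by simp
    finally have 2: "cmp C (cmp C g f) (cmp C f' g') = idn C (tgt C g)" .
    show ?thesis
      using A f' g' fg(3) 1 2 unfolding iso_arr_def
      by (auto simp: cmp_Arr src_cmp tgt_cmp intro!: bexI[of _ "cmp C f' g'"])
  qed
  ultimately show ?thesis
    unfolding iso_cat_def
    by unfold_locales
      (auto simp: iso_arr_def[of C f for f] src_Obj tgt_Obj idn_Arr src_idn tgt_idn cmp_Arr src_cmp
        tgt_cmp cmp_idn_left cmp_idn_right cmp_assoc)
qed

lemma (in category) cat_functor_iso_cat: "cat_functor (iso_cat C) C (\<lambda>x. x) (\<lambda>f. f)"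
  by unfold_locales (auto simp: iso_cat_def iso_arr_def)

lemma (in category) double_category_classifying: "double_category (classifying C)"
  unfolding classifying_def
  by (intro double_category_semidirect category_axioms category_iso_cat cat_functor_iso_cat)
    (simp add: iso_cat_def)

lemma cat_functor_iso_arr:
  assumes "cat_functor C E Fo Fm" "category C" "iso_arr C f"
  shows "iso_arr E (Fm f)"
proof -
  interpret C: category C by fact
  interpret F: cat_functor C E Fo Fm by fact
  obtain g where "f \<in> Arr C" "g \<in> Arr C" "src C g = tgt C f" "tgt C g = src C f"
    "cmp C g f = idn C (src C f)" "cmp C f g = idn C (tgt C f)"
    using assms(3) by (auto simp: iso_arr_def)
  then show ?thesis
    using F.map_cmp[of f g] F.map_cmp[of g f] unfolding iso_arr_def
    by (auto intro!: bexI[of _ "Fm g"] simp: F.map_Arr F.map_src F.map_tgt F.map_idn C.src_Obj C.tgt_Obj)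
qed

section \<open>The interval, the walking isomorphism and functors out of them\<close>

lemma category_thin_cat:
  assumes "\<And>x. x \<in> A \<Longrightarrow> r x x" "\<And>x y z. \<lbrakk>r x y; r y z\<rbrakk> \<Longrightarrow> r x z"
  shows "category (thin_cat A r)"
  by unfold_locales (auto simp: thin_cat_def intro: assms)

lemma category_interval_cat: "category interval_cat"
  unfolding interval_cat_def by (rule category_thin_cat) auto

lemma category_walking_iso: "category walking_iso"
  unfolding walking_iso_def by (rule category_thin_cat) auto

lemma Obj_interval_cat: "Obj interval_cat = {0, 1}"
  and Arr_interval_cat: "Arr interval_cat = {(0, 0), (0, 1), (1, 1)}"
  by (auto simp: interval_cat_def thin_cat_def)

lemma Obj_walking_iso: "Obj walking_iso = {0, 1}"
  and Arr_walking_iso: "Arr walking_iso = {(0, 0), (0, 1), (1, 0), (1, 1)}"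
  by (auto simp: walking_iso_def thin_cat_def)

lemma interval_cat_simps:
  "src interval_cat = fst" "tgt interval_cat = snd" "idn interval_cat x = (x, x)"
  "cmp interval_cat g f = (fst f, snd g)"
  by (auto simp: interval_cat_def thin_cat_def)

lemma walking_iso_simps:
  "src walking_iso = fst" "tgt walking_iso = snd" "idn walking_iso x = (x, x)"
  "cmp walking_iso g f = (fst f, snd g)"
  by (auto simp: walking_iso_def thin_cat_def)

lemma iso_arr_walking_iso: "f \<in> Arr walking_iso \<Longrightarrow> iso_arr walking_iso f"
  by (auto simp: iso_arr_def Arr_walking_iso walking_iso_simps)

definition pick_ob :: "('o, 'm) cat \<Rightarrow> 'm \<Rightarrow> nat \<Rightarrow> 'o" where
  "pick_ob C f = (\<lambda>x. if x = 0 then src C f else tgt C f)"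

text \<open>The functor out of the walking isomorphism, or out of the interval (then \<open>g\<close> is irrelevant),
  that sends the arrow from \<open>0\<close> to \<open>1\<close> to \<open>f\<close> and the one from \<open>1\<close> to \<open>0\<close> to \<open>g\<close>.\<close>

definition pick_arr :: "('o, 'm) cat \<Rightarrow> 'm \<Rightarrow> 'm \<Rightarrow> nat \<times> nat \<Rightarrow> 'm" where
  "pick_arr C f g = (\<lambda>(x, y). if x = y then idn C (pick_ob C f x) else if x = 0 then f else g)"

lemma (in category) cat_functor_pick_interval:
  assumes "f \<in> Arr C"
  shows "cat_functor interval_cat C (pick_ob C f) (pick_arr C f g)"
  using assms src_Obj[OF assms] tgt_Obj[OF assms] cmp_idn_left[OF assms] cmp_idn_right[OF assms]
    cmp_idn_left[OF idn_Arr[OF src_Obj[OF assms]]] cmp_idn_left[OF idn_Arr[OF tgt_Obj[OF assms]]]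
  by unfold_locales
    (auto simp: pick_ob_def pick_arr_def Obj_interval_cat Arr_interval_cat interval_cat_simps
      src_Obj tgt_Obj idn_Arr src_idn tgt_idn)

lemma (in category) cat_functor_pick_walking_iso:
  assumes "f \<in> Arr C" "g \<in> Arr C" "src C g = tgt C f" "tgt C g = src C f"
    "cmp C g f = idn C (src C f)" "cmp C f g = idn C (tgt C f)"
  shows "cat_functor walking_iso C (pick_ob C f) (pick_arr C f g)"
  using assms src_Obj[OF assms(1)] tgt_Obj[OF assms(1)] cmp_idn_left[OF assms(1)] cmp_idn_right[OF assms(1)]
    cmp_idn_left[OF assms(2)] cmp_idn_right[OF assms(2)]
    cmp_idn_left[OF idn_Arr[OF src_Obj[OF assms(1)]]] cmp_idn_left[OF idn_Arr[OF tgt_Obj[OF assms(1)]]]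
  by unfold_locales
    (auto simp: pick_ob_def pick_arr_def Obj_walking_iso Arr_walking_iso walking_iso_simps
      src_Obj tgt_Obj idn_Arr src_idn tgt_idn)

lemma double_category_HH:
  assumes "category C"
  shows "double_category (HH C)"
proof -
  interpret C: category C by fact
  note [simp] = C.src_Obj C.tgt_Obj C.idn_Arr C.src_idn C.tgt_idn C.cmp_Arr C.src_cmp C.tgt_cmp
    C.cmp_assoc C.cmp_idn_left C.cmp_idn_right
  have "cmp C (idn C x) (idn C x) = idn C x" if "x \<in> Obj C" for x
    using that C.cmp_idn_left[of "idn C x"] by simp
  then show ?thesis
    unfolding double_category_def using assms
    by (auto simp: HH_def hsq_cat_def vsq_cat_def discrete_cat_def category_def cat_functor_def)
qed

section \<open>Double functors out of double categories with arrows in one direction\<close>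

context double_category
begin

text \<open>Horizontal morphisms and squares of \<open>VV C\<close> are identities, so their images
  are dictated by the vertical part. \<open>double_functor_HH\<close> is the transpose.\<close>

lemma double_functor_VV:
  assumes "category C" "cat_functor C (vcat D) Fo Fm"
  shows "double_functor (VV C) D
    \<lparr>ob = Fo, hor = (\<lambda>x. idn (hcat D) (Fo x)), ver = Fm, sqr = (\<lambda>m. hid D (Fm m))\<rparr>"
proof -
  interpret C: category C by fact
  interpret F: cat_functor C "vcat D" Fo Fm by fact
  have Fo: "Fo x \<in> Obj (hcat D)" if "x \<in> Obj C" for x
    using F.map_Obj[OF that] same_Obj by simp
  have 1: "cmp (hcat D) (idn (hcat D) (Fo x)) (idn (hcat D) (Fo x)) = idn (hcat D) (Fo x)"
    if "x \<in> Obj C" for x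
    using H.cmp_idn_left[OF H.idn_Arr[OF Fo[OF that]]] that by (simp add: H.tgt_idn Fo)
  have 2: "hcomp D (hid D (Fm f)) (hid D (Fm f)) = hid D (Fm f)" if "f \<in> Arr C" for f
    using hcomp_hid(1)[of "hid D (Fm f)"] that by (simp add: hid_sq F.map_Arr)
  show ?thesis
    unfolding double_functor_def
    by (auto simp: VV_def hsq_cat_def vsq_cat_def cat_functor_def discrete_cat_def Fo F.map_Arr
        F.map_src F.map_tgt F.map_idn F.map_cmp F.map_Obj hid_sq H.idn_Arr H.src_idn H.tgt_idn 1 2
        hid_idn hid_cmp C.src_Obj C.tgt_Obj)
qed

lemma double_functor_HH:
  assumes "category C" "cat_functor C (hcat D) Fo Fm"
  shows "double_functor (HH C) D
    \<lparr>ob = Fo, hor = Fm, ver = (\<lambda>x. idn (vcat D) (Fo x)), sqr = (\<lambda>m. vid D (Fm m))\<rparr>"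
proof -
  interpret C: category C by fact
  interpret F: cat_functor C "hcat D" Fo Fm by fact
  have Fo: "Fo x \<in> Obj (vcat D)" if "x \<in> Obj C" for x
    using F.map_Obj[OF that] same_Obj by simp
  have 1: "cmp (vcat D) (idn (vcat D) (Fo x)) (idn (vcat D) (Fo x)) = idn (vcat D) (Fo x)"
    if "x \<in> Obj C" for x
    using V.cmp_idn_left[OF V.idn_Arr[OF Fo[OF that]]] that by (simp add: V.tgt_idn Fo)
  have 2: "vcomp D (vid D (Fm f)) (vid D (Fm f)) = vid D (Fm f)" if "f \<in> Arr C" for f
    using vcomp_vid(1)[of "vid D (Fm f)"] that by (simp add: vid_sq F.map_Arr)
  show ?thesis
    unfolding double_functor_def
    by (auto simp: HH_def hsq_cat_def vsq_cat_def cat_functor_def discrete_cat_def Fo F.map_Arr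
        F.map_src F.map_tgt F.map_idn F.map_cmp F.map_Obj vid_sq V.idn_Arr V.src_idn V.tgt_idn 1 2
        hid_idn vid_cmp C.src_Obj C.tgt_Obj)
qed

end

lemma VV_dfun_eqI:
  assumes "double_functor (VV C) D F" "double_functor (VV C) D G" "category C"
    and "\<And>x. x \<in> Obj C \<Longrightarrow> ob F x = ob G x" "\<And>f. f \<in> Arr C \<Longrightarrow> ver F f = ver G f"
  shows "dfun_eq (VV C) F G"
proof -
  interpret F: double_functor "VV C" D F by fact
  interpret G: double_functor "VV C" D G by fact
  have "hor F x = hor G x" if "x \<in> Obj C" for x
    using that F.H.map_idn[of x] G.H.map_idn[of x] assms(4) by (simp add: VV_def discrete_cat_def)
  moreover have "sqr F f = sqr G f" if "f \<in> Arr C" for f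
    using that F.sqr_hid[of f] G.sqr_hid[of f] assms(5) by (simp add: VV_def)
  ultimately show ?thesis
    using assms(4,5) by (simp add: dfun_eq_def VV_def discrete_cat_def)
qed

section \<open>The locality conditions in terms of squares\<close>

text \<open>\<open>lr_square\<close> and \<open>ul_square\<close> have the boundaries of the two
  binding squares of a companion pair formed by \<open>a\<close> and \<open>u\<close>.\<close>

definition lr_square :: "('o, 'h, 'v, 's) dblcat \<Rightarrow> 'h \<Rightarrow> 'v \<Rightarrow> 's \<Rightarrow> bool" where
  "lr_square D a u s \<longleftrightarrow> s \<in> Sq D \<and> sqtop D s = a \<and> sqleft D s = u \<and>
    sqright D s = idn (vcat D) (tgt (hcat D) a) \<and> sqbot D s = idn (hcat D) (tgt (hcat D) a)"

definition ul_square :: "('o, 'h, 'v, 's) dblcat \<Rightarrow> 'h \<Rightarrow> 'v \<Rightarrow> 's \<Rightarrow> bool" where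
  "ul_square D a u s \<longleftrightarrow> s \<in> Sq D \<and> sqbot D s = a \<and> sqright D s = u \<and>
    sqleft D s = idn (vcat D) (src (hcat D) a) \<and> sqtop D s = idn (hcat D) (src (hcat D) a)"

section \<open>The generating computads and the double functors between them\<close>

lemma wf_parallel_squares: "wf_computad (parallel_squares S)"
  by unfold_locales (auto simp: parallel_squares_def free_cat_def)

lemma wf_trunc_h_gen: "wf_computad trunc_h_gen"
  by unfold_locales (auto simp: trunc_h_gen_def free_cat_def)

lemma wf_rot_lr_gen: "wf_computad rot_lr_gen"
  by unfold_locales (auto simp: rot_lr_gen_def free_cat_def)

lemma wf_rot_ul_gen: "wf_computad rot_ul_gen"
  by unfold_locales (auto simp: rot_ul_gen_def free_cat_def)

lemma wf_rotfold_gen: "wf_computad rotfold_gen"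
  by unfold_locales (auto simp: rotfold_gen_def free_cat_def)

interpretation par: wf_computad "parallel_squares S" for S by (rule wf_parallel_squares)
interpretation trunc: wf_computad trunc_h_gen by (rule wf_trunc_h_gen)
interpretation rot_lr: wf_computad rot_lr_gen by (rule wf_rot_lr_gen)
interpretation rot_ul: wf_computad rot_ul_gen by (rule wf_rot_ul_gen)
interpretation rotfold: wf_computad rotfold_gen by (rule wf_rotfold_gen)

lemma computad_Gsq: "Gsq (parallel_squares S) = S" "Gsq trunc_h_gen = UNIV" "Gsq rot_lr_gen = UNIV"
    "Gsq rot_ul_gen = UNIV" "Gsq rotfold_gen = UNIV"
  by (simp_all add: parallel_squares_def trunc_h_gen_def rot_lr_gen_def rot_ul_gen_def rotfold_gen_def)

interpretation simp_fun: computad_map "parallel_squares {0, 1}" walking_square "\<lambda>x. x"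
  "\<lambda>i. ((i, 0), [i])" "\<lambda>j. ((0, j), [j])" "\<lambda>_. sq_class (parallel_squares {0}) (Gen 0)"
proof (rule computad_map.intro[OF wf_parallel_squares par.double_category_free_dbl])
  show "computad_map_axioms (parallel_squares {0, 1}) walking_square (\<lambda>x. x) (\<lambda>i. ((i, 0), [i]))
    (\<lambda>j. ((0, j), [j])) (\<lambda>_. sq_class (parallel_squares {0}) (Gen 0))"
    by unfold_locales
      (simp_all add: par.free_dbl_cats par.sq_class_Sq par.sq_class_sides computad_Gsq,
        auto simp: parallel_squares_def free_cat_def)
qed

interpretation trunc_h_fun: computad_map trunc_h_gen trunc_h_cod "\<lambda>x. x" "\<lambda>_. (0, 1)" "\<lambda>_. 0"
  "\<lambda>_. vid trunc_h_cod (0, 1)"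
proof (rule computad_map.intro[OF wf_trunc_h_gen double_category_HH[OF category_interval_cat]])
  show "computad_map_axioms trunc_h_gen trunc_h_cod (\<lambda>x. x) (\<lambda>_. (0, 1)) (\<lambda>_. 0)
    (\<lambda>_. vid trunc_h_cod (0, 1))"
    by unfold_locales
      (auto simp: trunc_h_gen_def free_cat_def HH_def discrete_cat_def Obj_interval_cat
        Arr_interval_cat interval_cat_simps)
qed

interpretation rotfold_fun: computad_map rotfold_gen rot_lr_cod "\<lambda>x. x" "\<lambda>_. (0, [()])" "\<lambda>_. (0, [()])"
  "\<lambda>_. sq_class rot_lr_gen (Gen ())"
proof (rule computad_map.intro[OF wf_rotfold_gen rot_lr.double_category_free_dbl])
  show "computad_map_axioms rotfold_gen rot_lr_cod (\<lambda>x. x) (\<lambda>_. (0, [()])) (\<lambda>_. (0, [()]))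
    (\<lambda>_. sq_class rot_lr_gen (Gen ()))"
    by unfold_locales
      (simp_all add: rot_lr.free_dbl_cats rot_lr.sq_class_Sq rot_lr.sq_class_sides computad_Gsq,
        auto simp: rotfold_gen_def rot_lr_gen_def free_cat_def)
qed

lemma double_functor_vertical_pick:
  assumes "wf_computad P" "Verts (hgraph P) = {0, 1}" "u \<in> Edges (vgraph P)"
    "esrc (vgraph P) u = 0" "etgt (vgraph P) u = 1"
  shows "double_functor (VV interval_cat) (free_dbl P) (vertical_pick P u)"
proof -
  interpret P: wf_computad P by fact
  let ?V = "\<lambda>(x, y). if x = y then (x, []) else (0, [u])"
  have "Verts (vgraph P) = {0, 1}"
    using assms(2) P.same_Verts by simp
  then have "cat_functor interval_cat P.VC (\<lambda>x. x) ?V"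
    using assms(3-5) unfolding cat_functor_def
    by (auto simp: Obj_interval_cat Arr_interval_cat interval_cat_simps P.VG.free_cat_simps)
  then show ?thesis
    using double_category.double_functor_VV[OF P.double_category_free_dbl category_interval_cat]
    by (simp add: vertical_pick_def P.free_dbl_cats Let_def)
qed

lemma vertical_pick_simps:
  "ob (vertical_pick P u) x = x" "ver (vertical_pick P u) (0, Suc 0) = (0, [u])"
  by (simp_all add: vertical_pick_def Let_def)

lemma double_functor_inv_fun: "double_functor (VV interval_cat) (VV walking_iso) inv_fun"
  unfolding double_functor_def
  by (auto simp: inv_fun_def VV_map_def cat_functor_def VV_def discrete_cat_def hsq_cat_def vsq_cat_def
      Obj_interval_cat Arr_interval_cat interval_cat_simps Obj_walking_iso Arr_walking_iso walking_iso_simps)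

lemma interval_ob_eq:
  assumes "cat_functor interval_cat C Fo Fm" "x \<in> Obj interval_cat"
  shows "Fo x = pick_ob C (Fm (0, 1)) x"
  using assms(2) cat_functor.map_src[OF assms(1), of "(0, 1)"] cat_functor.map_tgt[OF assms(1), of "(0, 1)"]
  by (auto simp: Obj_interval_cat Arr_interval_cat interval_cat_simps pick_ob_def)

lemma interval_cat_functor_eqI:
  assumes "cat_functor interval_cat C Fo Fm" "cat_functor interval_cat C Go Gm"
    and 01: "Fm (0, 1) = Gm (0, 1)" and f: "f \<in> Arr interval_cat"
  shows "Fm f = Gm f"
proof -
  have "Fo x = Go x" if "x \<in> Obj interval_cat" for x
    using interval_ob_eq[OF assms(1) that] interval_ob_eq[OF assms(2) that] 01 by simp
  moreover have "Fm (x, x) = idn C (Fo x) \<and> Gm (x, x) = idn C (Go x)" if "x \<in> Obj interval_cat" for x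
    using cat_functor.map_idn[OF assms(1) that] cat_functor.map_idn[OF assms(2) that]
    by (simp add: interval_cat_simps)
  ultimately show ?thesis
    using f 01 by (auto simp: Arr_interval_cat Obj_interval_cat)
qed

text \<open>A double functor out of \<open>VV interval_cat\<close> amounts to one vertical morphism.
  Hence extending along \<open>inv_fun\<close> or \<open>rot_lr_fun\<close> comes down to one
  equation at \<open>(0, 1)\<close>.\<close>

lemma VV_interval_dfun_eqI:
  assumes "double_functor (VV interval_cat) D F" "double_functor (VV interval_cat) D G"
    and 01: "ver F (0, 1) = ver G (0, 1)"
  shows "dfun_eq (VV interval_cat) F G"
proof -
  have F: "cat_functor interval_cat (vcat D) (ob F) (ver F)"
    and G: "cat_functor interval_cat (vcat D) (ob G) (ver G)"
    using double_functor.ver_functor[OF assms(1)] double_functor.ver_functor[OF assms(2)]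
    by (simp_all add: VV_def)
  show ?thesis
    by (rule VV_dfun_eqI[OF assms(1,2) category_interval_cat])
      (use interval_ob_eq[OF F] interval_ob_eq[OF G] 01 interval_cat_functor_eqI[OF F G 01] in auto)
qed

lemma parallel_squares_simps:
  "Verts (hgraph (parallel_squares S)) = {0, 1} \<times> {0, 1}"
  "Edges (hgraph (parallel_squares S)) = {0, 1}" "esrc (hgraph (parallel_squares S)) i = (i, 0)"
  "Edges (vgraph (parallel_squares S)) = {0, 1}" "esrc (vgraph (parallel_squares S)) j = (0, j)"
  by (simp_all add: parallel_squares_def)

section \<open>Parallel squares, truncation and inverses\<close>

context double_category
begin

text \<open>The set \<open>S\<close> is kept general so that one lemma serves both ends of
  \<open>simp_fun\<close>: vertices and edges go to the boundary of \<open>s\<close>, and the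
  generating squares to any squares with that boundary.\<close>

lemma computad_map_squares:
  assumes s: "s \<in> Sq D" and Fz: "\<And>z. z \<in> S \<Longrightarrow> Fz z \<in> Sq D \<and> sqtop D (Fz z) = sqtop D s \<and>
      sqbot D (Fz z) = sqbot D s \<and> sqleft D (Fz z) = sqleft D s \<and> sqright D (Fz z) = sqright D s"
  shows "computad_map (parallel_squares S) D
      (\<lambda>(i, j). pick_ob (hcat D) (if i = 0 then sqtop D s else sqbot D s) j)
      (\<lambda>i. if i = 0 then sqtop D s else sqbot D s) (\<lambda>j. if j = 0 then sqleft D s else sqright D s) Fz"
proof (rule computad_map.intro[OF wf_parallel_squares double_category_axioms])
  show "computad_map_axioms (parallel_squares S) D
      (\<lambda>(i, j). pick_ob (hcat D) (if i = 0 then sqtop D s else sqbot D s) j)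
      (\<lambda>i. if i = 0 then sqtop D s else sqbot D s) (\<lambda>j. if j = 0 then sqleft D s else sqright D s) Fz"
    using sq_sides[OF s] sq_corners[OF s, symmetric] Fz H.src_Obj H.tgt_Obj
      H.cmp_idn_right[OF sq_sides(1)[OF s]] H.cmp_idn_right[OF sq_sides(2)[OF s]]
      V.cmp_idn_right[OF sq_sides(3)[OF s]] V.cmp_idn_right[OF sq_sides(4)[OF s]]
    by unfold_locales (auto simp: parallel_squares_def pick_ob_def)
qed

text \<open>A double functor out of \<open>simp_dom\<close> is a pair of squares with a common
  boundary, and it factors through \<open>walking_square\<close> exactly when the two are
  equal.\<close>

lemma simp_local_iff:
  "is_local simp_dom walking_square simp_fun D \<longleftrightarrow>
    (\<forall>s \<in> Sq D. \<forall>t \<in> Sq D. sqtop D s = sqtop D t \<longrightarrow> sqbot D s = sqbot D t \<longrightarrow>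
      sqleft D s = sqleft D t \<longrightarrow> sqright D s = sqright D t \<longrightarrow> s = t)" (is "?L \<longleftrightarrow> ?R")
proof
  let ?G = "\<lambda>S i. sq_class (parallel_squares S) (Gen i) :: (nat \<times> nat, nat, nat, nat) sqterm set"
  have simp_gen: "sqr simp_fun (?G {0, 1} i) = ?G {0} 0" if "i \<in> {0, 1}" for i
    unfolding simp_fun_def using simp_fun.sqr_free_ext_gen that by (simp add: computad_Gsq)
  have gen_Sq: "?G {0, 1} i \<in> Sq simp_dom" if "i \<in> {0, 1}" for i
    using that par.sq_class_Sq by (simp add: computad_Gsq)
  show ?R if loc: ?L
  proof (intro ballI impI)
    fix s t assume st: "s \<in> Sq D" "t \<in> Sq D" "sqtop D s = sqtop D t" "sqbot D s = sqbot D t"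
      "sqleft D s = sqleft D t" "sqright D s = sqright D t"
    interpret F: computad_map "parallel_squares {0, 1}" D
      "\<lambda>(i, j). pick_ob (hcat D) (if i = 0 then sqtop D s else sqbot D s) j"
      "\<lambda>i. if i = 0 then sqtop D s else sqbot D s" "\<lambda>j. if j = 0 then sqleft D s else sqright D s"
      "\<lambda>z. if z = 0 then s else t"
      by (rule computad_map_squares) (use st in auto)
    obtain G where G: "dfun_eq simp_dom (dfun_comp G simp_fun)
        (free_ext D (\<lambda>(i, j). pick_ob (hcat D) (if i = 0 then sqtop D s else sqbot D s) j)
          (\<lambda>i. if i = 0 then sqtop D s else sqbot D s) (\<lambda>j. if j = 0 then sqleft D s else sqright D s)
          (\<lambda>z. if z = 0 then s else t))"
      using loc[unfolded is_local_def, rule_format, OF F.double_functor_free_ext]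
      by blast
    \<comment> \<open>Both generators are sent to the one generator of
      \<open>walking_square\<close>, so \<open>s\<close> and \<open>t\<close> are the same value of
      \<open>G\<close>.\<close>
    have "sqr G (?G {0} 0) = (if i = 0 then s else t)" if "i \<in> {0, 1}" for i :: nat
      using dfun_eq_sqr[OF G gen_Sq[OF that]] that simp_gen[OF that] F.sqr_free_ext_gen[of i]
      by (simp add: dfun_comp_def computad_Gsq)
    from this[of 0] this[of 1] show "s = t" by simp
  qed
  show ?L if eq: ?R
    unfolding is_local_def
  proof (intro allI impI)
    fix F
    assume F: "double_functor simp_dom D F"
    interpret F: double_functor simp_dom D F by fact
    define s where "s = sqr F (?G {0, 1} 0)"
    have gen_sides: "sqtop simp_dom (?G {0, 1} i) = ((0, 0), [0])" "sqbot simp_dom (?G {0, 1} i) = ((1, 0), [1])"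
      "sqleft simp_dom (?G {0, 1} i) = ((0, 0), [0])" "sqright simp_dom (?G {0, 1} i) = ((0, 1), [1])"
      if "i \<in> {0, 1}" for i
      using that par.sq_class_sides[of "{0, 1}" "Gen i"] by (simp_all add: computad_Gsq)
        (simp_all add: parallel_squares_def)
    have sides: "sqr F (?G {0, 1} i) \<in> Sq D" "sqtop D (sqr F (?G {0, 1} i)) = hor F ((0, 0), [0])"
        "sqbot D (sqr F (?G {0, 1} i)) = hor F ((1, 0), [1])"
        "sqleft D (sqr F (?G {0, 1} i)) = ver F ((0, 0), [0])"
        "sqright D (sqr F (?G {0, 1} i)) = ver F ((0, 1), [1])" if "i \<in> {0, 1}" for i
      using F.sqr_sq[OF gen_Sq[OF that]] unfolding gen_sides[OF that] by blast+
    have s1: "sqr F (?G {0, 1} i) = s" if "i \<in> {0, 1}" for i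
      using eq[rule_format, OF sides(1)[OF that] sides(1)[of 0, OF insertI1]] sides[OF that] sides[of 0, OF insertI1]
      unfolding s_def by simp
    note sides = sides[of 0, OF insertI1, folded s_def]
    \<comment> \<open>Each vertex is an end of a horizontal edge, so the values on horizontal edges
      determine \<open>F\<close> on objects.\<close>
    have ob_F: "ob F (i, j) = pick_ob (hcat D) (hor F ((i, 0), [i])) j" if "i \<in> {0, 1}" "j \<in> {0, 1}" for i j
    proof -
      have "((i, 0), [i]) \<in> Arr (hcat simp_dom)" "src (hcat simp_dom) ((i, 0), [i]) = (i, 0)"
        "tgt (hcat simp_dom) ((i, 0), [i]) = (i, 1)"
        using that(1) unfolding par.free_dbl_cats by (auto simp: parallel_squares_def free_cat_def)
      then show ?thesis
        using that(2) F.H.map_src[of "((i, 0), [i])"] F.H.map_tgt[of "((i, 0), [i])"]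
        by (auto simp: pick_ob_def)
    qed
    interpret G: computad_map "parallel_squares {0}" D
      "\<lambda>(i, j). pick_ob (hcat D) (if i = 0 then sqtop D s else sqbot D s) j"
      "\<lambda>i. if i = 0 then sqtop D s else sqbot D s" "\<lambda>j. if j = 0 then sqleft D s else sqright D s"
      "\<lambda>_. s"
      by (rule computad_map_squares) (use sides in auto)
    let ?H = "free_ext D (\<lambda>(i, j). pick_ob (hcat D) (if i = 0 then sqtop D s else sqbot D s) j)
      (\<lambda>i. if i = 0 then sqtop D s else sqbot D s) (\<lambda>j. if j = 0 then sqleft D s else sqright D s)
      (\<lambda>_. s) :: (_, _, _, (nat \<times> nat, nat, nat, nat) sqterm set, _, _, _, _) dfun"
    have "dfun_eq simp_dom (dfun_comp ?H simp_fun) F"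
    proof (rule par.free_dbl_dfun_eqI[OF _ F])
      show "double_functor simp_dom D (dfun_comp ?H simp_fun)"
        using double_functor_comp[OF simp_fun.double_functor_free_ext G.double_functor_free_ext]
        by (simp add: simp_fun_def)
      show "ob (dfun_comp ?H simp_fun) x = ob F x" if vert: "x \<in> Verts (hgraph (parallel_squares {0, 1}))" for x
      proof -
        obtain i j where x: "x = (i, j)" and ij: "i \<in> {0, 1}" "j \<in> {0, 1}"
          using vert unfolding parallel_squares_simps by (cases x) auto
        show ?thesis
          using ob_F[OF ij] ij(1) unfolding x dfun_comp_def simp_fun_def free_ext_def
          by (auto simp: sides)
      qed
      show "hor (dfun_comp ?H simp_fun) (esrc (hgraph (parallel_squares {0, 1})) e, [e]) =
          hor F (esrc (hgraph (parallel_squares {0, 1})) e, [e])"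
        if "e \<in> Edges (hgraph (parallel_squares {0, 1}))" for e
      proof -
        have e: "e \<in> {0, 1}"
          using that unfolding parallel_squares_simps .
        have "hor (dfun_comp ?H simp_fun) ((e, 0), [e]) = hor ?H ((e, 0), [e])"
          using simp_fun.hor_free_ext_edge[of e] e unfolding parallel_squares_simps dfun_comp_def simp_fun_def
          by simp
        also have "\<dots> = hor F ((e, 0), [e])"
          using G.hor_free_ext_edge[of e] e unfolding parallel_squares_simps by (auto simp: sides)
        finally show ?thesis
          unfolding parallel_squares_simps .
      qed
      show "ver (dfun_comp ?H simp_fun) (esrc (vgraph (parallel_squares {0, 1})) e, [e]) =
          ver F (esrc (vgraph (parallel_squares {0, 1})) e, [e])"
        if "e \<in> Edges (vgraph (parallel_squares {0, 1}))" for e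
      proof -
        have e: "e \<in> {0, 1}"
          using that unfolding parallel_squares_simps .
        have "ver (dfun_comp ?H simp_fun) ((0, e), [e]) = ver ?H ((0, e), [e])"
          using simp_fun.ver_free_ext_edge[of e] e unfolding parallel_squares_simps dfun_comp_def simp_fun_def
          by simp
        also have "\<dots> = ver F ((0, e), [e])"
          using G.ver_free_ext_edge[of e] e unfolding parallel_squares_simps by (auto simp: sides)
        finally show ?thesis
          unfolding parallel_squares_simps .
      qed
      show "sqr (dfun_comp ?H simp_fun) (?G {0, 1} z) = sqr F (?G {0, 1} z)"
        if "z \<in> Gsq (parallel_squares {0, 1})" for z
        using that simp_gen G.sqr_free_ext_gen[of 0] s1 by (auto simp: dfun_comp_def computad_Gsq)
    qed
    then show "\<exists>G. double_functor walking_square D G \<and> dfun_eq simp_dom (dfun_comp G simp_fun) F"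
      using G.double_functor_free_ext by blast
  qed
qed

text \<open>All squares of \<open>HH interval_cat\<close> are vertical identities, and double
  functors preserve these. Conversely, a generating square sent to a vertical identity identifies
  the images of \<open>Alpha\<close> and \<open>Beta\<close>, leaving just a horizontal
  morphism.\<close>

lemma trunc_h_local_iff:
  "is_local trunc_h_dom trunc_h_cod trunc_h_fun D \<longleftrightarrow>
    (\<forall>s \<in> Sq D. \<forall>x \<in> Obj (vcat D). \<forall>y \<in> Obj (vcat D).
      sqleft D s = idn (vcat D) x \<longrightarrow> sqright D s = idn (vcat D) y \<longrightarrow> s = vid D (sqtop D s))" (is "?L \<longleftrightarrow> ?R")
proof
  let ?s = "sq_class trunc_h_gen (Gen ()) :: (nat, trunc_edge, unit, unit) sqterm set"
  have trunc_gen: "sqr trunc_h_fun ?s = (0, 1)" "?s \<in> Sq trunc_h_dom"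
    using trunc_h_fun.sqr_free_ext_gen[of "()"] trunc.sq_class_Sq[of "Gen ()"]
    by (simp_all add: trunc_h_fun_def computad_Gsq) (simp add: HH_def)
  show ?R if loc: ?L
  proof (intro ballI impI)
    fix s x y assume s: "s \<in> Sq D" "x \<in> Obj (vcat D)" "y \<in> Obj (vcat D)"
      "sqleft D s = idn (vcat D) x" "sqright D s = idn (vcat D) y"
    \<comment> \<open>The identity sides give top and bottom the same endpoints, so the objects can
      be read off the top. There are no vertical edges, whence the value
      \<open>undefined\<close>.\<close>
    interpret F: computad_map trunc_h_gen D "pick_ob (hcat D) (sqtop D s)"
      "\<lambda>e. case e of Alpha \<Rightarrow> sqtop D s | Beta \<Rightarrow> sqbot D s" "\<lambda>_. undefined" "\<lambda>_. s"
    proof (rule computad_map.intro[OF wf_trunc_h_gen double_category_axioms])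
      show "computad_map_axioms trunc_h_gen D (pick_ob (hcat D) (sqtop D s))
          (\<lambda>e. case e of Alpha \<Rightarrow> sqtop D s | Beta \<Rightarrow> sqbot D s) (\<lambda>_. undefined) (\<lambda>_. s)"
        using sq_sides[OF s(1)] sq_corners[OF s(1)] s H.cmp_idn_right[of "sqtop D s"]
          H.cmp_idn_right[of "sqbot D s"] H.src_Obj H.tgt_Obj
        by unfold_locales
          (auto simp: trunc_h_gen_def pick_ob_def V.src_idn V.tgt_idn same_Obj split: trunc_edge.splits)
    qed
    obtain G where G: "double_functor trunc_h_cod D G"
      and "dfun_eq trunc_h_dom (dfun_comp G trunc_h_fun) (free_ext D (pick_ob (hcat D) (sqtop D s))
        (\<lambda>e. case e of Alpha \<Rightarrow> sqtop D s | Beta \<Rightarrow> sqbot D s) (\<lambda>_. undefined) (\<lambda>_. s))"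
      using loc[unfolded is_local_def, rule_format, OF F.double_functor_free_ext] by blast
    then have "sqr G (0, 1) = s"
      using trunc_gen F.sqr_free_ext_gen[of "()"] by (auto simp: dfun_eq_def dfun_comp_def computad_Gsq)
    moreover have "sqr G (0, 1) = vid D (hor G (0, 1))"
      using double_functor.sqr_vid[OF G, of "(0, 1)"] by (simp add: HH_def Arr_interval_cat)
    moreover have "hor G (0, 1) \<in> Arr (hcat D)"
      using cat_functor.map_Arr[OF double_functor.hor_functor[OF G], of "(0, 1)"]
      by (simp add: HH_def Arr_interval_cat)
    ultimately show "s = vid D (sqtop D s)"
      using vid_sq by metis
  qed
  show ?L if vid: ?R
    unfolding is_local_def
  proof (intro allI impI)
    fix F
    assume F: "double_functor trunc_h_dom D F"
    interpret F: double_functor trunc_h_dom D F by fact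
    have paths: "(0, [Alpha]) \<in> Arr (hcat trunc_h_dom)" "(0, [Beta]) \<in> Arr (hcat trunc_h_dom)"
      "src (hcat trunc_h_dom) (0, [Alpha]) = 0" "tgt (hcat trunc_h_dom) (0, [Alpha]) = 1"
      "Obj (hcat trunc_h_dom) = {0, 1}" "Obj (vcat trunc_h_dom) = {0, 1}"
      "idn (vcat trunc_h_dom) 0 = (0, [])" "idn (vcat trunc_h_dom) 1 = (1, [])"
      unfolding trunc.free_dbl_cats by (auto simp: free_cat_def trunc_h_gen_def)
    have gen: "sqtop trunc_h_dom ?s = (0, [Alpha])" "sqbot trunc_h_dom ?s = (0, [Beta])"
      "sqleft trunc_h_dom ?s = (0, [])" "sqright trunc_h_dom ?s = (1, [])"
      by (simp_all add: trunc.sq_class_sides computad_Gsq) (simp_all add: trunc_h_gen_def)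
    let ?f = "hor F (0, [Alpha])"
    have f: "?f \<in> Arr (hcat D)" "ob F 0 = src (hcat D) ?f" "ob F (Suc 0) = tgt (hcat D) ?f"
      using paths F.H.map_Arr[of "(0, [Alpha])"] F.H.map_src[of "(0, [Alpha])"]
        F.H.map_tgt[of "(0, [Alpha])"] by simp_all
    have "sqleft D (sqr F ?s) = idn (vcat D) (ob F 0)" "sqright D (sqr F ?s) = idn (vcat D) (ob F 1)"
      using F.sqr_sq[OF trunc_gen(2)] gen F.V.map_idn[of 0] F.V.map_idn[of 1] paths by simp_all
    then have "sqr F ?s = vid D (sqtop D (sqr F ?s))"
      using vid F.sqr_sq[OF trunc_gen(2)] F.V.map_Obj[of 0] F.V.map_Obj[of 1] paths by auto
    then have s: "sqr F ?s = vid D ?f"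
      using F.sqr_sq[OF trunc_gen(2)] gen by simp
    \<comment> \<open>The bottom of a vertical identity square is its top, here the image of
      \<open>Alpha\<close>.\<close>
    then have beta: "hor F (0, [Beta]) = ?f"
      using F.sqr_sq(3)[OF trunc_gen(2)] gen vid_sq(3)[OF f(1)] by simp
    let ?G = "\<lparr>ob = pick_ob (hcat D) ?f, hor = pick_arr (hcat D) ?f undefined,
      ver = (\<lambda>x. idn (vcat D) (pick_ob (hcat D) ?f x)), sqr = (\<lambda>m. vid D (pick_arr (hcat D) ?f undefined m))\<rparr>"
    have G: "double_functor trunc_h_cod D ?G"
      by (rule double_functor_HH[OF category_interval_cat H.cat_functor_pick_interval[OF f(1)]])
    have "dfun_eq trunc_h_dom (dfun_comp ?G trunc_h_fun) F"
    proof (rule trunc.free_dbl_dfun_eqI[OF _ F])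
      show "double_functor trunc_h_dom D (dfun_comp ?G trunc_h_fun)"
        using double_functor_comp[OF trunc_h_fun.double_functor_free_ext G] by (simp add: trunc_h_fun_def)
      show "ob (dfun_comp ?G trunc_h_fun) x = ob F x" if "x \<in> Verts (hgraph trunc_h_gen)" for x
        using that f by (auto simp: dfun_comp_def trunc_h_fun_def free_ext_def trunc_h_gen_def pick_ob_def)
      show "hor (dfun_comp ?G trunc_h_fun) (esrc (hgraph trunc_h_gen) e, [e]) =
          hor F (esrc (hgraph trunc_h_gen) e, [e])" if "e \<in> Edges (hgraph trunc_h_gen)" for e
        using trunc_h_fun.hor_free_ext_edge[OF that] beta
        by (cases e) (auto simp: dfun_comp_def trunc_h_fun_def pick_arr_def, auto simp: trunc_h_gen_def)
      show "ver (dfun_comp ?G trunc_h_fun) (esrc (vgraph trunc_h_gen) e, [e]) =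
          ver F (esrc (vgraph trunc_h_gen) e, [e])" if "e \<in> Edges (vgraph trunc_h_gen)" for e
        using that by (simp add: trunc_h_gen_def)
      show "sqr (dfun_comp ?G trunc_h_fun) (sq_class trunc_h_gen (Gen z)) = sqr F (sq_class trunc_h_gen (Gen z))"
        for z
        using trunc_gen s by (simp add: dfun_comp_def pick_arr_def)
    qed
    then show "\<exists>G. double_functor trunc_h_cod D G \<and> dfun_eq trunc_h_dom (dfun_comp G trunc_h_fun) F"
      using G by blast
  qed
qed

text \<open>An extension along \<open>inv_fun\<close> is a choice of inverse for the given vertical
  morphism, since functors out of the walking isomorphism are arrows with an inverse.\<close>

lemma inv_local_iff:
  "is_local (VV interval_cat) (VV walking_iso) inv_fun D \<longleftrightarrow> (\<forall>u \<in> Arr (vcat D). iso_arr (vcat D) u)"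
    (is "?L \<longleftrightarrow> ?R")
proof
  show ?R if loc: ?L
  proof
    fix u assume u: "u \<in> Arr (vcat D)"
    obtain G where G: "double_functor (VV walking_iso) D G"
      and "dfun_eq (VV interval_cat) (dfun_comp G inv_fun) \<lparr>ob = pick_ob (vcat D) u,
        hor = (\<lambda>x. idn (hcat D) (pick_ob (vcat D) u x)), ver = pick_arr (vcat D) u undefined,
        sqr = (\<lambda>m. hid D (pick_arr (vcat D) u undefined m))\<rparr>"
      using loc[unfolded is_local_def, rule_format,
          OF double_functor_VV[OF category_interval_cat V.cat_functor_pick_interval[OF u]]]
      by blast
    then have "ver G (0, 1) = u"
      by (auto simp: dfun_eq_def dfun_comp_def inv_fun_def VV_map_def pick_arr_def VV_def Arr_interval_cat)
    then show "iso_arr (vcat D) u"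
      using cat_functor_iso_arr[OF double_functor.ver_functor[OF G], of "(0, 1)"] category_walking_iso
        iso_arr_walking_iso[of "(0, 1)"] by (simp add: VV_def Arr_walking_iso)
  qed
  show ?L if iso: ?R
    unfolding is_local_def
  proof (intro allI impI)
    fix F assume F: "double_functor (VV interval_cat) D F"
    let ?u = "ver F (0, 1)"
    have "?u \<in> Arr (vcat D)"
      using cat_functor.map_Arr[OF double_functor.ver_functor[OF F], of "(0, 1)"]
      by (simp add: VV_def Arr_interval_cat)
    then obtain v where "?u \<in> Arr (vcat D)" "v \<in> Arr (vcat D)" "src (vcat D) v = tgt (vcat D) ?u"
      "tgt (vcat D) v = src (vcat D) ?u" "cmp (vcat D) v ?u = idn (vcat D) (src (vcat D) ?u)"
      "cmp (vcat D) ?u v = idn (vcat D) (tgt (vcat D) ?u)"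
      using iso unfolding iso_arr_def by blast
    note G = double_functor_VV[OF category_walking_iso V.cat_functor_pick_walking_iso[OF this]]
    show "\<exists>G. double_functor (VV walking_iso) D G \<and> dfun_eq (VV interval_cat) (dfun_comp G inv_fun) F"
      by (intro exI conjI, rule G, rule VV_interval_dfun_eqI[OF double_functor_comp[OF double_functor_inv_fun G] F])
        (simp add: dfun_comp_def inv_fun_def VV_map_def pick_arr_def)
  qed
qed

section \<open>Rotation squares as double functors\<close>

lemma lr_square_boundary:
  assumes "lr_square D a u s"
  shows "s \<in> Sq D" "a \<in> Arr (hcat D)" "u \<in> Arr (vcat D)"
    "src (vcat D) u = src (hcat D) a" "tgt (vcat D) u = tgt (hcat D) a"
    "sqtop D s = a" "sqleft D s = u" "sqright D s = idn (vcat D) (tgt (hcat D) a)"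
    "sqbot D s = idn (hcat D) (tgt (hcat D) a)"
  using assms sq_sides[of s] sq_corners[of s] H.tgt_Obj[of a] by (auto simp: lr_square_def H.src_idn)

lemma ul_square_boundary:
  assumes "ul_square D a u s"
  shows "s \<in> Sq D" "a \<in> Arr (hcat D)" "u \<in> Arr (vcat D)"
    "src (vcat D) u = src (hcat D) a" "tgt (vcat D) u = tgt (hcat D) a"
    "sqbot D s = a" "sqright D s = u" "sqleft D s = idn (vcat D) (src (hcat D) a)"
    "sqtop D s = idn (hcat D) (src (hcat D) a)"
  using assms sq_sides[of s] sq_corners[of s] H.src_Obj[of a] by (auto simp: ul_square_def H.tgt_idn)

lemma computad_map_lr:
  assumes "lr_square D a u s"
  shows "computad_map rot_lr_gen D (pick_ob (hcat D) a) (\<lambda>_. a) (\<lambda>_. u) (\<lambda>_. s)"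
proof (rule computad_map.intro[OF wf_rot_lr_gen double_category_axioms])
  show "computad_map_axioms rot_lr_gen D (pick_ob (hcat D) a) (\<lambda>_. a) (\<lambda>_. u) (\<lambda>_. s)"
    using lr_square_boundary[OF assms] H.src_Obj[of a] H.tgt_Obj[of a] H.cmp_idn_right[of a] V.cmp_idn_right[of u]
    by unfold_locales (auto simp: rot_lr_gen_def pick_ob_def)
qed

lemma computad_map_rotfold:
  assumes "lr_square D a u s" "lr_square D a v t"
  shows "computad_map rotfold_gen D (pick_ob (hcat D) a) (\<lambda>_. a) (\<lambda>e. case e of EdgeF \<Rightarrow> u | EdgeG \<Rightarrow> v)
    (\<lambda>e. case e of EdgeF \<Rightarrow> s | EdgeG \<Rightarrow> t)"
proof (rule computad_map.intro[OF wf_rotfold_gen double_category_axioms])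
  show "computad_map_axioms rotfold_gen D (pick_ob (hcat D) a) (\<lambda>_. a) (\<lambda>e. case e of EdgeF \<Rightarrow> u | EdgeG \<Rightarrow> v)
    (\<lambda>e. case e of EdgeF \<Rightarrow> s | EdgeG \<Rightarrow> t)"
    using lr_square_boundary[OF assms(1)] lr_square_boundary[OF assms(2)] H.src_Obj[of a] H.tgt_Obj[of a]
      H.cmp_idn_right[of a] V.cmp_idn_right[of u] V.cmp_idn_right[of v]
    by unfold_locales (auto simp: rotfold_gen_def pick_ob_def split: rotfold_edge.splits)
qed

text \<open>Converse to \<open>computad_map_lr\<close>: together they identify double functors out
  of \<open>rot_lr_cod\<close> with lower-right squares. The second claim recovers the objects from
  the horizontal generator.\<close>

lemma lr_square_rot_lr_cod:
  assumes "double_functor rot_lr_cod D F"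
  shows "lr_square D (hor F (0, [()])) (ver F (0, [()])) (sqr F (sq_class rot_lr_gen (Gen ())))"
    "x \<in> {0, 1} \<Longrightarrow> ob F x = pick_ob (hcat D) (hor F (0, [()])) x"
proof -
  let ?A = rot_lr_cod and ?s = "sq_class rot_lr_gen (Gen ()) :: (nat, unit, unit, unit) sqterm set"
  interpret F: double_functor ?A D F by fact
  have A: "(0, [()]) \<in> Arr (hcat ?A)" "tgt (hcat ?A) (0, [()]) = 1" "src (hcat ?A) (0, [()]) = 0"
    "1 \<in> Obj (hcat ?A)" "1 \<in> Obj (vcat ?A)" "idn (hcat ?A) 1 = (1, [])" "idn (vcat ?A) 1 = (1, [])"
    unfolding rot_lr.free_dbl_cats by (auto simp: free_cat_def rot_lr_gen_def)
  have s: "?s \<in> Sq ?A" "sqtop ?A ?s = (0, [()])" "sqbot ?A ?s = (1, [])" "sqleft ?A ?s = (0, [()])"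
    "sqright ?A ?s = (1, [])"
    using rot_lr.sq_class_Sq[of "Gen ()"] rot_lr.sq_class_sides[of "Gen ()"]
    by (simp_all add: computad_Gsq) (simp_all add: rot_lr_gen_def)
  have ob: "ob F 0 = src (hcat D) (hor F (0, [()]))" "ob F 1 = tgt (hcat D) (hor F (0, [()]))"
    using F.H.map_src[OF A(1)] F.H.map_tgt[OF A(1)] unfolding A by simp_all
  show "lr_square D (hor F (0, [()])) (ver F (0, [()])) (sqr F ?s)"
    using F.sqr_sq[OF s(1)] F.H.map_idn[OF A(4)] F.V.map_idn[OF A(5)] unfolding lr_square_def s A ob by simp
  show "ob F x = pick_ob (hcat D) (hor F (0, [()])) x" if "x \<in> {0, 1}"
    using that ob by (auto simp: pick_ob_def)
qed

lemma ul_square_rot_ul_cod: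
  assumes "double_functor rot_ul_cod D F"
  shows "ul_square D (hor F (0, [()])) (ver F (0, [()])) (sqr F (sq_class rot_ul_gen (Gen ())))"
proof -
  let ?A = rot_ul_cod and ?s = "sq_class rot_ul_gen (Gen ()) :: (nat, unit, unit, unit) sqterm set"
  interpret F: double_functor ?A D F by fact
  have A: "(0, [()]) \<in> Arr (hcat ?A)" "src (hcat ?A) (0, [()]) = 0"
    "0 \<in> Obj (hcat ?A)" "0 \<in> Obj (vcat ?A)" "idn (hcat ?A) 0 = (0, [])" "idn (vcat ?A) 0 = (0, [])"
    unfolding rot_ul.free_dbl_cats by (auto simp: free_cat_def rot_ul_gen_def)
  have s: "?s \<in> Sq ?A" "sqbot ?A ?s = (0, [()])" "sqtop ?A ?s = (0, [])" "sqright ?A ?s = (0, [()])"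
    "sqleft ?A ?s = (0, [])"
    using rot_ul.sq_class_Sq[of "Gen ()"] rot_ul.sq_class_sides[of "Gen ()"]
    by (simp_all add: computad_Gsq) (simp_all add: rot_ul_gen_def)
  have ob: "ob F 0 = src (hcat D) (hor F (0, [()]))"
    using F.H.map_src[OF A(1)] unfolding A by simp
  show ?thesis
    using F.sqr_sq[OF s(1)] F.H.map_idn[OF A(3)] F.V.map_idn[OF A(4)] unfolding ul_square_def s A ob by simp
qed

lemma lr_square_rotfold_dom:
  assumes "double_functor rotfold_dom D F"
  shows "lr_square D (hor F (0, [()])) (ver F (0, [e])) (sqr F (sq_class rotfold_gen (Gen e)))"
    "x \<in> {0, 1} \<Longrightarrow> ob F x = pick_ob (hcat D) (hor F (0, [()])) x"
proof -
  let ?A = rotfold_dom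
    and ?s = "sq_class rotfold_gen (Gen e) :: (nat, unit, rotfold_edge, rotfold_edge) sqterm set"
  interpret F: double_functor ?A D F by fact
  have A: "(0, [()]) \<in> Arr (hcat ?A)" "tgt (hcat ?A) (0, [()]) = 1" "src (hcat ?A) (0, [()]) = 0"
    "1 \<in> Obj (hcat ?A)" "1 \<in> Obj (vcat ?A)" "idn (hcat ?A) 1 = (1, [])" "idn (vcat ?A) 1 = (1, [])"
    unfolding rotfold.free_dbl_cats by (auto simp: free_cat_def rotfold_gen_def)
  have s: "?s \<in> Sq ?A" "sqtop ?A ?s = (0, [()])" "sqbot ?A ?s = (1, [])" "sqleft ?A ?s = (0, [e])"
    "sqright ?A ?s = (1, [])"
    using rotfold.sq_class_Sq[of "Gen e"] rotfold.sq_class_sides[of "Gen e"]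
    by (simp_all add: computad_Gsq) (simp_all add: rotfold_gen_def)
  have ob: "ob F 0 = src (hcat D) (hor F (0, [()]))" "ob F 1 = tgt (hcat D) (hor F (0, [()]))"
    using F.H.map_src[OF A(1)] F.H.map_tgt[OF A(1)] unfolding A by simp_all
  show "lr_square D (hor F (0, [()])) (ver F (0, [e])) (sqr F ?s)"
    using F.sqr_sq[OF s(1)] F.H.map_idn[OF A(4)] F.V.map_idn[OF A(5)] unfolding lr_square_def s A ob by simp
  show "ob F x = pick_ob (hcat D) (hor F (0, [()])) x" if "x \<in> {0, 1}"
    using that ob by (auto simp: pick_ob_def)
qed

text \<open>A double functor out of \<open>rotfold_dom\<close> is a pair of lower-right squares over
  one horizontal morphism; it factors through \<open>rot_lr_cod\<close> exactly when the pair is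
  constant.\<close>

lemma rotfold_local_iff:
  "is_local rotfold_dom rot_lr_cod rotfold_fun D \<longleftrightarrow>
    (\<forall>a u v s t. lr_square D a u s \<longrightarrow> lr_square D a v t \<longrightarrow> u = v \<and> s = t)" (is "?L \<longleftrightarrow> ?R")
proof
  let ?s = "sq_class rot_lr_gen (Gen ()) :: (nat, unit, unit, unit) sqterm set"
  let ?t = "\<lambda>e. sq_class rotfold_gen (Gen e) :: (nat, unit, rotfold_edge, rotfold_edge) sqterm set"
  have rotfold_images: "hor rotfold_fun (0, [()]) = (0, [()])" "ver rotfold_fun (0, [e]) = (0, [()])"
    "sqr rotfold_fun (?t e) = ?s" for e
    using rotfold_fun.hor_free_ext_edge[of "()"] rotfold_fun.ver_free_ext_edge[of e]
      rotfold_fun.sqr_free_ext_gen[of e]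
    by (simp_all add: rotfold_fun_def computad_Gsq) (simp_all add: rotfold_gen_def)
  have gen: "?t e \<in> Sq rotfold_dom" "(0, [e]) \<in> Arr (vcat rotfold_dom)" for e
    using rotfold.sq_class_Sq[of "Gen e"] unfolding rotfold.free_dbl_cats
    by (simp_all add: computad_Gsq) (simp add: rotfold_gen_def free_cat_def)
  show ?R if loc: ?L
  proof (intro allI impI)
    fix a u v s t assume st: "lr_square D a u s" "lr_square D a v t"
    interpret F: computad_map rotfold_gen D "pick_ob (hcat D) a" "\<lambda>_. a" "\<lambda>e. case e of EdgeF \<Rightarrow> u | EdgeG \<Rightarrow> v"
      "\<lambda>e. case e of EdgeF \<Rightarrow> s | EdgeG \<Rightarrow> t"
      by (rule computad_map_rotfold[OF st])
    let ?F = "free_ext D (pick_ob (hcat D) a) (\<lambda>_. a) (\<lambda>e. case e of EdgeF \<Rightarrow> u | EdgeG \<Rightarrow> v)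
      (\<lambda>e. case e of EdgeF \<Rightarrow> s | EdgeG \<Rightarrow> t) :: (_, _, _, (nat, unit, rotfold_edge, rotfold_edge) sqterm set, _, _, _, _) dfun"
    obtain G where G: "dfun_eq rotfold_dom (dfun_comp G rotfold_fun) ?F"
      using loc[unfolded is_local_def, rule_format, OF F.double_functor_free_ext] by blast
    have "sqr G ?s = sqr ?F (?t e)" "ver G (0, [()]) = ver ?F (0, [e])" for e
      using dfun_eq_sqr[OF G gen(1)[of e]] dfun_eq_ver[OF G gen(2)[of e]]
      by (simp_all add: dfun_comp_def rotfold_images)
    moreover have "sqr ?F (?t EdgeF) = s" "sqr ?F (?t EdgeG) = t"
      "ver ?F (0, [EdgeF]) = u" "ver ?F (0, [EdgeG]) = v"
      using F.sqr_free_ext_gen[of EdgeF] F.sqr_free_ext_gen[of EdgeG]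
        F.ver_free_ext_edge[of EdgeF] F.ver_free_ext_edge[of EdgeG]
      by (simp_all add: computad_Gsq) (simp_all add: rotfold_gen_def)
    ultimately show "u = v \<and> s = t"
      by metis
  qed
  show ?L if eq: ?R
    unfolding is_local_def
  proof (intro allI impI)
    fix F assume F: "double_functor rotfold_dom D F"
    let ?a = "hor F (0, [()])"
    define u where "u = ver F (0, [EdgeF])"
    define r where "r = sqr F (?t EdgeF)"
    have same: "ver F (0, [e]) = u" "sqr F (?t e) = r" for e
      using eq lr_square_rotfold_dom(1)[OF F] unfolding u_def r_def by blast+
    have lr: "lr_square D ?a u r"
      using lr_square_rotfold_dom(1)[OF F] unfolding u_def r_def .
    interpret G: computad_map rot_lr_gen D "pick_ob (hcat D) ?a" "\<lambda>_. ?a" "\<lambda>_. u" "\<lambda>_. r"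
      by (rule computad_map_lr[OF lr])
    let ?G = "free_ext D (pick_ob (hcat D) ?a) (\<lambda>_. ?a) (\<lambda>_. u) (\<lambda>_. r)
      :: (_, _, _, (nat, unit, unit, unit) sqterm set, _, _, _, _) dfun"
    have G: "hor ?G (0, [()]) = ?a" "ver ?G (0, [()]) = u" "sqr ?G ?s = r"
      using G.hor_free_ext_edge[of "()"] G.ver_free_ext_edge[of "()"] G.sqr_free_ext_gen[of "()"]
      by (simp_all add: computad_Gsq) (simp_all add: rot_lr_gen_def)
    have src0: "esrc (hgraph rotfold_gen) e = 0" "esrc (vgraph rotfold_gen) d = 0"
      "Verts (hgraph rotfold_gen) = {0, 1}" for e d
      by (simp_all add: rotfold_gen_def)
    have "dfun_eq rotfold_dom (dfun_comp ?G rotfold_fun) F"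
    proof (rule rotfold.free_dbl_dfun_eqI[OF _ F])
      show "double_functor rotfold_dom D (dfun_comp ?G rotfold_fun)"
        using double_functor_comp[OF rotfold_fun.double_functor_free_ext G.double_functor_free_ext]
        by (simp add: rotfold_fun_def)
      show "ob (dfun_comp ?G rotfold_fun) x = ob F x" if "x \<in> Verts (hgraph rotfold_gen)" for x
        using lr_square_rotfold_dom(2)[OF F, of x] that unfolding src0
        by (simp add: dfun_comp_def rotfold_fun_def free_ext_def)
    qed (simp_all add: src0 dfun_comp_def rotfold_images G same)
    then show "\<exists>G. double_functor rot_lr_cod D G \<and> dfun_eq rotfold_dom (dfun_comp G rotfold_fun) F"
      using G.double_functor_free_ext by blast
  qed
qed

lemma double_functor_pick_vertical:
  assumes "u \<in> Arr (vcat D)"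
  shows "\<exists>F. double_functor (VV interval_cat) D F \<and> ver F (0, 1) = u"
  using double_functor_VV[OF category_interval_cat V.cat_functor_pick_interval[OF assms, of undefined]]
  by (intro exI conjI, assumption) (simp add: pick_arr_def)

lemma rot_lr_local_lr_square:
  assumes loc: "is_local rot_dom rot_lr_cod rot_lr_fun D" and u: "u \<in> Arr (vcat D)"
  shows "\<exists>a s. lr_square D a u s"
proof -
  obtain F where F: "double_functor (VV interval_cat) D F" "ver F (0, 1) = u"
    using double_functor_pick_vertical[OF u] by blast
  obtain G where G: "double_functor rot_lr_cod D G" "dfun_eq rot_dom (dfun_comp G rot_lr_fun) F"
    using loc[unfolded is_local_def, rule_format, OF F(1)] by blast
  have "ver G (0, [()]) = u"
    using G(2) F(2) by (auto simp: dfun_eq_def dfun_comp_def rot_lr_fun_def vertical_pick_simps VV_def Arr_interval_cat)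
  then show ?thesis
    using lr_square_rot_lr_cod(1)[OF G(1)] by auto
qed

lemma rot_ul_local_ul_square:
  assumes loc: "is_local rot_dom rot_ul_cod rot_ul_fun D" and u: "u \<in> Arr (vcat D)"
  shows "\<exists>a s. ul_square D a u s"
proof -
  obtain F where F: "double_functor (VV interval_cat) D F" "ver F (0, 1) = u"
    using double_functor_pick_vertical[OF u] by blast
  obtain G where G: "double_functor rot_ul_cod D G" "dfun_eq rot_dom (dfun_comp G rot_ul_fun) F"
    using loc[unfolded is_local_def, rule_format, OF F(1)] by blast
  have "ver G (0, [()]) = u"
    using G(2) F(2) by (auto simp: dfun_eq_def dfun_comp_def rot_ul_fun_def vertical_pick_simps VV_def Arr_interval_cat)
  then show ?thesis
    using ul_square_rot_ul_cod[OF G(1)] by auto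
qed

text \<open>An extension is determined by its values on the horizontal generator, the vertical
  generator and the square. The vertical one is prescribed by \<open>F\<close>, and
  \<open>uniq\<close> fixes the other two.\<close>

lemma rot_lr_strictly_localI:
  assumes "\<And>u. u \<in> Arr (vcat D) \<Longrightarrow> \<exists>a s. lr_square D a u s"
    and uniq: "\<And>a b u s t. \<lbrakk>lr_square D a u s; lr_square D b u t\<rbrakk> \<Longrightarrow> a = b \<and> s = t"
  shows "is_strictly_local rot_dom rot_lr_cod rot_lr_fun D"
  unfolding is_strictly_local_def
proof (intro allI impI)
  fix F assume F: "double_functor (VV interval_cat) D F"
  let ?u = "ver F (0, 1)" and ?s = "sq_class rot_lr_gen (Gen ()) :: (nat, unit, unit, unit) sqterm set"
  have "?u \<in> Arr (vcat D)"
    using cat_functor.map_Arr[OF double_functor.ver_functor[OF F], of "(0, 1)"]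
    by (simp add: VV_def Arr_interval_cat)
  then obtain a s where s: "lr_square D a ?u s"
    using assms(1) by blast
  interpret G: computad_map rot_lr_gen D "pick_ob (hcat D) a" "\<lambda>_. a" "\<lambda>_. ?u" "\<lambda>_. s"
    by (rule computad_map_lr[OF s])
  let ?G = "free_ext D (pick_ob (hcat D) a) (\<lambda>_. a) (\<lambda>_. ?u) (\<lambda>_. s)
      :: (_, _, _, (nat, unit, unit, unit) sqterm set, _, _, _, _) dfun"
  have G: "hor ?G (0, [()]) = a" "ver ?G (0, [()]) = ?u" "sqr ?G ?s = s"
    using G.hor_free_ext_edge[of "()"] G.ver_free_ext_edge[of "()"] G.sqr_free_ext_gen[of "()"]
    by (simp_all add: computad_Gsq) (simp_all add: rot_lr_gen_def)
  have pick: "double_functor (VV interval_cat) rot_lr_cod rot_lr_fun"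
    unfolding rot_lr_fun_def
    by (rule double_functor_vertical_pick[OF wf_rot_lr_gen]) (simp_all add: rot_lr_gen_def)
  have "dfun_eq (VV interval_cat) (dfun_comp ?G rot_lr_fun) F"
    using G by (intro VV_interval_dfun_eqI[OF double_functor_comp[OF pick G.double_functor_free_ext] F])
      (simp add: dfun_comp_def rot_lr_fun_def vertical_pick_simps)
  moreover have "dfun_eq rot_lr_cod ?G G'"
    if G': "double_functor rot_lr_cod D G'" "dfun_eq (VV interval_cat) (dfun_comp G' rot_lr_fun) F" for G'
  proof -
    have u: "ver G' (0, [()]) = ?u"
      using G'(2) by (auto simp: dfun_eq_def dfun_comp_def rot_lr_fun_def vertical_pick_simps VV_def Arr_interval_cat)
    then have a: "hor G' (0, [()]) = a" "sqr G' ?s = s"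
      using uniq[OF s] lr_square_rot_lr_cod(1)[OF G'(1)] by metis+
    have src0: "esrc (hgraph rot_lr_gen) e = 0" "esrc (vgraph rot_lr_gen) d = 0"
      "Verts (hgraph rot_lr_gen) = {0, 1}" for e d
      by (simp_all add: rot_lr_gen_def)
    show ?thesis
      by (rule rot_lr.free_dbl_dfun_eqI[OF G.double_functor_free_ext G'(1)])
        (use lr_square_rot_lr_cod(2)[OF G'(1)] lr_square_rot_lr_cod(2)[OF G.double_functor_free_ext] u a G
          in \<open>simp_all add: src0\<close>)
  qed
  ultimately show "\<exists>G. double_functor rot_lr_cod D G \<and> dfun_eq rot_dom (dfun_comp G rot_lr_fun) F \<and>
      (\<forall>G'. double_functor rot_lr_cod D G' \<and> dfun_eq rot_dom (dfun_comp G' rot_lr_fun) F \<longrightarrow>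
        dfun_eq rot_lr_cod G G')"
    using G.double_functor_free_ext by blast
qed

text \<open>Extend the walking isomorphism at \<open>a\<close> to \<open>hiso_cod\<close>. There the
  vertical arrow \<open>(0, 1)\<close> has both rotation squares onto the horizontal
  \<open>(0, 1)\<close>, and their images share the vertical \<open>ver G (0, 1)\<close>.\<close>

lemma hiso_local_companion:
  assumes loc: "is_local hiso_dom hiso_cod hiso_fun D" and a: "iso_arr (hcat D) a"
  shows "\<exists>u s t. lr_square D a u s \<and> ul_square D a u t"
proof -
  obtain b where "a \<in> Arr (hcat D)" "b \<in> Arr (hcat D)" "src (hcat D) b = tgt (hcat D) a"
      "tgt (hcat D) b = src (hcat D) a" "cmp (hcat D) b a = idn (hcat D) (src (hcat D) a)"
      "cmp (hcat D) a b = idn (hcat D) (tgt (hcat D) a)"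
    using a unfolding iso_arr_def by blast
  note F = double_functor_HH[OF category_walking_iso H.cat_functor_pick_walking_iso[OF this]]
  obtain G where G: "double_functor hiso_cod D G" and GF: "dfun_eq hiso_dom (dfun_comp G hiso_fun)
     \<lparr>ob = pick_ob (hcat D) a, hor = pick_arr (hcat D) a b,
       ver = \<lambda>x. idn (vcat D) (pick_ob (hcat D) a x), sqr = \<lambda>m. vid D (pick_arr (hcat D) a b m)\<rparr>"
    using loc[unfolded is_local_def, rule_format, OF F] by blast
  interpret G: double_functor hiso_cod D G by fact
  have ob: "ob G 0 = src (hcat D) a" "ob G 1 = tgt (hcat D) a" and hor: "hor G (0, 1) = a"
    using GF by (auto simp: dfun_eq_def dfun_comp_def hiso_fun_def HH_def Obj_walking_iso Arr_walking_iso
        pick_ob_def pick_arr_def)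
  have idn: "hor G (x, x) = idn (hcat D) (ob G x)" "ver G (x, x) = idn (vcat D) (ob G x)"
    if "x \<in> {0, 1}" for x
    using that G.H.map_idn[of x] G.V.map_idn[of x]
    by (simp_all add: semidirect_def Obj_walking_iso walking_iso_simps)
  \<comment> \<open>In the order top, left, right, bottom, these are the lower-right and the
    upper-left square.\<close>
  have sq: "((0, 1), (0, 1), (1, 1), (1, 1)) \<in> Sq hiso_cod" "((0, 0), (0, 0), (0, 1), (0, 1)) \<in> Sq hiso_cod"
    by (auto simp: semidirect_def Arr_walking_iso walking_iso_simps)
  have "lr_square D a (ver G (0, 1)) (sqr G ((0, 1), (0, 1), (1, 1), (1, 1)))"
    using G.sqr_sq[OF sq(1)] idn[of 1] ob hor by (simp add: lr_square_def semidirect_def)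
  moreover have "ul_square D a (ver G (0, 1)) (sqr G ((0, 0), (0, 0), (0, 1), (0, 1)))"
    using G.sqr_sq[OF sq(2)] idn[of 0] ob hor by (simp add: ul_square_def semidirect_def)
  ultimately show ?thesis
    by blast
qed

end

section \<open>Recognition of classifying double categories\<close>

context double_category
begin

lemma vcomp_corners:
  assumes "a \<in> Sq D" "b \<in> Sq D" "sqtop D b = sqbot D a"
  shows "src (vcat D) (sqleft D b) = tgt (vcat D) (sqleft D a)"
    "src (vcat D) (sqright D b) = tgt (vcat D) (sqright D a)"
  using assms sq_corners by metis+

text \<open>The pasting is a staircase: \<open>s\<close> beside \<open>vid b\<close> has bottom
  \<open>b\<close>, because the bottom of \<open>s\<close> is an identity, and so \<open>t\<close>
  fits underneath.\<close>

lemma lr_square_cmp: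
  assumes s: "lr_square D a u s" and t: "lr_square D b v t" and uv: "src (vcat D) v = tgt (vcat D) u"
  shows "lr_square D (cmp (hcat D) b a) (cmp (vcat D) v u) (vcomp D t (hcomp D (vid D b) s))"
proof -
  note s = lr_square_boundary[OF s] and t = lr_square_boundary[OF t]
  have ba: "src (hcat D) b = tgt (hcat D) a"
    using s t uv by simp
  have row: "hcomp D (vid D b) s \<in> Sq D" "sqleft D (hcomp D (vid D b) s) = u"
    "sqright D (hcomp D (vid D b) s) = idn (vcat D) (tgt (hcat D) b)"
    "sqtop D (hcomp D (vid D b) s) = cmp (hcat D) b a" "sqbot D (hcomp D (vid D b) s) = b"
    using hcomp_sq[of s "vid D b"] vid_sq[OF t(2)] s ba H.cmp_idn_right[OF t(2)] by simp_all
  have "idn (vcat D) (tgt (hcat D) b) \<in> Arr (vcat D)"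
    using t(2) H.tgt_Obj V.idn_Arr same_Obj by simp
  then have "cmp (vcat D) (idn (vcat D) (tgt (hcat D) b)) (idn (vcat D) (tgt (hcat D) b)) = idn (vcat D) (tgt (hcat D) b)"
    using V.cmp_idn_left[of "idn (vcat D) (tgt (hcat D) b)"] t(2) H.tgt_Obj by (simp add: V.tgt_idn same_Obj)
  then show ?thesis
    using vcomp_sq[OF row(1) t(1)] row t s ba by (simp add: lr_square_def H.tgt_cmp)
qed

lemma lr_square_idn:
  assumes "x \<in> Obj (hcat D)"
  shows "lr_square D (idn (hcat D) x) (idn (vcat D) x) (vid D (idn (hcat D) x))"
  using vid_sq[OF H.idn_Arr[OF assms]] assms by (simp add: lr_square_def H.src_idn H.tgt_idn)

end

text \<open>The locality conditions in the form in which they are used. Only lower-right squares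
  appear in \<open>rotate\<close>; the upper-left alternative is brought to this form by
  \<open>lr_square_of_ul_squares\<close>.\<close>

locale rotatable = double_category +
  assumes flat: "\<And>s t. \<lbrakk>s \<in> Sq D; t \<in> Sq D; sqtop D s = sqtop D t; sqbot D s = sqbot D t;
      sqleft D s = sqleft D t; sqright D s = sqright D t\<rbrakk> \<Longrightarrow> s = t"
    and trunc: "\<And>s x y. \<lbrakk>s \<in> Sq D; x \<in> Obj (vcat D); y \<in> Obj (vcat D); sqleft D s = idn (vcat D) x;
      sqright D s = idn (vcat D) y\<rbrakk> \<Longrightarrow> s = vid D (sqtop D s)"
    and groupoid: "\<And>u. u \<in> Arr (vcat D) \<Longrightarrow> iso_arr (vcat D) u"
    and fold: "\<And>a u v s t. \<lbrakk>lr_square D a u s; lr_square D a v t\<rbrakk> \<Longrightarrow> u = v"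
    and companion: "\<And>a. iso_arr (hcat D) a \<Longrightarrow> \<exists>u s t. lr_square D a u s \<and> ul_square D a u t"
    and rotate: "\<And>u. u \<in> Arr (vcat D) \<Longrightarrow> \<exists>a s. lr_square D a u s"
begin

lemma thin_square_top_eq_bot:
  assumes "s \<in> Sq D" "x \<in> Obj (vcat D)" "y \<in> Obj (vcat D)" "sqleft D s = idn (vcat D) x" "sqright D s = idn (vcat D) y"
  shows "sqtop D s = sqbot D s"
  using trunc[OF assms] vid_sq(3)[OF sq_sides(1)[OF assms(1)]] by simp

lemma inverse_arr:
  assumes "u \<in> Arr (vcat D)"
  obtains v where "v \<in> Arr (vcat D)" "src (vcat D) v = tgt (vcat D) u" "tgt (vcat D) v = src (vcat D) u"
    "cmp (vcat D) v u = idn (vcat D) (src (vcat D) u)" "cmp (vcat D) u v = idn (vcat D) (tgt (vcat D) u)"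
  using groupoid[OF assms] unfolding iso_arr_def by blast

text \<open>Pasting a square for the inverse of \<open>u\<close> on top of \<open>q\<close> makes both vertical sides identities.\<close>

lemma cmp_lr_square_left:
  assumes q: "q \<in> Sq D" "sqleft D q = u" "y \<in> Obj (hcat D)" "sqright D q = idn (vcat D) y"
    and s: "lr_square D a u s"
  shows "sqtop D q = cmp (hcat D) (sqbot D q) a"
proof -
  note a = lr_square_boundary[OF s]
  obtain v where v: "v \<in> Arr (vcat D)" "src (vcat D) v = tgt (vcat D) u" "tgt (vcat D) v = src (vcat D) u"
    "cmp (vcat D) v u = idn (vcat D) (src (vcat D) u)" "cmp (vcat D) u v = idn (vcat D) (tgt (vcat D) u)"
    using inverse_arr[OF a(3)] .
  obtain b t where t: "lr_square D b v t"
    using rotate[OF v(1)] by blast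
  note b = lr_square_boundary[OF t]
  let ?k = "sqtop D q"
  have k: "?k \<in> Arr (hcat D)" "src (hcat D) ?k = tgt (hcat D) b" "tgt (hcat D) ?k = y"
    using q sq_sides[OF q(1)] sq_corners[OF q(1)] v b by (simp_all add: V.src_idn same_Obj)
  have Obj: "src (hcat D) a \<in> Obj (vcat D)" "tgt (hcat D) a \<in> Obj (vcat D)" "tgt (hcat D) b \<in> Obj (vcat D)"
    using a(2) b(2) H.src_Obj H.tgt_Obj same_Obj by simp_all
  \<comment> \<open>The rotations of \<open>u\<close> and \<open>v\<close> paste to a square whose
    left side \<open>v\<close> after \<open>u\<close> is an identity, so its top equals its identity
    bottom: \<open>b\<close> is a left inverse of \<open>a\<close>.\<close>
  have ab: "cmp (hcat D) b a = idn (hcat D) (src (hcat D) a)"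
  proof -
    have "lr_square D (cmp (hcat D) b a) (cmp (vcat D) v u) (vcomp D t (hcomp D (vid D b) s))"
      by (rule lr_square_cmp[OF s t v(2)])
    note lr = lr_square_boundary[OF this]
    have "tgt (hcat D) (cmp (hcat D) b a) = src (hcat D) a"
      using a b v by (simp add: H.tgt_cmp)
    then show ?thesis
      using thin_square_top_eq_bot[OF lr(1) Obj(1) Obj(1)] lr v(4) a by simp
  qed
  let ?row = "hcomp D (vid D ?k) t"
  have row: "?row \<in> Sq D" "sqleft D ?row = v" "sqright D ?row = idn (vcat D) y"
    "sqtop D ?row = cmp (hcat D) ?k b" "sqbot D ?row = ?k"
    using hcomp_sq[of t "vid D ?k"] vid_sq[OF k(1)] b k H.cmp_idn_right[OF k(1)] by simp_all
  have "cmp (vcat D) (idn (vcat D) y) (idn (vcat D) y) = idn (vcat D) y"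
    using V.cmp_idn_left[of "idn (vcat D) y"] q(3) V.idn_Arr by (simp add: V.tgt_idn same_Obj)
  \<comment> \<open>With the row on top of \<open>q\<close>, the left side is \<open>u\<close> after
    \<open>v\<close>, an identity. Equality of top and bottom writes the bottom of \<open>q\<close>
    as \<open>?k\<close> after \<open>b\<close>, and composing with \<open>a\<close> cancels
    \<open>b\<close>.\<close>
  then have "sqbot D q = cmp (hcat D) ?k b"
    using thin_square_top_eq_bot[of "vcomp D q ?row" "tgt (vcat D) u" y] vcomp_sq[OF row(1) q(1)] row q v
      a Obj same_Obj by simp
  then have "cmp (hcat D) (sqbot D q) a = cmp (hcat D) ?k (cmp (hcat D) b a)"
    using H.cmp_assoc[of a b ?k] a b k v by simp
  also have "\<dots> = ?k"
    using ab H.cmp_idn_right[OF k(1)] k b v a by simp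
  finally show ?thesis ..
qed

text \<open>Here \<open>'c\<close> and \<open>'b\<close> are the types of vertical and horizontal
  morphisms. The choice is made before uniqueness is known; \<open>rot_eqI\<close> shows that
  \<open>u\<close> determines the result.\<close>

definition rot :: "'c \<Rightarrow> 'b" where
  "rot u = (SOME a. \<exists>s. lr_square D a u s)"

lemma lr_square_rot:
  assumes "u \<in> Arr (vcat D)"
  shows "\<exists>s. lr_square D (rot u) u s"
  using someI_ex[OF rotate[OF assms]] by (simp add: rot_def)

text \<open>Take for \<open>q\<close> in \<open>cmp_lr_square_left\<close> the square that defines
  \<open>rot u\<close>: its bottom is an identity, so its top is \<open>a\<close>.\<close>

lemma rot_eqI:
  assumes s: "lr_square D a u s"
  shows "rot u = a"
proof -
  note a = lr_square_boundary[OF s]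
  obtain t where t: "lr_square D (rot u) u t"
    using lr_square_rot[OF a(3)] by blast
  note r = lr_square_boundary[OF t]
  have "rot u = cmp (hcat D) (idn (hcat D) (tgt (hcat D) a)) a"
    using cmp_lr_square_left[OF r(1,7) _ r(8) s] r a H.tgt_Obj[OF r(2)] by simp
  then show ?thesis
    using H.cmp_idn_left a by simp
qed

lemma rot_functor: "cat_functor (vcat D) (hcat D) (\<lambda>x. x) rot"
proof
  show "x \<in> Obj (hcat D)" if "x \<in> Obj (vcat D)" for x
    using that same_Obj by simp
  show "rot u \<in> Arr (hcat D)" "src (hcat D) (rot u) = src (vcat D) u" "tgt (hcat D) (rot u) = tgt (vcat D) u"
    if "u \<in> Arr (vcat D)" for u
    using lr_square_rot[OF that] lr_square_boundary by metis+
  show "rot (idn (vcat D) x) = idn (hcat D) x" if "x \<in> Obj (vcat D)" for x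
    using rot_eqI[OF lr_square_idn] that same_Obj by simp
  show "rot (cmp (vcat D) v u) = cmp (hcat D) (rot v) (rot u)"
    if "u \<in> Arr (vcat D)" "v \<in> Arr (vcat D)" "src (vcat D) v = tgt (vcat D) u" for u v
    using that lr_square_rot rot_eqI[OF lr_square_cmp] by metis
qed

sublocale rot: cat_functor "vcat D" "hcat D" "\<lambda>x. x" rot
  by (rule rot_functor)

text \<open>Rotated morphisms are isomorphisms because a functor preserves the inverses of the
  vertical groupoid. For surjectivity, \<open>companion\<close> gives a vertical over each
  isomorphism, and \<open>rot_eqI\<close> says that it rotates back to it.\<close>

lemma bij_betw_rot: "bij_betw rot (Arr (vcat D)) {a. iso_arr (hcat D) a}"
  unfolding bij_betw_def
proof (intro conjI equalityI subsetI)
  show "inj_on rot (Arr (vcat D))"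
    by (intro inj_onI) (metis fold lr_square_rot)
  show "a \<in> {a. iso_arr (hcat D) a}" if "a \<in> rot ` Arr (vcat D)" for a
    using that cat_functor_iso_arr[OF rot_functor vcat groupoid] by auto
  show "a \<in> rot ` Arr (vcat D)" if "a \<in> {a. iso_arr (hcat D) a}" for a
    using that companion[of a] rot_eqI lr_square_boundary(3) by (metis image_eqI mem_Collect_eq)
qed

text \<open>The square comes from \<open>companion\<close> at the isomorphism \<open>rot u\<close>
  and a priori has some other vertical side \<open>w\<close>. Its lower-right partner and
  \<open>fold\<close> force \<open>w = u\<close>.\<close>

lemma ul_square_rot:
  assumes "u \<in> Arr (vcat D)"
  shows "\<exists>t. ul_square D (rot u) u t"
proof -
  have "iso_arr (hcat D) (rot u)"
    using bij_betw_rot assms by (auto simp: bij_betw_def)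
  then obtain w s t where "lr_square D (rot u) w s" "ul_square D (rot u) w t"
    using companion by blast
  then show ?thesis
    using fold lr_square_rot[OF assms] by blast
qed

lemma square_commutes:
  assumes s: "s \<in> Sq D"
  shows "cmp (hcat D) (rot (sqright D s)) (sqtop D s) = cmp (hcat D) (sqbot D s) (rot (sqleft D s))"
proof -
  note sides = sq_sides[OF s] and corners = sq_corners[OF s]
  obtain t where "lr_square D (rot (sqright D s)) (sqright D s) t"
    using lr_square_rot[OF sides(4)] by blast
  note t = lr_square_boundary[OF this]
  obtain r where r: "lr_square D (rot (sqleft D s)) (sqleft D s) r"
    using lr_square_rot[OF sides(3)] by blast
  \<comment> \<open>The bottom of \<open>t\<close> is an identity, so pasting it to the right of
    \<open>s\<close> leaves the bottom unchanged while the right side is transferred to the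
    top.\<close>
  have q: "hcomp D t s \<in> Sq D" "sqleft D (hcomp D t s) = sqleft D s"
    "sqright D (hcomp D t s) = idn (vcat D) (tgt (hcat D) (rot (sqright D s)))"
    "sqtop D (hcomp D t s) = cmp (hcat D) (rot (sqright D s)) (sqtop D s)"
    "sqbot D (hcomp D t s) = sqbot D s"
    using hcomp_sq[OF s t(1)] t corners H.cmp_idn_left[OF sides(2)] by simp_all
  show ?thesis
    using cmp_lr_square_left[OF q(1,2) _ q(3) r] q t(2) H.tgt_Obj by simp
qed

lemma square_exists:
  assumes f: "f \<in> Arr (hcat D)" and j: "j \<in> Arr (hcat D)" and g: "g \<in> Arr (vcat D)" and h: "h \<in> Arr (vcat D)"
    and corners: "src (vcat D) g = src (hcat D) f" "src (vcat D) h = tgt (hcat D) f"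
      "tgt (vcat D) g = src (hcat D) j" "tgt (vcat D) h = tgt (hcat D) j"
    and comm: "cmp (hcat D) (rot h) f = cmp (hcat D) j (rot g)"
  shows "\<exists>s \<in> Sq D. sqtop D s = f \<and> sqbot D s = j \<and> sqleft D s = g \<and> sqright D s = h"
proof -
  obtain s where "lr_square D (rot g) g s"
    using lr_square_rot[OF g] by blast
  note s = lr_square_boundary[OF this]
  obtain t where "ul_square D (rot h) h t"
    using ul_square_rot[OF h] by blast
  note t = ul_square_boundary[OF this]
  \<comment> \<open>The two rows meet along the diagonal of the commuting boundary: the upper row
    ends in \<open>f\<close> followed by \<open>rot h\<close>, the lower one starts with
    \<open>rot g\<close> followed by \<open>j\<close>, and \<open>comm\<close> equates them.\<close>
  let ?upper = "hcomp D t (vid D f)" and ?lower = "hcomp D (vid D j) s"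
  have upper: "?upper \<in> Sq D" "sqleft D ?upper = idn (vcat D) (src (vcat D) g)" "sqright D ?upper = h"
    "sqtop D ?upper = f" "sqbot D ?upper = cmp (hcat D) (rot h) f"
    using hcomp_sq[of "vid D f" t] vid_sq[OF f] t corners H.cmp_idn_left[OF f] by simp_all
  have lower: "?lower \<in> Sq D" "sqleft D ?lower = g" "sqright D ?lower = idn (vcat D) (tgt (vcat D) h)"
    "sqtop D ?lower = cmp (hcat D) j (rot g)" "sqbot D ?lower = j"
    using hcomp_sq[of s "vid D j"] vid_sq[OF j] s corners H.cmp_idn_right[OF j] by simp_all
  show ?thesis
    using vcomp_sq[OF upper(1) lower(1)] upper lower comm V.cmp_idn_right[OF g] V.cmp_idn_left[OF h]
    by (intro bexI[of _ "vcomp D ?lower ?upper"]) simp_all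
qed

text \<open>The double functor records the boundary of a square with its vertical sides rotated. On
  squares it is injective by \<open>flat\<close> and injectivity of \<open>rot\<close>, and
  surjective by \<open>square_exists\<close>.\<close>

lemma isomorphic_classifying: "dbl_isomorphic D (classifying (hcat D))"
proof -
  let ?E = "classifying (hcat D)"
  let ?F = "\<lparr>ob = \<lambda>x. x, hor = \<lambda>f. f, ver = rot,
    sqr = \<lambda>s. (sqtop D s, rot (sqleft D s), rot (sqright D s), sqbot D s)\<rparr>"
  note defs = classifying_def semidirect_def iso_cat_def
  have iso: "iso_arr (hcat D) (rot u)" if "u \<in> Arr (vcat D)" for u
    using that bij_betw_rot by (auto simp: bij_betw_def)
  have E: "hcat ?E = hcat D" "Arr (vcat ?E) = {a. iso_arr (hcat D) a}" "Obj (vcat ?E) = Obj (hcat D)"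
    by (simp_all add: defs)
  have Sq: "(sqtop D s, rot (sqleft D s), rot (sqright D s), sqbot D s) \<in> Sq ?E" if "s \<in> Sq D" for s
    using sq_sides[OF that] sq_corners[OF that] square_commutes[OF that]
    by (simp add: defs iso rot.map_src rot.map_tgt)
  note functor_simps = rot.map_Obj rot.map_Arr rot.map_src rot.map_tgt rot.map_idn rot.map_cmp iso
    sq_sides sq_corners hid_sq vid_sq hcomp_sq vcomp_sq
  have F: "double_functor D ?E ?F"
  proof (rule double_functor.intro)
    show "cat_functor (hcat D) (hcat ?E) (ob ?F) (hor ?F)"
      unfolding E by unfold_locales simp_all
    show "cat_functor (vcat D) (vcat ?E) (ob ?F) (ver ?F)"
      unfolding defs by unfold_locales (simp_all add: functor_simps same_Obj)
    show "cat_functor (hsq_cat D) (hsq_cat ?E) (ver ?F) (sqr ?F)"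
      using Sq unfolding hsq_cat_def
      by unfold_locales (simp_all add: defs functor_simps)
    show "cat_functor (vsq_cat D) (vsq_cat ?E) (hor ?F) (sqr ?F)"
      using Sq unfolding vsq_cat_def
      by unfold_locales (simp_all add: defs functor_simps vcomp_corners H.src_Obj H.tgt_Obj same_Obj)
  qed
  have inj: "inj_on rot (Arr (vcat D))"
    using bij_betw_rot by (simp add: bij_betw_def)
  have "bij_betw (sqr ?F) (Sq D) (Sq ?E)"
    unfolding bij_betw_def
  proof (intro conjI equalityI subsetI)
    show "inj_on (sqr ?F) (Sq D)"
      by (intro inj_onI flat) (auto simp: sq_sides inj_on_eq_iff[OF inj])
    show "p \<in> Sq ?E" if "p \<in> sqr ?F ` Sq D" for p
      using that Sq by auto
    show "p \<in> sqr ?F ` Sq D" if p: "p \<in> Sq ?E" for p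
    proof -
      obtain f g' h' j where p': "p = (f, g', h', j)" "f \<in> Arr (hcat D)" "j \<in> Arr (hcat D)"
        "iso_arr (hcat D) g'" "iso_arr (hcat D) h'"
        "src (hcat D) g' = src (hcat D) f" "src (hcat D) h' = tgt (hcat D) f"
        "tgt (hcat D) g' = src (hcat D) j" "tgt (hcat D) h' = tgt (hcat D) j"
        "cmp (hcat D) h' f = cmp (hcat D) j g'"
        using p by (auto simp: defs)
      obtain g h where gh: "g \<in> Arr (vcat D)" "h \<in> Arr (vcat D)" "g' = rot g" "h' = rot h"
        using p'(4,5) bij_betw_rot unfolding bij_betw_def by blast
      obtain s where "s \<in> Sq D" "sqtop D s = f" "sqbot D s = j" "sqleft D s = g" "sqright D s = h"
        using square_exists[of f j g h] p' gh by (auto simp: rot.map_src rot.map_tgt)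
      then show ?thesis
        using p'(1) gh by (auto intro!: image_eqI[of _ _ s])
    qed
  qed
  then show ?thesis
    using bij_betw_rot by (intro dbl_isomorphicI[OF double_category_axioms F]) (simp_all add: E bij_betw_def)
qed

end

section \<open>From upper-left to lower-right rotation squares\<close>

context double_category
begin

text \<open>Paste \<open>vid a\<close> to the left of the square rotating the inverse of \<open>u\<close>, and put \<open>hid u\<close> below.\<close>

lemma lr_square_of_ul_squares:
  assumes groupoid: "\<And>u. u \<in> Arr (vcat D) \<Longrightarrow> iso_arr (vcat D) u"
    and trunc: "\<And>s x y. \<lbrakk>s \<in> Sq D; x \<in> Obj (vcat D); y \<in> Obj (vcat D); sqleft D s = idn (vcat D) x;
      sqright D s = idn (vcat D) y\<rbrakk> \<Longrightarrow> s = vid D (sqtop D s)"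
    and rotate: "\<And>u. u \<in> Arr (vcat D) \<Longrightarrow> \<exists>a s. ul_square D a u s"
    and u: "u \<in> Arr (vcat D)"
  shows "\<exists>a s. lr_square D a u s"
proof -
  obtain v where v: "v \<in> Arr (vcat D)" "src (vcat D) v = tgt (vcat D) u" "tgt (vcat D) v = src (vcat D) u"
    "cmp (vcat D) v u = idn (vcat D) (src (vcat D) u)" "cmp (vcat D) u v = idn (vcat D) (tgt (vcat D) u)"
    using groupoid[OF u] unfolding iso_arr_def by blast
  obtain a s b t where "ul_square D a u s" "ul_square D b v t"
    using rotate[OF u] rotate[OF v(1)] by blast
  note s = ul_square_boundary[OF this(1)] and t = ul_square_boundary[OF this(2)]
  have Obj: "src (hcat D) a \<in> Obj (vcat D)" "tgt (hcat D) a \<in> Obj (vcat D)"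
    using s(2) H.src_Obj H.tgt_Obj same_Obj by simp_all
  let ?row = "hcomp D t (vid D a)"
  have row: "?row \<in> Sq D" "sqleft D ?row = idn (vcat D) (src (hcat D) a)" "sqright D ?row = v"
    "sqtop D ?row = a" "sqbot D ?row = cmp (hcat D) b a"
    using hcomp_sq[of "vid D a" t] vid_sq[OF s(2)] s t v H.cmp_idn_left[OF s(2)] by simp_all
  \<comment> \<open>Below \<open>s\<close> the row has vertical sides that compose to identities, so
    \<open>trunc\<close> equates its bottom with the identity on top of \<open>s\<close>.\<close>
  have ba: "cmp (hcat D) b a = idn (hcat D) (src (hcat D) a)"
  proof -
    have glue: "sqtop D ?row = sqbot D s"
      using row s by simp
    have "cmp (vcat D) (idn (vcat D) (src (hcat D) a)) (idn (vcat D) (src (hcat D) a)) = idn (vcat D) (src (hcat D) a)"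
      using V.cmp_idn_left[OF V.idn_Arr[OF Obj(1)]] V.tgt_idn[OF Obj(1)] by simp
    then have q: "vcomp D ?row s \<in> Sq D" "sqleft D (vcomp D ?row s) = idn (vcat D) (src (hcat D) a)"
      "sqright D (vcomp D ?row s) = idn (vcat D) (src (hcat D) a)"
      "sqtop D (vcomp D ?row s) = idn (hcat D) (src (hcat D) a)" "sqbot D (vcomp D ?row s) = cmp (hcat D) b a"
      using vcomp_sq[OF s(1) row(1) glue] row s v by simp_all
    show ?thesis
      using trunc[OF q(1) Obj(1) Obj(1) q(2,3)] vid_sq(3)[OF sq_sides(1)[OF q(1)]] q by simp
  qed
  \<comment> \<open>By \<open>ba\<close> the row ends in an identity, which is the top of
    \<open>hid D u\<close>. Below the row, \<open>hid D u\<close> makes the left side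
    \<open>u\<close> and cancels \<open>v\<close> on the right.\<close>
  have glue: "sqtop D (hid D u) = sqbot D ?row"
    using hid_sq[OF u] row ba s by simp
  have "lr_square D a u (vcomp D (hid D u) ?row)"
    using vcomp_sq[OF row(1) hid_sq(1)[OF u] glue] hid_sq[OF u] row s v V.cmp_idn_right[OF u]
    by (simp add: lr_square_def)
  then show ?thesis
    by blast
qed

end

section \<open>Locality of classifying double categories\<close>

lemma (in category) classifying_simps:
  "hcat (classifying C) = C" "Obj (vcat (classifying C)) = Obj C" "Arr (vcat (classifying C)) = {f. iso_arr C f}"
  "idn (vcat (classifying C)) = idn C" "src (vcat (classifying C)) = src C" "tgt (vcat (classifying C)) = tgt C"
  "cmp (vcat (classifying C)) = cmp C"
  "(f, g, h, j) \<in> Sq (classifying C) \<longleftrightarrow> f \<in> Arr C \<and> j \<in> Arr C \<and> iso_arr C g \<and> iso_arr C h \<and>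
     src C g = src C f \<and> src C h = tgt C f \<and> tgt C g = src C j \<and> tgt C h = tgt C j \<and> cmp C h f = cmp C j g"
  "sqtop (classifying C) (f, g, h, j) = f" "sqleft (classifying C) (f, g, h, j) = g"
  "sqright (classifying C) (f, g, h, j) = h" "sqbot (classifying C) (f, g, h, j) = j"
  "vid (classifying C) f = (f, idn C (src C f), idn C (tgt C f), f)"
  by (simp_all add: classifying_def semidirect_def iso_cat_def)

text \<open>With identities on the right and at the bottom, commutativity of the square reads
  \<open>a = u\<close>: rotation in \<open>classifying C\<close> is the inclusion of
  isomorphisms.\<close>

lemma (in category) lr_square_classifying:
  "lr_square (classifying C) a u s \<longleftrightarrow>
    iso_arr C u \<and> a = u \<and> s = (u, u, idn C (tgt C u), idn C (tgt C u))" (is "?L \<longleftrightarrow> ?R")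
proof
  obtain f g h j where s: "s = (f, g, h, j)"
    by (cases s)
  show ?R if ?L
  proof -
    have fghj: "f = a" "g = u" "h = idn C (tgt C a)" "j = idn C (tgt C a)"
      using that unfolding s lr_square_def by (simp_all add: classifying_simps)
    have "(f, g, h, j) \<in> Sq (classifying C)"
      using that unfolding s lr_square_def by blast
    then have sq: "a \<in> Arr C" "iso_arr C u" "tgt C u = src C (idn C (tgt C a))"
      "cmp C (idn C (tgt C a)) a = cmp C (idn C (tgt C a)) u"
      unfolding classifying_simps fghj by blast+
    have "tgt C u = tgt C a"
      using sq(3) unfolding src_idn[OF tgt_Obj[OF sq(1)]] .
    moreover from this have "a = u"
      using sq(4) cmp_idn_left[OF sq(1)] cmp_idn_left[of u] sq(2) by (simp add: iso_arr_def)
    ultimately show ?thesis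
      using fghj sq(2) unfolding s by simp
  qed
  show ?L if iso: ?R
  proof -
    have u: "u \<in> Arr C" and t: "tgt C u \<in> Obj C"
      using iso tgt_Obj by (auto simp: iso_arr_def)
    have "iso_arr C (idn C (tgt C u))"
      using category.idn_Arr[OF category_iso_cat, of "tgt C u"] t by (simp add: iso_cat_def)
    then show ?thesis
      using iso u t by (simp add: lr_square_def classifying_simps idn_Arr src_idn tgt_idn)
  qed
qed

text \<open>All values of a functor on the walking isomorphism are isomorphisms, so its arrow part
  also serves as the vertical part of an extension.\<close>

lemma (in category) hiso_local_classifying: "is_local hiso_dom hiso_cod hiso_fun (classifying C)"
  unfolding is_local_def
proof (intro allI impI)
  fix F assume F: "double_functor hiso_dom (classifying C) F"
  interpret F: double_functor hiso_dom "classifying C" F by fact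
  have h: "cat_functor walking_iso C (ob F) (hor F)"
    using F.hor_functor by (simp add: HH_def classifying_simps)
  interpret h: cat_functor walking_iso C "ob F" "hor F" by (rule h)
  have "iso_arr C (hor F f)" if "f \<in> Arr walking_iso" for f
    using cat_functor_iso_arr[OF h category_walking_iso iso_arr_walking_iso[OF that]] .
  then have v: "cat_functor walking_iso (iso_cat C) (ob F) (hor F)"
    by unfold_locales
      (simp_all add: iso_cat_def h.map_Obj h.map_Arr h.map_src h.map_tgt h.map_idn h.map_cmp)
  have "cat_functor walking_iso walking_iso (\<lambda>x. x) (\<lambda>f. f)"
    by unfold_locales simp_all
  note G = double_functor_semidirect[OF h v category_walking_iso category_walking_iso refl this,
      where F' = "\<lambda>f. f", OF refl, folded classifying_def]
  have "dfun_eq hiso_dom (dfun_comp \<lparr>ob = ob F, hor = hor F, ver = hor F,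
      sqr = \<lambda>(f, g, h, j). (hor F f, hor F g, hor F h, hor F j)\<rparr> hiso_fun) F"
  proof -
    have "ver F x = idn C (ob F x)" if "x \<in> Obj walking_iso" for x
      using F.V.map_idn[of x] that by (simp add: HH_def discrete_cat_def classifying_simps)
    moreover have "sqr F f = vid (classifying C) (hor F f)" if "f \<in> Arr walking_iso" for f
      using F.sqr_vid[of f] that by (simp add: HH_def)
    ultimately show ?thesis
      using category.src_Obj[OF category_walking_iso] category.tgt_Obj[OF category_walking_iso]
      by (simp add: dfun_eq_def dfun_comp_def hiso_fun_def HH_def discrete_cat_def h.map_idn semidirect_def
          classifying_simps h.map_src h.map_tgt)
  qed
  then show "\<exists>G. double_functor hiso_cod (classifying C) G \<and> dfun_eq hiso_dom (dfun_comp G hiso_fun) F"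
    using G by blast
qed

lemma (in category) classifying_local:
  "is_local simp_dom walking_square simp_fun (classifying C)"
  "is_local trunc_h_dom trunc_h_cod trunc_h_fun (classifying C)"
  "is_local (VV interval_cat) (VV walking_iso) inv_fun (classifying C)"
  "is_local rotfold_dom rot_lr_cod rotfold_fun (classifying C)"
  "is_strictly_local rot_dom rot_lr_cod rot_lr_fun (classifying C)"
proof -
  interpret K: double_category "classifying C" by (rule double_category_classifying)
  \<comment> \<open>The inverse must itself be a vertical morphism, that is, an isomorphism;
    \<open>u\<close> is its inverse.\<close>
  have "iso_arr (vcat (classifying C)) u" if u: "iso_arr C u" for u
  proof -
    obtain v where v: "v \<in> Arr C" "src C v = tgt C u" "tgt C v = src C u"
      "cmp C v u = idn C (src C u)" "cmp C u v = idn C (tgt C u)"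
      using u by (auto simp: iso_arr_def)
    moreover have "iso_arr C v"
      using u v by (auto simp: iso_arr_def intro!: bexI[of _ u])
    ultimately show ?thesis
      using that by (auto simp: iso_arr_def[of "vcat (classifying C)"] classifying_simps intro!: bexI[of _ v])
  qed
  then show "is_local (VV interval_cat) (VV walking_iso) inv_fun (classifying C)"
    unfolding K.inv_local_iff by (simp add: classifying_simps)
  have "s = vid (classifying C) (sqtop (classifying C) s)"
    if "s \<in> Sq (classifying C)" "x \<in> Obj C" "y \<in> Obj C" "sqleft (classifying C) s = idn C x"
      "sqright (classifying C) s = idn C y" for s x y
  proof -
    obtain f g h j where s: "s = (f, g, h, j)"
      by (cases s)
    \<comment> \<open>The corners show that the sides are the identities at the ends of both
      \<open>f\<close> and \<open>j\<close>, so commutativity collapses to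
      \<open>f = j\<close>.\<close>
    have "src C f = x" "tgt C f = y" "src C j = x"
      using that unfolding s by (auto simp: classifying_simps src_idn tgt_idn)
    then show ?thesis
      using that cmp_idn_left[of f] cmp_idn_right[of j] unfolding s by (auto simp: classifying_simps)
  qed
  then show "is_local trunc_h_dom trunc_h_cod trunc_h_fun (classifying C)"
    unfolding K.trunc_h_local_iff by (simp add: classifying_simps)
  have "s = t" if "s \<in> Sq (classifying C)" "t \<in> Sq (classifying C)"
    "sqtop (classifying C) s = sqtop (classifying C) t" "sqbot (classifying C) s = sqbot (classifying C) t"
    "sqleft (classifying C) s = sqleft (classifying C) t" "sqright (classifying C) s = sqright (classifying C) t" for s t
    using that by (cases s; cases t) (simp add: classifying_simps)
  then show "is_local simp_dom walking_square simp_fun (classifying C)"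
    unfolding K.simp_local_iff by blast
  show "is_local rotfold_dom rot_lr_cod rotfold_fun (classifying C)"
    unfolding K.rotfold_local_iff by (simp add: lr_square_classifying)
  show "is_strictly_local rot_dom rot_lr_cod rot_lr_fun (classifying C)"
    by (rule K.rot_lr_strictly_localI) (simp_all add: classifying_simps lr_square_classifying)
qed

section \<open>The characterization of classifying double categories\<close>

theorem corollary3p25:
  fixes D :: "('o, 'h, 'v, 's) dblcat"
  assumes "double_category D"
  shows "dbl_isomorphic D (classifying (hcat D)) \<longleftrightarrow>
      is_local simp_dom walking_square simp_fun D \<and>
      is_local trunc_h_dom trunc_h_cod trunc_h_fun D \<and>
      is_local (VV interval_cat) (VV walking_iso) inv_fun D \<and>
      is_local rotfold_dom rot_lr_cod rotfold_fun D \<and>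
      is_local hiso_dom hiso_cod hiso_fun D \<and>
      (is_strictly_local rot_dom rot_lr_cod rot_lr_fun D \<or>
       is_strictly_local rot_dom rot_ul_cod rot_ul_fun D)"
    (is "?iso \<longleftrightarrow> ?local")
proof
  interpret double_category D by fact
  show ?local if ?iso
  proof (intro conjI disjI1)
    note local = is_local_iso[OF that]
    show "is_local simp_dom walking_square simp_fun D"
      by (rule local[OF H.classifying_local(1)])
    show "is_local trunc_h_dom trunc_h_cod trunc_h_fun D"
      by (rule local[OF H.classifying_local(2)])
    show "is_local (VV interval_cat) (VV walking_iso) inv_fun D"
      by (rule local[OF H.classifying_local(3)])
    show "is_local rotfold_dom rot_lr_cod rotfold_fun D"
      by (rule local[OF H.classifying_local(4)])
    show "is_local hiso_dom hiso_cod hiso_fun D"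
      by (rule local[OF H.hiso_local_classifying])
    \<comment> \<open>Of the two rotation conditions the lower-right one is established, since
      \<open>lr_square_classifying\<close> gives its squares explicitly.\<close>
    show "is_strictly_local rot_dom rot_lr_cod rot_lr_fun D"
      by (rule is_strictly_local_iso[OF that H.classifying_local(5)])
  qed
  show ?iso if loc: ?local
  proof -
    have inv: "\<And>u. u \<in> Arr (vcat D) \<Longrightarrow> iso_arr (vcat D) u"
      and trunc: "\<And>s x y. \<lbrakk>s \<in> Sq D; x \<in> Obj (vcat D); y \<in> Obj (vcat D); sqleft D s = idn (vcat D) x;
        sqright D s = idn (vcat D) y\<rbrakk> \<Longrightarrow> s = vid D (sqtop D s)"
      using loc unfolding inv_local_iff trunc_h_local_iff by blast+
    have flat: "\<And>s t. \<lbrakk>s \<in> Sq D; t \<in> Sq D; sqtop D s = sqtop D t; sqbot D s = sqbot D t;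
        sqleft D s = sqleft D t; sqright D s = sqright D t\<rbrakk> \<Longrightarrow> s = t"
      and fold: "\<And>a u v s t. \<lbrakk>lr_square D a u s; lr_square D a v t\<rbrakk> \<Longrightarrow> u = v"
      using loc unfolding simp_local_iff rotfold_local_iff by blast+
    have companion: "\<And>a. iso_arr (hcat D) a \<Longrightarrow> \<exists>u s t. lr_square D a u s \<and> ul_square D a u t"
      using hiso_local_companion loc by blast
    have "is_local rot_dom rot_lr_cod rot_lr_fun D \<or> is_local rot_dom rot_ul_cod rot_ul_fun D"
      using loc unfolding is_local_def is_strictly_local_def by blast
    \<comment> \<open>Either alternative yields lower-right squares, the upper-left one by pasting
      with the inverse vertical.\<close>
    then have rotate: "\<exists>a s. lr_square D a u s" if "u \<in> Arr (vcat D)" for u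
    proof
      assume "is_local rot_dom rot_lr_cod rot_lr_fun D"
      then show ?thesis
        using rot_lr_local_lr_square that by blast
    next
      assume "is_local rot_dom rot_ul_cod rot_ul_fun D"
      then have ul: "\<exists>a s. ul_square D a v s" if "v \<in> Arr (vcat D)" for v
        using rot_ul_local_ul_square that by blast
      show ?thesis
        by (rule lr_square_of_ul_squares) (fact inv trunc ul that)+
    qed
    interpret rotatable D
      by unfold_locales (fact flat trunc inv fold companion rotate)+
    show ?iso
      by (rule isomorphic_classifying)
  qed
qed

end
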